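(* Let $d\ge2$ and let $(E_n,F_n,G_n,H_n)$ be a sequence of positive quadruples of flags in $\mathbb{R}^d$ whose ultralimit $(E,F,G,H)$, a quadruple of flags in $\mathbb{F}^d$, is positive. Let $Z_i:=\operatorname{ulim}Z_i(E_n,F_n,G_n,H_n)\in\mathbb{F}_{>0}$ for $0<i<d$. Let $f_{EG}$ and $f'_{EG}$ be the preferred markings of the apartment $\mathcal{A}_{EG}$ of $\mathcal{B}_d$ determined by the sequences of triples containing $F_n$ and $H_n$ respectively (as defined in the context). Then the element $w_{(E,F,G,H)}:=f_{EG}^{-1}\circ f'_{EG}$ of the affine Weyl group $W_{\mathrm{aff}}$ is the translation of $\mathbb{A}^{d-1}$ by the unique vector $(x_1,\dots,x_d)\in\mathbb{V}^{d-1}$ such that $$x_{i+1}-x_i=v(Z_{d-i})\qquad\text{for } i=1,\dots,d-1.$$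
   Context: **The field $\mathbb{F}$.** Fix a non-principal ultrafilter $\omega$ on $\mathbb{N}$ and a real sequence $\lambda_n\ge 1$ with $\lambda_n\to\infty$. $\mathbb{F}$ is the set of real sequences $(x_n)$ with $\lim_\omega|x_n|^{1/\lambda_n}<\infty$, modulo $(x_n)\sim(y_n)$ iff $\lim_\omega|x_n-y_n|^{1/\lambda_n}=0$; it is a field under termwise operations. The class of $(x_n)$ is denoted $\operatorname{ulim}x_n$. The valuation is $v(x)=-\lim_\omega\log|x_n|^{1/\lambda_n}\in\mathbb{R}\cup\{\infty\}$, and $|x|_v=e^{-v(x)}$. $\mathbb{F}$ is ordered by $[x_n]\ge[y_n]$ if (for suitable representatives) $x_n\ge y_n$ for $\omega$-almost every $n$; $\mathbb{F}_{\ge0}=\{x\ge0\}$, $\mathbb{F}_{>0}=\mathbb{F}_{\ge0}\setminus\{0\}$. A sequence of vectors in $\mathbb{R}^d$ or $(\mathbb{R}^d)^*$ whose coordinates define elements of $\mathbb{F}$ has as ultralimit the vector of ultralimits of the coordinates. **Flags.** A flag $F$ in $K^d$ ($K=\mathbb{R}$ or $\mathbb{F}$) is a chain $0=F^{(0)}\subset F^{(1)}\subset\dots\subset F^{(d)}=K^d$ of subspaces with $\dim F^{(i)}=i$. A tuple $(F_1,\dots,F_t)$ of flags has the maximum span property if $\dim(F_1^{(a_1)}+\dots+F_t^{(a_t)})=\min\{a_1+\dots+a_t,d\}$ for all integers $0\le a_1,\dots,a_t\le d$. For flags in $\mathbb{R}^d$ with the maximum span property let $e^{(i)}$ be any non-zero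 element of $\bigwedge^iE^{(i)}$ (similarly for $F,G,H$) and identify $\bigwedge^d\mathbb{R}^d\cong\mathbb{R}$. Triple ratios ($a,b,c\ge1$, $a+b+c=d$): $$X_{a,b,c}(E,F,G)=\frac{e^{(a-1)}\wedge f^{(b)}\wedge g^{(c+1)}}{e^{(a+1)}\wedge f^{(b)}\wedge g^{(c-1)}}\cdot\frac{e^{(a)}\wedge f^{(b+1)}\wedge g^{(c-1)}}{e^{(a)}\wedge f^{(b-1)}\wedge g^{(c+1)}}\cdot\frac{e^{(a+1)}\wedge f^{(b-1)}\wedge g^{(c)}}{e^{(a-1)}\wedge f^{(b+1)}\wedge g^{(c)}}.$$ Double ratios ($0<i<d$): $$Z_i(E,F,G,H)=-\frac{e^{(i)}\wedge g^{(d-i-1)}\wedge f^{(1)}}{e^{(i)}\wedge g^{(d-i-1)}\wedge h^{(1)}}\cdot\frac{e^{(i-1)}\wedge g^{(d-i)}\wedge h^{(1)}}{e^{(i-1)}\wedge g^{(d-i)}\wedge f^{(1)}}.$$ A quadruple $(E,F,G,H)$ in $\mathbb{R}^d$ is positive if it has the maximum span property and all $X_{a,b,c}(E,F,G)$, $X_{a,b,c}(E,G,H)$, $Z_i(E,F,G,H)$ are positive. **Ultralimits of flags.** The ultralimit of a sequence $F_n$ of flags in $\mathbb{R}^d$ is the (unique) flag $F$ in $\mathbb{F}^d$ for which there are bases $(v_{1,n},\dots,v_{d,n})$ of $\mathbb{R}^d$ and a basis $(v_1,\dots,v_d)$ of $\mathbb{F}^d$ with $\operatorname{ulim}v_{i,n}=v_i$,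 $F_n^{(i)}=\mathrm{Span}(v_{1,n},\dots,v_{i,n})$ and $F^{(i)}=\mathrm{Span}(v_1,\dots,v_i)$. The ultralimit $(E,F,G,H)$ is positive if it has the maximum span property and the sequences $X_{a,b,c}(E_n,F_n,G_n)$, $X_{a,b,c}(E_n,G_n,H_n)$, $Z_i(E_n,F_n,G_n,H_n)$ all define (non-zero, finite) elements of $\mathbb{F}_{>0}$. **The building.** $\mathbb{A}^{d-1}=\{x\in\mathbb{R}^d:\sum x_i=1\}$, $\mathbb{V}^{d-1}=\{x\in\mathbb{R}^d:\sum x_i=0\}$, $W_{\mathrm{aff}}=\mathfrak{S}_d\ltimes\mathbb{V}^{d-1}$ acts on $\mathbb{A}^{d-1}$ by permutations of coordinates and translations. Let $V=(\mathbb{F}^d)^*$. An ultrametric norm on $V$ is $\eta\colon V\to\mathbb{R}$ with $\eta(w)=0$ iff $w=0$, $\eta(xw)=|x|_v\eta(w)$, $\eta(w+z)\le\max\{\eta(w),\eta(z)\}$. It is adapted to a basis $(e_1,\dots,e_d)$ if $\eta(\sum x_je_j)=\max_j|x_j|_v\eta(e_j)$, and adaptable if adapted to some basis. $\eta,\eta'$ are homothetic if $\eta(w)=\eta'(xw)$ for all $w$, for some $x\in\mathbb{F}\setminus\{0\}$. $\mathcal{B}_d$ is the set of homothety classes of adaptable norms. For a basis $\mathcal{E}=(e_1,\dots,e_d)$ the standard marking $f_{\mathcal{E}}\colon\mathbb{A}^{d-1}\to\mathcal{B}_d$ sends $x$ to the class of the norm adapted to $\mathcal{E}$ with $\eta(e_j)=e^{-x_j}$;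 its image is an apartment, depending only on the line decomposition $\{\mathrm{Span}(e_i)\}$. $\mathcal{A}_{EG}$ is the apartment of the line decomposition $L_i=(E^{(d-i)}\oplus G^{(i-1)})^\perp$, $i=1,\dots,d$, of $V$, where $\perp$ denotes annihilator. **Preferred markings.** Let $K_n$ be $F_n$ or $H_n$. For each $n$ choose a non-zero $u_{1,n}\in(E_n^{(d-1)})^\perp\subset(\mathbb{R}^d)^*$, so that $\operatorname{ulim}u_{1,n}$ exists and is non-zero, and define recursively $u_{i+1,n}$ as the unique element of $(E_n^{(d-i-1)}\oplus G_n^{(i)})^\perp$ such that $u_{i,n}+u_{i+1,n}\in(E_n^{(d-i-1)}\oplus K_n^{(1)}\oplus G_n^{(i-1)})^\perp$, $1\le i<d$. The ultralimits $u_i=\operatorname{ulim}u_{i,n}$ are non-zero, form a basis of $V$ with $u_i\in L_i$, and the standard marking $f_{(u_i)}$ of $\mathcal{A}_{EG}$ is independent of the choice of $u_{1,n}$. It is denoted $f_{EG}$ for $K_n=F_n$ and $f'_{EG}$ for $K_n=H_n$. *)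

theory Defs
  imports "HOL-Library.Extended_Real" "HOL-Algebra.QuotRing" "Jordan_Normal_Form.VS_Connect"
begin

section \<open>The field of ultralimits\<close>

definition nonprincipal_ultrafilter :: "nat filter \<Rightarrow> bool" where
  "nonprincipal_ultrafilter U \<longleftrightarrow>
     U \<noteq> bot \<and>
     (\<forall>P. eventually P U \<or> eventually (\<lambda>n. \<not> P n) U) \<and>
     (\<forall>m. \<not> eventually (\<lambda>n. n = m) U)"

text \<open>Limits along the ultrafilter are taken in the extended reals, where they always exist.\<close>

definition growth :: "nat filter \<Rightarrow> (nat \<Rightarrow> real) \<Rightarrow> (nat \<Rightarrow> real) \<Rightarrow> ereal" where
  "growth U l x = Lim U (\<lambda>n. ereal (\<bar>x n\<bar> powr (1 / l n)))"

definition moderate :: "nat filter \<Rightarrow> (nat \<Rightarrow> real) \<Rightarrow> (nat \<Rightarrow> real) set" where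
  "moderate U l = {x. growth U l x < \<infinity>}"

definition negligible :: "nat filter \<Rightarrow> (nat \<Rightarrow> real) \<Rightarrow> (nat \<Rightarrow> real) set" where
  "negligible U l = {x. growth U l x = 0}"

definition moderate_ring :: "nat filter \<Rightarrow> (nat \<Rightarrow> real) \<Rightarrow> (nat \<Rightarrow> real) ring" where
  "moderate_ring U l =
     \<lparr>carrier = moderate U l, mult = (\<lambda>x y n. x n * y n), one = (\<lambda>n. 1),
      zero = (\<lambda>n. 0), add = (\<lambda>x y n. x n + y n)\<rparr>"

definition asym_field :: "nat filter \<Rightarrow> (nat \<Rightarrow> real) \<Rightarrow> (nat \<Rightarrow> real) set ring" where
  "asym_field U l = moderate_ring U l Quot negligible U l"

text \<open>The class of a sequence; it is an element of \<^const>\<open>asym_field\<close> only for moderate sequences,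
  so ``\<open>x\<close> defines an element of the field'' is \<open>x \<in> moderate U l\<close>.\<close>

definition ulim :: "nat filter \<Rightarrow> (nat \<Rightarrow> real) \<Rightarrow> (nat \<Rightarrow> real) \<Rightarrow> (nat \<Rightarrow> real) set" where
  "ulim U l x = negligible U l +>\<^bsub>moderate_ring U l\<^esub> x"

definition val_seq :: "nat filter \<Rightarrow> (nat \<Rightarrow> real) \<Rightarrow> (nat \<Rightarrow> real) \<Rightarrow> ereal" where
  "val_seq U l x =
     - Lim U (\<lambda>n. if x n = 0 then -\<infinity> else ereal (ln (\<bar>x n\<bar> powr (1 / l n))))"

text \<open>\<^const>\<open>val_seq\<close> is constant on each class, and \<^const>\<open>the_elem\<close> picks this constant.\<close>

definition val :: "nat filter \<Rightarrow> (nat \<Rightarrow> real) \<Rightarrow> (nat \<Rightarrow> real) set \<Rightarrow> ereal" where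
  "val U l X = the_elem (val_seq U l ` X)"

definition absv :: "nat filter \<Rightarrow> (nat \<Rightarrow> real) \<Rightarrow> (nat \<Rightarrow> real) set \<Rightarrow> real" where
  "absv U l X = (if val U l X = \<infinity> then 0 else exp (- real_of_ereal (val U l X)))"

definition asym_ge :: "nat filter \<Rightarrow> (nat \<Rightarrow> real) set \<Rightarrow> (nat \<Rightarrow> real) set \<Rightarrow> bool" where
  "asym_ge U X Y \<longleftrightarrow> (\<exists>x\<in>X. \<exists>y\<in>Y. eventually (\<lambda>n. x n \<ge> y n) U)"

definition asym_pos :: "nat filter \<Rightarrow> (nat \<Rightarrow> real) \<Rightarrow> (nat \<Rightarrow> real) set set" where
  "asym_pos U l =
     {X \<in> carrier (asym_field U l). asym_ge U X \<zero>\<^bsub>asym_field U l\<^esub>} - {\<zero>\<^bsub>asym_field U l\<^esub>}"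

section \<open>Vectors and flags\<close>

text \<open>\<open>K\<^sup>d\<close> is the space of functions on \<open>{1..d}\<close>. The dual space is identified with it by
  coordinates in the dual basis, via the pairing below.\<close>

abbreviation coord_space :: "'a ring \<Rightarrow> nat \<Rightarrow> ('a, nat \<Rightarrow> 'a) module" where
  "coord_space K d \<equiv> ring.func_space K {1..d}"

abbreviation real_field :: "real ring" where
  "real_field \<equiv> class_ring"

definition pairing :: "'a ring \<Rightarrow> nat \<Rightarrow> (nat \<Rightarrow> 'a) \<Rightarrow> (nat \<Rightarrow> 'a) \<Rightarrow> 'a" where
  "pairing K d u w = (\<Oplus>\<^bsub>K\<^esub>i\<in>{1..d}. u i \<otimes>\<^bsub>K\<^esub> w i)"

definition annihilator :: "'a ring \<Rightarrow> nat \<Rightarrow> (nat \<Rightarrow> 'a) set \<Rightarrow> (nat \<Rightarrow> 'a) set" where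
  "annihilator K d W =
     {u \<in> carrier (coord_space K d). \<forall>w\<in>W. pairing K d u w = \<zero>\<^bsub>K\<^esub>}"

definition frame :: "'a ring \<Rightarrow> nat \<Rightarrow> (nat \<Rightarrow> nat \<Rightarrow> 'a) \<Rightarrow> bool" where
  "frame K d b \<longleftrightarrow>
     inj_on b {1..d} \<and> vectorspace.basis K (coord_space K d) (b ` {1..d})"

definition vspan :: "'a ring \<Rightarrow> nat \<Rightarrow> (nat \<Rightarrow> 'a) set \<Rightarrow> (nat \<Rightarrow> 'a) set" where
  "vspan K d S = LinearCombinations.module.span K (coord_space K d) S"

definition vdim :: "'a ring \<Rightarrow> nat \<Rightarrow> (nat \<Rightarrow> 'a) set \<Rightarrow> nat" where
  "vdim K d W = vectorspace.dim K ((coord_space K d)\<lparr>carrier := W\<rparr>)"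

type_synonym 'a flag = "nat \<Rightarrow> (nat \<Rightarrow> 'a) set"

text \<open>Only the values of a flag at \<open>i \<le> d\<close> are meaningful.\<close>

definition is_flag :: "'a ring \<Rightarrow> nat \<Rightarrow> 'a flag \<Rightarrow> bool" where
  "is_flag K d F \<longleftrightarrow>
     F 0 = {\<zero>\<^bsub>coord_space K d\<^esub>} \<and> F d = carrier (coord_space K d) \<and>
     (\<forall>i<d. F i \<subseteq> F (Suc i)) \<and>
     (\<forall>i\<le>d. subspace K (F i) (coord_space K d) \<and> vdim K d (F i) = i)"

definition max_span :: "'a ring \<Rightarrow> nat \<Rightarrow> 'a flag list \<Rightarrow> bool" where
  "max_span K d Fs \<longleftrightarrow>
     (\<forall>as. length as = length Fs \<and> (\<forall>a\<in>set as. a \<le> d) \<longrightarrow>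
        vdim K d (foldr (\<lambda>(F, a) W. F a <+>\<^bsub>coord_space K d\<^esub> W) (zip Fs as)
                        {\<zero>\<^bsub>coord_space K d\<^esub>})
          = min (sum_list as) d)"

section \<open>Triple and double ratios\<close>

text \<open>A non-zero element of the top exterior power of a subspace is the wedge product of a basis,
  up to a non-zero scalar. One basis is fixed for each subspace; every such element occurs in the
  ratios below once in a numerator and once in a denominator, so the choice does not matter.\<close>

definition some_basis :: "nat \<Rightarrow> (nat \<Rightarrow> real) set \<Rightarrow> (nat \<Rightarrow> real) list" where
  "some_basis d W =
     (SOME bs. distinct bs \<and>
        vectorspace.basis real_field ((coord_space real_field d)\<lparr>carrier := W\<rparr>) (set bs))"

text \<open>Under the identification of the \<open>d\<close>-th exterior power of \<open>\<real>\<^sup>d\<close> with \<open>\<real>\<close>, the wedge product of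
  \<open>d\<close> vectors is the determinant of the matrix with these columns.\<close>

definition wedge3 ::
  "nat \<Rightarrow> (nat \<Rightarrow> real) set \<Rightarrow> (nat \<Rightarrow> real) set \<Rightarrow> (nat \<Rightarrow> real) set \<Rightarrow> real" where
  "wedge3 d A B C =
     (let bs = some_basis d A @ some_basis d B @ some_basis d C
      in det (mat d d (\<lambda>(i, j). (bs ! j) (Suc i))))"

definition triple_ratio ::
  "nat \<Rightarrow> nat \<Rightarrow> nat \<Rightarrow> nat \<Rightarrow> real flag \<Rightarrow> real flag \<Rightarrow> real flag \<Rightarrow> real" where
  "triple_ratio d a b c E F G =
     wedge3 d (E (a - 1)) (F b) (G (c + 1)) / wedge3 d (E (a + 1)) (F b) (G (c - 1)) *
     (wedge3 d (E a) (F (b + 1)) (G (c - 1)) / wedge3 d (E a) (F (b - 1)) (G (c + 1))) *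
     (wedge3 d (E (a + 1)) (F (b - 1)) (G c) / wedge3 d (E (a - 1)) (F (b + 1)) (G c))"

definition double_ratio ::
  "nat \<Rightarrow> nat \<Rightarrow> real flag \<Rightarrow> real flag \<Rightarrow> real flag \<Rightarrow> real flag \<Rightarrow> real" where
  "double_ratio d i E F G H =
     - (wedge3 d (E i) (G (d - i - 1)) (F 1) / wedge3 d (E i) (G (d - i - 1)) (H 1)) *
       (wedge3 d (E (i - 1)) (G (d - i)) (H 1) / wedge3 d (E (i - 1)) (G (d - i)) (F 1))"

definition positive_quadruple ::
  "nat \<Rightarrow> real flag \<Rightarrow> real flag \<Rightarrow> real flag \<Rightarrow> real flag \<Rightarrow> bool" where
  "positive_quadruple d E F G H \<longleftrightarrow>
     (\<forall>X\<in>{E, F, G, H}. is_flag real_field d X) \<and>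
     max_span real_field d [E, F, G, H] \<and>
     (\<forall>a b c. a \<ge> 1 \<and> b \<ge> 1 \<and> c \<ge> 1 \<and> a + b + c = d \<longrightarrow>
        triple_ratio d a b c E F G > 0 \<and> triple_ratio d a b c E G H > 0) \<and>
     (\<forall>i. 0 < i \<and> i < d \<longrightarrow> double_ratio d i E F G H > 0)"

section \<open>Ultralimits of vectors and flags\<close>

definition vec_ulim ::
  "nat filter \<Rightarrow> (nat \<Rightarrow> real) \<Rightarrow> nat \<Rightarrow> (nat \<Rightarrow> nat \<Rightarrow> real) \<Rightarrow> (nat \<Rightarrow> (nat \<Rightarrow> real) set)" where
  "vec_ulim U l d w = (\<lambda>k\<in>{1..d}. ulim U l (\<lambda>n. w n k))"

definition has_vec_ulim ::
  "nat filter \<Rightarrow> (nat \<Rightarrow> real) \<Rightarrow> nat \<Rightarrow> (nat \<Rightarrow> nat \<Rightarrow> real) \<Rightarrow> (nat \<Rightarrow> (nat \<Rightarrow> real) set) \<Rightarrow> bool"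
  where
  "has_vec_ulim U l d w v \<longleftrightarrow>
     (\<forall>k\<in>{1..d}. (\<lambda>n. w n k) \<in> moderate U l) \<and> v = vec_ulim U l d w"

text \<open>In the bases, \<open>w i n\<close> is the \<open>i\<close>-th vector of the \<open>n\<close>-th basis.\<close>

definition flag_ulim ::
  "nat filter \<Rightarrow> (nat \<Rightarrow> real) \<Rightarrow> nat \<Rightarrow> (nat \<Rightarrow> real flag) \<Rightarrow> (nat \<Rightarrow> real) set flag \<Rightarrow> bool" where
  "flag_ulim U l d Fn F \<longleftrightarrow>
     is_flag (asym_field U l) d F \<and>
     (\<exists>w v. (\<forall>n. frame real_field d (\<lambda>i. w i n)) \<and>
            frame (asym_field U l) d v \<and>
            (\<forall>i\<in>{1..d}. has_vec_ulim U l d (w i) (v i)) \<and>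
            (\<forall>n. \<forall>i\<le>d. Fn n i = vspan real_field d ((\<lambda>j. w j n) ` {1..i})) \<and>
            (\<forall>i\<le>d. F i = vspan (asym_field U l) d (v ` {1..i})))"

definition defines_pos :: "nat filter \<Rightarrow> (nat \<Rightarrow> real) \<Rightarrow> (nat \<Rightarrow> real) \<Rightarrow> bool" where
  "defines_pos U l x \<longleftrightarrow> x \<in> moderate U l \<and> ulim U l x \<in> asym_pos U l"

definition positive_ultralimit ::
  "nat filter \<Rightarrow> (nat \<Rightarrow> real) \<Rightarrow> nat \<Rightarrow>
   (nat \<Rightarrow> real flag) \<Rightarrow> (nat \<Rightarrow> real flag) \<Rightarrow> (nat \<Rightarrow> real flag) \<Rightarrow> (nat \<Rightarrow> real flag) \<Rightarrow>
   (nat \<Rightarrow> real) set flag \<Rightarrow> (nat \<Rightarrow> real) set flag \<Rightarrow>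
   (nat \<Rightarrow> real) set flag \<Rightarrow> (nat \<Rightarrow> real) set flag \<Rightarrow> bool" where
  "positive_ultralimit U l d En Fn Gn Hn E F G H \<longleftrightarrow>
     flag_ulim U l d En E \<and> flag_ulim U l d Fn F \<and>
     flag_ulim U l d Gn G \<and> flag_ulim U l d Hn H \<and>
     max_span (asym_field U l) d [E, F, G, H] \<and>
     (\<forall>a b c. a \<ge> 1 \<and> b \<ge> 1 \<and> c \<ge> 1 \<and> a + b + c = d \<longrightarrow>
        defines_pos U l (\<lambda>n. triple_ratio d a b c (En n) (Fn n) (Gn n)) \<and>
        defines_pos U l (\<lambda>n. triple_ratio d a b c (En n) (Gn n) (Hn n))) \<and>
     (\<forall>i. 0 < i \<and> i < d \<longrightarrow>
        defines_pos U l (\<lambda>n. double_ratio d i (En n) (Fn n) (Gn n) (Hn n)))"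

section \<open>The model apartment\<close>

definition model_apartment :: "nat \<Rightarrow> (nat \<Rightarrow> real) set" where
  "model_apartment d = {x \<in> extensional {1..d}. (\<Sum>i=1..d. x i) = 1}"

definition model_vectors :: "nat \<Rightarrow> (nat \<Rightarrow> real) set" where
  "model_vectors d = {x \<in> extensional {1..d}. (\<Sum>i=1..d. x i) = 0}"

definition translation :: "nat \<Rightarrow> (nat \<Rightarrow> real) \<Rightarrow> (nat \<Rightarrow> real) \<Rightarrow> (nat \<Rightarrow> real)" where
  "translation d t = (\<lambda>p\<in>model_apartment d. \<lambda>i\<in>{1..d}. p i + t i)"

definition affine_weyl :: "nat \<Rightarrow> ((nat \<Rightarrow> real) \<Rightarrow> (nat \<Rightarrow> real)) set" where
  "affine_weyl d =
     {(\<lambda>p\<in>model_apartment d. \<lambda>i\<in>{1..d}. p (s i) + t i) | s t.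
        s permutes {1..d} \<and> t \<in> model_vectors d}"

section \<open>The building\<close>

type_synonym dual_vec = "nat \<Rightarrow> (nat \<Rightarrow> real) set"

abbreviation dual_space ::
  "nat filter \<Rightarrow> (nat \<Rightarrow> real) \<Rightarrow> nat \<Rightarrow> ((nat \<Rightarrow> real) set, dual_vec) module" where
  "dual_space U l d \<equiv> coord_space (asym_field U l) d"

text \<open>Norms are functions on the carrier; extensionality fixes their value outside of it.\<close>

definition ultrametric_norm ::
  "nat filter \<Rightarrow> (nat \<Rightarrow> real) \<Rightarrow> nat \<Rightarrow> (dual_vec \<Rightarrow> real) \<Rightarrow> bool" where
  "ultrametric_norm U l d \<eta> \<longleftrightarrow>
     \<eta> \<in> extensional (carrier (dual_space U l d)) \<and>
     (\<forall>w\<in>carrier (dual_space U l d). \<eta> w = 0 \<longleftrightarrow> w = \<zero>\<^bsub>dual_space U l d\<^esub>) \<and>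
     (\<forall>x\<in>carrier (asym_field U l). \<forall>w\<in>carrier (dual_space U l d).
        \<eta> (x \<odot>\<^bsub>dual_space U l d\<^esub> w) = absv U l x * \<eta> w) \<and>
     (\<forall>w\<in>carrier (dual_space U l d). \<forall>z\<in>carrier (dual_space U l d).
        \<eta> (w \<oplus>\<^bsub>dual_space U l d\<^esub> z) \<le> max (\<eta> w) (\<eta> z))"

definition adapted ::
  "nat filter \<Rightarrow> (nat \<Rightarrow> real) \<Rightarrow> nat \<Rightarrow> (dual_vec \<Rightarrow> real) \<Rightarrow> (nat \<Rightarrow> dual_vec) \<Rightarrow> bool" where
  "adapted U l d \<eta> b \<longleftrightarrow>
     (\<forall>x\<in>{1..d} \<rightarrow> carrier (asym_field U l).
        \<eta> (\<Oplus>\<^bsub>dual_space U l d\<^esub>j\<in>{1..d}. x j \<odot>\<^bsub>dual_space U l d\<^esub> b j)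
          = Max ((\<lambda>j. absv U l (x j) * \<eta> (b j)) ` {1..d}))"

definition adaptable_norms ::
  "nat filter \<Rightarrow> (nat \<Rightarrow> real) \<Rightarrow> nat \<Rightarrow> (dual_vec \<Rightarrow> real) set" where
  "adaptable_norms U l d =
     {\<eta>. ultrametric_norm U l d \<eta> \<and> (\<exists>b. frame (asym_field U l) d b \<and> adapted U l d \<eta> b)}"

definition homothety ::
  "nat filter \<Rightarrow> (nat \<Rightarrow> real) \<Rightarrow> nat \<Rightarrow> ((dual_vec \<Rightarrow> real) \<times> (dual_vec \<Rightarrow> real)) set" where
  "homothety U l d =
     {(\<eta>, \<eta>') \<in> adaptable_norms U l d \<times> adaptable_norms U l d.
        \<exists>x\<in>carrier (asym_field U l) - {\<zero>\<^bsub>asym_field U l\<^esub>}.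
          \<forall>w\<in>carrier (dual_space U l d). \<eta> w = \<eta>' (x \<odot>\<^bsub>dual_space U l d\<^esub> w)}"

definition building ::
  "nat filter \<Rightarrow> (nat \<Rightarrow> real) \<Rightarrow> nat \<Rightarrow> (dual_vec \<Rightarrow> real) set set" where
  "building U l d = adaptable_norms U l d // homothety U l d"

definition standard_marking ::
  "nat filter \<Rightarrow> (nat \<Rightarrow> real) \<Rightarrow> nat \<Rightarrow> (nat \<Rightarrow> dual_vec) \<Rightarrow>
   (nat \<Rightarrow> real) \<Rightarrow> (dual_vec \<Rightarrow> real) set" where
  "standard_marking U l d b =
     (\<lambda>x\<in>model_apartment d. homothety U l d ``
        {THE \<eta>. ultrametric_norm U l d \<eta> \<and> adapted U l d \<eta> b \<and>
                (\<forall>j\<in>{1..d}. \<eta> (b j) = exp (- x j))})"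

text \<open>The apartment depends only on the lines spanned by the basis vectors, so the description
  below is proper.\<close>

definition apartment ::
  "nat filter \<Rightarrow> (nat \<Rightarrow> real) \<Rightarrow> nat \<Rightarrow> (nat \<Rightarrow> dual_vec set) \<Rightarrow> (dual_vec \<Rightarrow> real) set set" where
  "apartment U l d L =
     (THE A. \<exists>b. frame (asym_field U l) d b \<and>
                 (\<forall>i\<in>{1..d}. vspan (asym_field U l) d {b i} = L i) \<and>
                 A = standard_marking U l d b ` model_apartment d)"

definition flag_apartment ::
  "nat filter \<Rightarrow> (nat \<Rightarrow> real) \<Rightarrow> nat \<Rightarrow>
   (nat \<Rightarrow> real) set flag \<Rightarrow> (nat \<Rightarrow> real) set flag \<Rightarrow> (dual_vec \<Rightarrow> real) set set" where
  "flag_apartment U l d E G =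
     apartment U l d
       (\<lambda>i. annihilator (asym_field U l) d (E (d - i) <+>\<^bsub>coord_space (asym_field U l) d\<^esub> G (i - 1)))"

section \<open>Preferred markings\<close>

text \<open>\<open>u i n\<close> is the \<open>i\<close>-th covector for the \<open>n\<close>-th triple of flags. Only \<open>u 1\<close> is required to have
  a non-zero ultralimit; the corresponding property of the other covectors is a consequence.\<close>

definition preferred_sequence ::
  "nat filter \<Rightarrow> (nat \<Rightarrow> real) \<Rightarrow> nat \<Rightarrow>
   (nat \<Rightarrow> real flag) \<Rightarrow> (nat \<Rightarrow> real flag) \<Rightarrow> (nat \<Rightarrow> real flag) \<Rightarrow>
   (nat \<Rightarrow> nat \<Rightarrow> nat \<Rightarrow> real) \<Rightarrow> bool" where
  "preferred_sequence U l d En Kn Gn u \<longleftrightarrow>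
     (let V = coord_space real_field d; ann = annihilator real_field d in
      (\<forall>n. u 1 n \<in> ann (En n (d - 1)) \<and> u 1 n \<noteq> \<zero>\<^bsub>V\<^esub>) \<and>
      (\<exists>u1. has_vec_ulim U l d (u 1) u1 \<and> u1 \<noteq> \<zero>\<^bsub>dual_space U l d\<^esub>) \<and>
      (\<forall>n. \<forall>i. 1 \<le> i \<and> i < d \<longrightarrow>
         u (i + 1) n \<in> ann (En n (d - i - 1) <+>\<^bsub>V\<^esub> Gn n i) \<and>
         u i n \<oplus>\<^bsub>V\<^esub> u (i + 1) n \<in> ann (En n (d - i - 1) <+>\<^bsub>V\<^esub> Kn n 1 <+>\<^bsub>V\<^esub> Gn n (i - 1))))"

definition preferred_marking ::
  "nat filter \<Rightarrow> (nat \<Rightarrow> real) \<Rightarrow> nat \<Rightarrow>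
   (nat \<Rightarrow> real flag) \<Rightarrow> (nat \<Rightarrow> real flag) \<Rightarrow> (nat \<Rightarrow> real flag) \<Rightarrow>
   ((nat \<Rightarrow> real) \<Rightarrow> (dual_vec \<Rightarrow> real) set) \<Rightarrow> bool" where
  "preferred_marking U l d En Kn Gn f \<longleftrightarrow>
     (\<exists>u. preferred_sequence U l d En Kn Gn u \<and>
          f = standard_marking U l d (\<lambda>i. vec_ulim U l d (u i)))"

definition marking_change ::
  "nat \<Rightarrow> ((nat \<Rightarrow> real) \<Rightarrow> 'b) \<Rightarrow> ((nat \<Rightarrow> real) \<Rightarrow> 'b) \<Rightarrow> (nat \<Rightarrow> real) \<Rightarrow> (nat \<Rightarrow> real)" where
  "marking_change d f f' = restrict (inv_into (model_apartment d) f \<circ> f') (model_apartment d)"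

end

theory Submission
  imports Defs "HOL-Algebra.Multiplicative_Group"
begin

text \<open>For a preferred sequence determined by a third flag \<open>K\<^sub>n\<close> one has \<open>u\<^sub>i(k) = - u\<^sub>i\<^sub>+\<^sub>1(k)\<close> for \<open>k\<close> in the line
  \<open>K\<^sub>n\<^sup>(\<^sup>1\<^sup>)\<close>, so all the covectors \<open>u\<^sub>i\<close> take the same values on that line up to sign. As each \<open>u\<^sub>i\<close>
  vanishes on \<open>E\<^sub>n\<^sup>(\<^sup>d\<^sup>-\<^sup>i\<^sup>)\<close> and \<open>G\<^sub>n\<^sup>(\<^sup>i\<^sup>-\<^sup>1\<^sup>)\<close>, which together with the line span the space also in the
  limit, every \<open>u\<^sub>i\<close> has an ultralimit; these form a basis because their pairings with the flag \<open>G\<close>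
  are triangular. Let \<open>u\<^sub>i\<close> and \<open>u'\<^sub>i\<close> be the covectors obtained from \<open>F\<close> and \<open>H\<close>. They lie on the same
  lines, so \<open>u'\<^sub>i = r\<^sub>i u\<^sub>i\<close>. Since two covectors with the same kernel are proportional, the
  determinants in the double ratio can be replaced by covectors, and
  \<open>Z\<^sub>d\<^sub>-\<^sub>i u\<^sub>i(h) = u\<^sub>i\<^sub>+\<^sub>1(h)\<close> for \<open>h\<close> in the line \<open>H\<^sup>(\<^sup>1\<^sup>)\<close>. Combined with \<open>u'\<^sub>i(h) = - u'\<^sub>i\<^sub>+\<^sub>1(h)\<close> this
  yields \<open>r\<^sub>i = - r\<^sub>i\<^sub>+\<^sub>1 Z\<^sub>d\<^sub>-\<^sub>i\<close>. Rescaling a basis by \<open>r\<close> changes its marking by the translation by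
  \<open>- v(r\<^sub>i)\<close>, normalised to have sum zero.\<close>

text \<open>The recursion fixes \<open>u (i + 1) n\<close> by linear conditions for each
  \<open>n\<close> separately and says nothing on its growth. A bound comes only from values on
  lifts of vectors over the limit field, so spanning is needed in the limit and not merely for every
  \<open>n\<close>. Maximum span is therefore used in the form: a submodule containing suitable
  members of the flags is everything. Applied to kernels of covectors, it replaces exterior algebra.
  The comparison takes place on the line of \<open>H\<close>: there the covectors \<open>u'\<close>
  alternate, while the double ratio transports the alternation of \<open>u\<close> from the line of
  \<open>F\<close>, and its minus sign cancels that of the alternation. The index
  \<open>d - i\<close> appears because \<open>u i\<close> annihilates \<open>E (d - i)\<close> and
  \<open>G (i - 1)\<close>, the pair in the first quotient of that double ratio, and
  \<open>u (i + 1)\<close> annihilates the pair in the second. The sign left between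
  \<open>r i\<close> and \<open>r (i + 1)\<close> disappears under the absolute value.\<close>

declare One_nat_def [simp del]

section \<open>Linear algebra in coordinate spaces\<close>

text \<open>Independence inside a subspace is independence in the whole space, so the size of
  independent sets is bounded by \<open>dim\<close> and a maximal one exists. This links the
  dimension of the record with carrier \<open>W\<close>, by which \<open>vdim\<close> is defined, to
  sets of vectors in \<open>V\<close>.\<close>

lemma (in vectorspace) subspace_finite_basis:
  assumes fd: fin_dim and W: "subspace K W V"
  obtains A where "finite A" "A \<subseteq> W" "lin_indpt A" "span A = W"
    "vectorspace.basis K (vs W) A" "card A = vectorspace.dim K (vs W)"
proof -
  have sm: "submodule K W V" using W by (simp add: subspace_def)
  interpret W: vectorspace K "vs W" by (rule subspace_is_vs[OF W])
  have WV: "W \<subseteq> carrier V" using sm by (simp add: submodule_def)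
  have small: "finite A \<and> card A \<le> dim" if "A \<subseteq> W" "W.lin_indpt A" for A
    using that li_le_dim[OF fd, of A] span_li_not_depend(2)[OF that(1) sm] WV by auto
  have "\<exists>A. finite A \<and> maximal A (\<lambda>S. S \<subseteq> carrier (vs W) \<and> W.lin_indpt S)"
  proof (rule maximal_exists[where N = dim and B = "{}"])
    show "{} \<subseteq> carrier (vs W) \<and> W.lin_indpt {}" by (auto simp: W.lin_dep_def)
  qed (use small in auto)
  then obtain A where A: "finite A" "maximal A (\<lambda>S. S \<subseteq> carrier (vs W) \<and> W.lin_indpt S)"
    by blast
  have bas: "W.basis A" by (rule W.max_li_is_basis) (use A(2) in auto)
  then have AW: "A \<subseteq> W" and li: "W.lin_indpt A" and gen: "W.span A = W"
    by (auto simp: W.basis_def)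
  show thesis
  proof
    show "lin_indpt A" "span A = W"
      using span_li_not_depend[OF AW sm] li gen by auto
    show "card A = W.dim" using W.dim_basis[OF A(1) bas] by simp
  qed (use A bas AW in auto)
qed

text \<open>A basis of \<open>W\<close> is then an independent set of \<open>dim\<close> vectors,
  hence a basis of the whole space.\<close>

lemma (in vectorspace) subspace_dim_eq_carrier:
  assumes fd: fin_dim and W: "subspace K W V" and "vectorspace.dim K (vs W) = dim"
  shows "W = carrier V"
proof -
  obtain A where A: "finite A" "A \<subseteq> W" "lin_indpt A" "span A = W"
    "card A = vectorspace.dim K (vs W)"
    using subspace_finite_basis[OF fd W] by metis
  have "W \<subseteq> carrier V" using W by (simp add: subspace_def submodule_def)
  then have "basis A" using A assms by (intro dim_li_is_basis) auto
  then show ?thesis using A by (simp add: basis_def)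
qed

lemma (in module) set_add_submodule:
  assumes "submodule R A M" "submodule R B M"
  shows "submodule R (A <+>\<^bsub>M\<^esub> B) M"
proof -
  have "A <+>\<^bsub>M\<^esub> B = submodule_sum A B"
    by (auto simp: set_add_def' submodule_sum_def)
  then show ?thesis using sum_is_submodule[OF assms] by simp
qed

lemma (in module) set_add_subset_submodule:
  assumes "submodule R P M" "A \<subseteq> P" "B \<subseteq> P"
  shows "A <+>\<^bsub>M\<^esub> B \<subseteq> P"
  using assms by (auto simp: set_add_def' submodule_def subset_iff)

lemma (in module) subset_set_add:
  assumes "submodule R A M" "submodule R B M"
  shows "A \<subseteq> A <+>\<^bsub>M\<^esub> B" "B \<subseteq> A <+>\<^bsub>M\<^esub> B"
proof -
  have A: "A \<subseteq> carrier M" "\<zero>\<^bsub>M\<^esub> \<in> A" and B: "B \<subseteq> carrier M" "\<zero>\<^bsub>M\<^esub> \<in> B"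
    using assms by (auto simp: submodule_def)
  show "A \<subseteq> A <+>\<^bsub>M\<^esub> B"
  proof
    fix x assume "x \<in> A"
    then have "x \<oplus>\<^bsub>M\<^esub> \<zero>\<^bsub>M\<^esub> = x" using A by auto
    then show "x \<in> A <+>\<^bsub>M\<^esub> B" using \<open>x \<in> A\<close> B unfolding set_add_def' by force
  qed
  show "B \<subseteq> A <+>\<^bsub>M\<^esub> B"
  proof
    fix x assume "x \<in> B"
    then have "\<zero>\<^bsub>M\<^esub> \<oplus>\<^bsub>M\<^esub> x = x" using B by auto
    then show "x \<in> A <+>\<^bsub>M\<^esub> B" using \<open>x \<in> B\<close> A unfolding set_add_def' by force
  qed
qed

locale coordinate_space = field K for K :: "'a ring" (structure) +
  fixes d :: nat
begin

abbreviation V where "V \<equiv> coord_space K d"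

sublocale vs: vectorspace K V
  by (intro vectorspace.intro func_space_is_module field_axioms)

lemma carrier_V: "carrier V = {1..d} \<rightarrow>\<^sub>E carrier K"
  by (simp add: func_space_def)

lemma zero_V: "\<zero>\<^bsub>V\<^esub> = (\<lambda>i\<in>{1..d}. \<zero>)"
  by (simp add: func_space_def)

lemma add_V: "u \<oplus>\<^bsub>V\<^esub> w = (\<lambda>i\<in>{1..d}. u i \<oplus> w i)"
  by (simp add: func_space_def)

lemma smult_V: "c \<odot>\<^bsub>V\<^esub> w = (\<lambda>i\<in>{1..d}. c \<otimes> w i)"
  by (simp add: func_space_def)

lemma V_coord [simp]: "u \<in> carrier V \<Longrightarrow> i \<in> {1..d} \<Longrightarrow> u i \<in> carrier K"
  by (auto simp: carrier_V)

lemma V_eqI: "u \<in> carrier V \<Longrightarrow> w \<in> carrier V \<Longrightarrow> (\<And>i. i \<in> {1..d} \<Longrightarrow> u i = w i) \<Longrightarrow> u = w"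
  unfolding carrier_V by (rule PiE_ext)

section \<open>The pairing of covectors and vectors\<close>

lemma pairing_closed [simp]:
  "u \<in> carrier V \<Longrightarrow> w \<in> carrier V \<Longrightarrow> pairing K d u w \<in> carrier K"
  unfolding pairing_def by (intro finsum_closed) auto

lemma pairing_commute:
  "u \<in> carrier V \<Longrightarrow> w \<in> carrier V \<Longrightarrow> pairing K d u w = pairing K d w u"
  unfolding pairing_def by (intro finsum_cong') (auto simp: m_comm)

lemma pairing_add:
  assumes "u \<in> carrier V" "w \<in> carrier V" "w' \<in> carrier V"
  shows "pairing K d u (w \<oplus>\<^bsub>V\<^esub> w') = pairing K d u w \<oplus> pairing K d u w'"
proof -
  have "pairing K d u (w \<oplus>\<^bsub>V\<^esub> w') = (\<Oplus>i\<in>{1..d}. u i \<otimes> w i \<oplus> u i \<otimes> w' i)"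
    unfolding pairing_def using assms by (intro finsum_cong') (auto simp: add_V r_distr)
  then show ?thesis
    unfolding pairing_def using assms by (subst finsum_addf [symmetric]) auto
qed

lemma pairing_smult:
  assumes "u \<in> carrier V" "w \<in> carrier V" "c \<in> carrier K"
  shows "pairing K d u (c \<odot>\<^bsub>V\<^esub> w) = c \<otimes> pairing K d u w"
proof -
  have "pairing K d u (c \<odot>\<^bsub>V\<^esub> w) = (\<Oplus>i\<in>{1..d}. c \<otimes> (u i \<otimes> w i))"
    unfolding pairing_def using assms by (intro finsum_cong') (auto simp: smult_V m_lcomm)
  then show ?thesis
    unfolding pairing_def using assms by (subst finsum_rdistr) auto
qed

lemma pairing_add_left:
  assumes "u \<in> carrier V" "u' \<in> carrier V" "w \<in> carrier V"
  shows "pairing K d (u \<oplus>\<^bsub>V\<^esub> u') w = pairing K d u w \<oplus> pairing K d u' w"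
  using assms by (simp add: pairing_commute[of _ w] pairing_add)

lemma pairing_smult_left:
  assumes "u \<in> carrier V" "w \<in> carrier V" "c \<in> carrier K"
  shows "pairing K d (c \<odot>\<^bsub>V\<^esub> u) w = c \<otimes> pairing K d u w"
  using assms by (simp add: pairing_commute[of _ w] pairing_smult)

lemma pairing_zero [simp]: "u \<in> carrier V \<Longrightarrow> pairing K d u \<zero>\<^bsub>V\<^esub> = \<zero>"
  unfolding pairing_def zero_V by (subst finsum_cong'[where g = "\<lambda>_. \<zero>"]) auto

lemma pairing_zero_left [simp]: "u \<in> carrier V \<Longrightarrow> pairing K d \<zero>\<^bsub>V\<^esub> u = \<zero>"
  by (subst pairing_commute) auto

lemma pairing_finsum_left:
  assumes "finite A" "u \<in> A \<rightarrow> carrier V" "c \<in> A \<rightarrow> carrier K" "w \<in> carrier V"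
  shows "pairing K d (\<Oplus>\<^bsub>V\<^esub>i\<in>A. c i \<odot>\<^bsub>V\<^esub> u i) w = (\<Oplus>i\<in>A. c i \<otimes> pairing K d (u i) w)"
  using assms
proof (induction A rule: finite_induct)
  case (insert a A)
  then have m: "(\<lambda>i. c i \<odot>\<^bsub>V\<^esub> u i) \<in> A \<rightarrow> carrier V"
    "(\<lambda>i. c i \<otimes> pairing K d (u i) w) \<in> A \<rightarrow> carrier K"
    "c a \<odot>\<^bsub>V\<^esub> u a \<in> carrier V" "(\<Oplus>\<^bsub>V\<^esub>i\<in>A. c i \<odot>\<^bsub>V\<^esub> u i) \<in> carrier V"
    by (auto simp: Pi_iff intro!: vs.finsum_closed)
  show ?case
    using insert m by (simp add: pairing_add_left pairing_smult_left vs.finsum_insert)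
qed simp

definition unit_vec where "unit_vec j = (\<lambda>i\<in>{1..d}. if i = j then \<one> else \<zero>)"

lemma unit_vec_V [simp]: "unit_vec j \<in> carrier V"
  by (auto simp: carrier_V unit_vec_def)

lemma pairing_unit_vec:
  assumes "u \<in> carrier V" "j \<in> {1..d}"
  shows "pairing K d u (unit_vec j) = u j"
proof -
  have "pairing K d u (unit_vec j) = (\<Oplus>i\<in>{1..d}. if j = i then u i else \<zero>)"
    unfolding pairing_def using assms by (intro finsum_cong') (auto simp: unit_vec_def)
  also have "\<dots> = u j"
    using assms by (intro add.finprod_singleton) auto
  finally show ?thesis .
qed

lemma pairing_nondegenerate:
  assumes "u \<in> carrier V" "\<And>w. w \<in> carrier V \<Longrightarrow> pairing K d u w = \<zero>"
  shows "u = \<zero>\<^bsub>V\<^esub>"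
proof (rule V_eqI)
  fix i assume "i \<in> {1..d}"
  then show "u i = \<zero>\<^bsub>V\<^esub> i"
    using assms(2)[of "unit_vec i"] pairing_unit_vec[OF assms(1)] by (simp add: zero_V)
qed (use assms in auto)

lemma submoduleI:
  assumes "P \<subseteq> carrier V" "\<zero>\<^bsub>V\<^esub> \<in> P" "\<And>v w. v \<in> P \<Longrightarrow> w \<in> P \<Longrightarrow> v \<oplus>\<^bsub>V\<^esub> w \<in> P"
    "\<And>c v. c \<in> carrier K \<Longrightarrow> v \<in> P \<Longrightarrow> c \<odot>\<^bsub>V\<^esub> v \<in> P"
  shows "submodule K P V"
  using assms by (intro submodule.intro vs.module_axioms) auto

lemma submodule_pairing_zero:
  assumes "u \<in> carrier V"
  shows "submodule K {w \<in> carrier V. pairing K d u w = \<zero>} V"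
  using assms by (intro submoduleI) (auto simp: pairing_add pairing_smult)

lemma vspan_subset: "S \<subseteq> P \<Longrightarrow> submodule K P V \<Longrightarrow> vspan K d S \<subseteq> P"
  unfolding vspan_def by (rule vs.span_is_subset)

lemma vspan_superset: "S \<subseteq> carrier V \<Longrightarrow> S \<subseteq> vspan K d S"
  unfolding vspan_def by (rule vs.in_own_span)

lemma vspan_singleton:
  assumes "v \<in> carrier V"
  shows "vspan K d {v} = {c \<odot>\<^bsub>V\<^esub> v | c. c \<in> carrier K}"
proof -
  have "vs.lincomb a {v} = a v \<odot>\<^bsub>V\<^esub> v" if "a \<in> {v} \<rightarrow> carrier K" for a
    using that assms by (simp add: vs.lincomb_def)
  then have "vspan K d {v} = {a v \<odot>\<^bsub>V\<^esub> v | a. a \<in> {v} \<rightarrow> carrier K}"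
    unfolding vspan_def using assms by (auto simp: vs.finite_span) metis
  also have "\<dots> = {c \<odot>\<^bsub>V\<^esub> v | c. c \<in> carrier K}"
  proof (intro equalityI subsetI)
    fix x assume "x \<in> {c \<odot>\<^bsub>V\<^esub> v | c. c \<in> carrier K}"
    then obtain c where "x = c \<odot>\<^bsub>V\<^esub> v" "c \<in> carrier K" by blast
    then show "x \<in> {a v \<odot>\<^bsub>V\<^esub> v | a. a \<in> {v} \<rightarrow> carrier K}"
      by (intro CollectI exI[of _ "\<lambda>_. c"]) auto
  qed auto
  finally show ?thesis .
qed

lemma annihilator_iff:
  "u \<in> annihilator K d W \<longleftrightarrow> u \<in> carrier V \<and> (\<forall>w\<in>W. pairing K d u w = \<zero>)"
  by (simp add: annihilator_def)

section \<open>Frames\<close>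

lemma frame_V: "frame K d b \<Longrightarrow> i \<in> {1..d} \<Longrightarrow> b i \<in> carrier V"
  by (auto simp: frame_def vs.basis_def)

lemma frame_fin_dim:
  assumes "frame K d b"
  shows "vs.fin_dim"
  using assms unfolding frame_def vs.basis_def vs.fin_dim_def by (metis finite_atLeastAtMost finite_imageI)

abbreviation combine where "combine b x \<equiv> \<Oplus>\<^bsub>V\<^esub>j\<in>{1..d}. x j \<odot>\<^bsub>V\<^esub> b j"

lemma combine_closed:
  "b \<in> {1..d} \<rightarrow> carrier V \<Longrightarrow> x \<in> {1..d} \<rightarrow> carrier K \<Longrightarrow> combine b x \<in> carrier V"
  by (intro vs.finsum_closed) auto

lemma lincomb_image:
  assumes "inj_on b {1..d}" "b \<in> {1..d} \<rightarrow> carrier V" "a \<in> b ` {1..d} \<rightarrow> carrier K"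
  shows "vs.lincomb a (b ` {1..d}) = combine b (\<lambda>j. a (b j))"
  unfolding vs.lincomb_def using assms by (subst vs.finsum_reindex) auto

text \<open>The basis criterion speaks of coefficient functions on the set of basis vectors;
  injectivity of \<open>b\<close> turns them into functions of the index.\<close>

lemma frame_coordinates:
  assumes b: "frame K d b" and w: "w \<in> carrier V"
  shows "\<exists>!x. x \<in> {1..d} \<rightarrow>\<^sub>E carrier K \<and> combine b x = w"
proof -
  have inj: "inj_on b {1..d}" and bV: "b \<in> {1..d} \<rightarrow> carrier V" and bas: "vs.basis (b ` {1..d})"
    using b frame_V[OF b] by (auto simp: frame_def)
  have ex1: "\<exists>!a. a \<in> b ` {1..d} \<rightarrow>\<^sub>E carrier K \<and> vs.lincomb a (b ` {1..d}) = w"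
    using vs.basis_criterion[of "b ` {1..d}"] bas bV w by (auto simp: vs.basis_def)
  then obtain a where a: "a \<in> b ` {1..d} \<rightarrow>\<^sub>E carrier K" "vs.lincomb a (b ` {1..d}) = w" by blast
  show ?thesis
  proof (rule ex1I[of _ "\<lambda>j\<in>{1..d}. a (b j)"], intro conjI)
    have aP: "a \<in> b ` {1..d} \<rightarrow> carrier K" using a by auto
    show "combine b (\<lambda>j\<in>{1..d}. a (b j)) = w"
      unfolding a(2)[symmetric] lincomb_image[OF inj bV aP]
      using aP bV by (intro vs.finsum_cong') auto
    fix x assume x: "x \<in> {1..d} \<rightarrow>\<^sub>E carrier K \<and> combine b x = w"
    \<comment> \<open>Coefficients given by index, carried over to the basis vectors so that
      uniqueness of \<open>a\<close> applies.\<close>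
    define a' where "a' = (\<lambda>v\<in>b ` {1..d}. x (the_inv_into {1..d} b v))"
    have a'b: "a' (b j) = x j" if "j \<in> {1..d}" for j
      using that inj by (simp add: a'_def the_inv_into_f_f)
    have a': "a' \<in> b ` {1..d} \<rightarrow>\<^sub>E carrier K"
      using x a'b by (auto simp: a'_def intro!: restrict_PiE_iff[THEN iffD2])
    then have aP': "a' \<in> b ` {1..d} \<rightarrow> carrier K" by auto
    have "vs.lincomb a' (b ` {1..d}) = combine b x"
      unfolding lincomb_image[OF inj bV aP'] using x bV a'b by (intro vs.finsum_cong') auto
    then have "a' = a" using ex1 a a' x by auto
    show "x = (\<lambda>j\<in>{1..d}. a (b j))"
      using x a'b unfolding \<open>a' = a\<close> by (intro PiE_ext[of x "{1..d}" "\<lambda>_. carrier K"]) auto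
  qed (use a in auto)
qed

lemma combine_add:
  assumes "b \<in> {1..d} \<rightarrow> carrier V" "x \<in> {1..d} \<rightarrow> carrier K" "y \<in> {1..d} \<rightarrow> carrier K"
  shows "combine b (\<lambda>j\<in>{1..d}. x j \<oplus> y j) = combine b x \<oplus>\<^bsub>V\<^esub> combine b y"
proof -
  have "combine b (\<lambda>j\<in>{1..d}. x j \<oplus> y j) = (\<Oplus>\<^bsub>V\<^esub>j\<in>{1..d}. x j \<odot>\<^bsub>V\<^esub> b j \<oplus>\<^bsub>V\<^esub> y j \<odot>\<^bsub>V\<^esub> b j)"
    using assms by (intro vs.finsum_cong') (auto simp: vs.smult_l_distr Pi_iff)
  then show ?thesis using assms by (subst vs.finsum_addf[symmetric]) auto
qed

lemma combine_smult:
  assumes "b \<in> {1..d} \<rightarrow> carrier V" "x \<in> {1..d} \<rightarrow> carrier K" "c \<in> carrier K"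
  shows "combine b (\<lambda>j\<in>{1..d}. c \<otimes> x j) = c \<odot>\<^bsub>V\<^esub> combine b x"
proof -
  have "combine b (\<lambda>j\<in>{1..d}. c \<otimes> x j) = (\<Oplus>\<^bsub>V\<^esub>j\<in>{1..d}. c \<odot>\<^bsub>V\<^esub> (x j \<odot>\<^bsub>V\<^esub> b j))"
    using assms by (intro vs.finsum_cong') (auto simp: vs.smult_assoc1 Pi_iff)
  then show ?thesis using assms by (subst vs.finsum_smult) auto
qed

lemma combine_zero: "b \<in> {1..d} \<rightarrow> carrier V \<Longrightarrow> combine b (\<lambda>j\<in>{1..d}. \<zero>) = \<zero>\<^bsub>V\<^esub>"
  by (subst vs.finsum_cong'[where g = "\<lambda>_. \<zero>\<^bsub>V\<^esub>"]) (auto simp: Pi_iff)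

lemma combine_single:
  assumes "b \<in> {1..d} \<rightarrow> carrier V" "c \<in> carrier K" "i \<in> {1..d}"
  shows "combine b (\<lambda>j\<in>{1..d}. if j = i then c else \<zero>) = c \<odot>\<^bsub>V\<^esub> b i"
proof -
  have "combine b (\<lambda>j\<in>{1..d}. if j = i then c else \<zero>) =
      (\<Oplus>\<^bsub>V\<^esub>j\<in>{1..d}. if i = j then c \<odot>\<^bsub>V\<^esub> b j else \<zero>\<^bsub>V\<^esub>)"
    using assms by (intro vs.finsum_cong') (auto simp: Pi_iff)
  also have "\<dots> = c \<odot>\<^bsub>V\<^esub> b i"
    using assms by (intro vs.add.finprod_singleton) (auto simp: Pi_iff)
  finally show ?thesis .
qed

text \<open>In a vanishing combination of the \<open>u i\<close>, pairing with \<open>g j\<close>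
  removes the terms beyond \<open>j\<close> by \<open>lower\<close>, and those before
  \<open>j\<close> are already known to have coefficient zero.\<close>

lemma frame_triangular:
  assumes fd: "vs.fin_dim" and dim: "vs.dim = d"
    and u: "u \<in> {1..d} \<rightarrow> carrier V" and g: "g \<in> {1..d} \<rightarrow> carrier V"
    and lower: "\<And>i j. i \<in> {1..d} \<Longrightarrow> j \<in> {1..d} \<Longrightarrow> j < i \<Longrightarrow> pairing K d (u i) (g j) = \<zero>"
    and diag: "\<And>i. i \<in> {1..d} \<Longrightarrow> pairing K d (u i) (g i) \<noteq> \<zero>"
  shows "frame K d u"
proof -
  \<comment> \<open>If \<open>u i = u j\<close> with \<open>i < j\<close>, the pairing with
    \<open>g i\<close> is zero by \<open>lower\<close> and nonzero by \<open>diag\<close>.\<close>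
  have inj: "inj_on u {1..d}"
    by (rule linorder_inj_onI') (metis diag lower)
  have "vs.lin_indpt (u ` {1..d})"
  proof (rule vs.finite_lin_indpt2)
    fix a assume a: "a \<in> u ` {1..d} \<rightarrow> carrier K" and "vs.lincomb a (u ` {1..d}) = \<zero>\<^bsub>V\<^esub>"
    then have z: "combine u (\<lambda>j. a (u j)) = \<zero>\<^bsub>V\<^esub>"
      using lincomb_image[OF inj u a] by simp
    have "a (u j) = \<zero>" if "j \<in> {1..d}" for j
      using that
    proof (induction j rule: less_induct)
      case (less j)
      have aK: "a (u i) \<in> carrier K" "pairing K d (u i) (g j) \<in> carrier K" if "i \<in> {1..d}" for i
        using that a u g less by (auto simp: Pi_iff)
      have "\<zero> = pairing K d (combine u (\<lambda>j. a (u j))) (g j)"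
        using z pairing_zero_left[OF funcset_mem[OF g less.prems]] by simp
      also have "\<dots> = (\<Oplus>i\<in>{1..d}. a (u i) \<otimes> pairing K d (u i) (g j))"
        using u g less a by (intro pairing_finsum_left) auto
      also have "\<dots> = (\<Oplus>i\<in>{1..d}. if j = i then a (u i) \<otimes> pairing K d (u i) (g j) else \<zero>)"
      proof (intro finsum_cong')
        fix i assume i: "i \<in> {1..d}"
        show "a (u i) \<otimes> pairing K d (u i) (g j) =
            (if j = i then a (u i) \<otimes> pairing K d (u i) (g j) else \<zero>)"
          using less.IH[of i] lower[of i j] aK[OF i] i less.prems
          by (cases i j rule: linorder_cases) auto
      qed (use aK in auto)
      also have "\<dots> = a (u j) \<otimes> pairing K d (u j) (g j)"
        using aK less.prems by (intro add.finprod_singleton) auto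
      finally show "a (u j) = \<zero>"
        using integral aK[OF less.prems] diag[OF less.prems] by metis
    qed
    then show "\<forall>v\<in>u ` {1..d}. a v = \<zero>" by auto
  qed (use u in auto)
  then have "vs.basis (u ` {1..d})"
    using fd dim u inj by (intro vs.dim_li_is_basis) (auto simp: card_image)
  then show ?thesis using inj by (simp add: frame_def)
qed

section \<open>Flags\<close>

lemma flag_submodule: "is_flag K d F \<Longrightarrow> i \<le> d \<Longrightarrow> submodule K (F i) V"
  by (simp add: is_flag_def subspace_def)

lemma flag_mono:
  assumes "is_flag K d F" "i \<le> j" "j \<le> d"
  shows "F i \<subseteq> F j"
  using assms(2,3)
proof (induction rule: dec_induct)
  case (step n)
  then have "F n \<subseteq> F (Suc n)" using assms(1,3) by (simp add: is_flag_def)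
  then show ?case using step by (meson Suc_leD subset_trans)
qed simp

lemma flag_zero: "is_flag K d F \<Longrightarrow> F 0 = {\<zero>\<^bsub>V\<^esub>}"
  by (simp add: is_flag_def)

lemma flag_dim: "is_flag K d F \<Longrightarrow> vs.dim = d"
  by (auto simp: is_flag_def vdim_def)

text \<open>The form in which maximum span is used: \<open>P\<close> will be a kernel or a similar
  submodule. The sum of the four subspaces has dimension \<open>d\<close>, so it is the whole space,
  and it lies in \<open>P\<close>.\<close>

lemma max_span_carrier:
  assumes flags: "is_flag K d E" "is_flag K d F" "is_flag K d G" "is_flag K d H"
    and ms: "max_span K d [E, F, G, H]" and fd: "vs.fin_dim"
    and le: "a \<le> d" "b \<le> d" "c \<le> d" "e \<le> d" "a + b + c + e \<ge> d"
    and P: "submodule K P V" "E a \<subseteq> P" "F b \<subseteq> P" "G c \<subseteq> P" "H e \<subseteq> P"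
  shows "P = carrier V"
proof -
  \<comment> \<open>Nested as in the \<open>foldr\<close> of \<open>max_span\<close>, with the zero
    subspace at its end.\<close>
  define S where "S = E a <+>\<^bsub>V\<^esub> (F b <+>\<^bsub>V\<^esub> (G c <+>\<^bsub>V\<^esub> (H e <+>\<^bsub>V\<^esub> {\<zero>\<^bsub>V\<^esub>})))"
  have z: "submodule K {\<zero>\<^bsub>V\<^esub>} V" by (intro submoduleI) auto
  have S: "submodule K S V"
    unfolding S_def using flags le
    by (intro vs.set_add_submodule z flag_submodule[OF flags(1)] flag_submodule[OF flags(2)]
        flag_submodule[OF flags(3)] flag_submodule[OF flags(4)])
  have "S \<subseteq> P"
    unfolding S_def using P by (intro vs.set_add_subset_submodule) (auto simp: submodule_def)
  have "vdim K d S = min (sum_list [a, b, c, e]) d"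
    using ms[unfolded max_span_def, rule_format, of "[a, b, c, e]"] le by (simp add: S_def)
  then have "vdim K d S = vs.dim" using le flag_dim[OF flags(1)] by simp
  then have "S = carrier V"
    using S fd vs.vectorspace_axioms
    by (intro vs.subspace_dim_eq_carrier) (auto simp: subspace_def vdim_def)
  then show ?thesis using \<open>S \<subseteq> P\<close> P by (auto simp: submodule_def)
qed

end

section \<open>The field of ultralimits\<close>

locale asymptotic =
  fixes U :: "nat filter" and l :: "nat \<Rightarrow> real"
  assumes ultra: "nonprincipal_ultrafilter U"
    and l_ge_1: "\<And>n. l n \<ge> 1"
    and l_at_top: "filterlim l at_top sequentially"
begin

section \<open>Limits along the ultrafilter and logarithmic growth\<close>

lemma U_nontrivial [simp]: "U \<noteq> bot"
  using ultra by (simp add: nonprincipal_ultrafilter_def)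

lemma eventually_ultra: "eventually P U \<or> eventually (\<lambda>n. \<not> P n) U"
  using ultra by (simp add: nonprincipal_ultrafilter_def)

lemma l_pos [simp]: "l n > 0"
  using l_ge_1[of n] by linarith

text \<open>Compactness of the extended reals along an ultrafilter: the limit is the supremum
  \<open>?s\<close> of the eventual lower bounds. A \<open>b\<close> above \<open>?s\<close> is not
  an eventual lower bound, and the ultrafilter then makes \<open>g n < b\<close> eventual.\<close>

lemma tendsto_Lim_ultra:
  fixes g :: "nat \<Rightarrow> ereal"
  shows "(g \<longlongrightarrow> Lim U g) U"
proof -
  let ?s = "Sup {y. eventually (\<lambda>n. y \<le> g n) U}"
  have "(g \<longlongrightarrow> ?s) U"
  proof (rule order_tendstoI)
    fix a assume "a < ?s"
    then obtain y where "eventually (\<lambda>n. y \<le> g n) U" "a < y"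
      by (auto simp: less_Sup_iff)
    then show "eventually (\<lambda>n. a < g n) U" by (auto elim: eventually_mono)
  next
    fix a assume "?s < a"
    then obtain b where b: "?s < b" "b < a" using dense by blast
    then have "\<not> eventually (\<lambda>n. b \<le> g n) U"
      using Sup_upper[of b "{y. eventually (\<lambda>n. y \<le> g n) U}"] by auto
    then have "eventually (\<lambda>n. \<not> b \<le> g n) U" using eventually_ultra by blast
    then show "eventually (\<lambda>n. g n < a) U" by eventually_elim (use b in auto)
  qed
  then show ?thesis using tendsto_Lim[OF U_nontrivial] by metis
qed

text \<open>The logarithm of \<open>\<bar>x n\<bar> powr (1 / l n)\<close>, with the value
  \<open>-\<infinity>\<close> at zero. Its limit governs both \<open>growth\<close> and
  \<open>val_seq\<close>.\<close>

definition log_term :: "(nat \<Rightarrow> real) \<Rightarrow> nat \<Rightarrow> ereal" where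
  "log_term x n = (if x n = 0 then -\<infinity> else ereal (ln \<bar>x n\<bar> / l n))"

definition log_growth :: "(nat \<Rightarrow> real) \<Rightarrow> ereal" where
  "log_growth x = Lim U (log_term x)"

lemma log_term_tendsto: "(log_term x \<longlongrightarrow> log_growth x) U"
  unfolding log_growth_def by (rule tendsto_Lim_ultra)

text \<open>Rewrites conditions on the limit as bounds by \<open>exp (c * l n)\<close>, which also
  cover the indices with \<open>x n = 0\<close>.\<close>

lemma log_term_le_iff: "log_term x n \<le> ereal c \<longleftrightarrow> \<bar>x n\<bar> \<le> exp (c * l n)"
proof (cases "x n = 0")
  case False
  then have "ln \<bar>x n\<bar> \<le> c * l n \<longleftrightarrow> \<bar>x n\<bar> \<le> exp (c * l n)"
    by (metis exp_le_cancel_iff exp_ln zero_less_abs_iff)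
  then show ?thesis using False by (simp add: log_term_def pos_divide_le_eq)
qed (simp add: log_term_def)

lemma le_log_term_iff: "ereal c \<le> log_term x n \<longleftrightarrow> exp (c * l n) \<le> \<bar>x n\<bar>"
proof (cases "x n = 0")
  case False
  then have "c * l n \<le> ln \<bar>x n\<bar> \<longleftrightarrow> exp (c * l n) \<le> \<bar>x n\<bar>"
    by (metis exp_le_cancel_iff exp_ln zero_less_abs_iff)
  then show ?thesis using False by (simp add: log_term_def pos_le_divide_eq)
qed (simp add: log_term_def not_le)

lemma log_growth_leI:
  assumes "eventually (\<lambda>n. \<bar>x n\<bar> \<le> exp (c * l n)) U"
  shows "log_growth x \<le> ereal c"
  by (rule tendsto_upperbound[OF log_term_tendsto]) (use assms in \<open>auto simp: log_term_le_iff\<close>)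

lemma log_growth_geI:
  assumes "eventually (\<lambda>n. exp (c * l n) \<le> \<bar>x n\<bar>) U"
  shows "ereal c \<le> log_growth x"
  by (rule tendsto_lowerbound[OF log_term_tendsto]) (use assms in \<open>auto simp: le_log_term_iff\<close>)

lemma log_growth_lessD:
  assumes "log_growth x < ereal c"
  shows "eventually (\<lambda>n. \<bar>x n\<bar> \<le> exp (c * l n)) U"
  using order_tendstoD(2)[OF log_term_tendsto assms]
  by eventually_elim (simp flip: log_term_le_iff)

lemma moderate_iff: "x \<in> moderate U l \<longleftrightarrow> (\<exists>c. eventually (\<lambda>n. \<bar>x n\<bar> \<le> exp (c * l n)) U)"
proof -
  let ?g = "\<lambda>n. ereal (\<bar>x n\<bar> powr (1 / l n))"
  have lim: "(?g \<longlongrightarrow> growth U l x) U"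
    unfolding growth_def by (rule tendsto_Lim_ultra)
  have iff: "\<bar>x n\<bar> powr (1 / l n) \<le> exp c \<longleftrightarrow> \<bar>x n\<bar> \<le> exp (c * l n)" for n c
    using log_term_le_iff[of x n c] by (auto simp: log_term_def powr_def split: if_splits)
  show ?thesis
  proof
    assume "x \<in> moderate U l"
    then have "growth U l x < \<infinity>" by (simp add: moderate_def)
    then obtain c where "growth U l x < ereal c" using ereal_dense2 by blast
    then have "eventually (\<lambda>n. \<bar>x n\<bar> powr (1 / l n) < c) U" using order_tendstoD(2)[OF lim] by fastforce
    then have "eventually (\<lambda>n. \<bar>x n\<bar> \<le> exp (c * l n)) U"
    proof eventually_elim
      case (elim n)
      \<comment> \<open>A bound \<open>c\<close> on the root is weakened to \<open>exp c\<close>,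
        the form that \<open>iff\<close> translates.\<close>
      then have "\<bar>x n\<bar> powr (1 / l n) \<le> exp c" using exp_ge_add_one_self[of c] by linarith
      then show ?case by (simp only: iff)
    qed
    then show "\<exists>c. eventually (\<lambda>n. \<bar>x n\<bar> \<le> exp (c * l n)) U" by blast
  next
    assume "\<exists>c. eventually (\<lambda>n. \<bar>x n\<bar> \<le> exp (c * l n)) U"
    then obtain c where "eventually (\<lambda>n. \<bar>x n\<bar> \<le> exp (c * l n)) U" by blast
    then have "growth U l x \<le> ereal (exp c)"
      by (intro tendsto_upperbound[OF lim]) (auto simp: iff)
    then show "x \<in> moderate U l" by (auto simp: moderate_def)
  qed
qed

lemma negligible_iff: "x \<in> negligible U l \<longleftrightarrow> (\<forall>c. eventually (\<lambda>n. \<bar>x n\<bar> \<le> exp (c * l n)) U)"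
proof -
  let ?g = "\<lambda>n. ereal (\<bar>x n\<bar> powr (1 / l n))"
  have lim: "(?g \<longlongrightarrow> growth U l x) U"
    unfolding growth_def by (rule tendsto_Lim_ultra)
  have iff: "\<bar>x n\<bar> powr (1 / l n) \<le> exp c \<longleftrightarrow> \<bar>x n\<bar> \<le> exp (c * l n)" for n c
    using log_term_le_iff[of x n c] by (auto simp: log_term_def powr_def split: if_splits)
  show ?thesis
  proof
    assume "x \<in> negligible U l"
    then have g: "growth U l x < ereal (exp c)" for c by (simp add: negligible_def)
    have "eventually (\<lambda>n. \<bar>x n\<bar> powr (1 / l n) \<le> exp c) U" for c
      using order_tendstoD(2)[OF lim g[of c]] by (rule eventually_mono) auto
    then show "\<forall>c. eventually (\<lambda>n. \<bar>x n\<bar> \<le> exp (c * l n)) U"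
      by (simp only: iff) blast
  next
    assume "\<forall>c. eventually (\<lambda>n. \<bar>x n\<bar> \<le> exp (c * l n)) U"
    then have le: "growth U l x \<le> ereal (exp c)" for c
      by (intro tendsto_upperbound[OF lim]) (auto simp: iff)
    have ge: "0 \<le> growth U l x"
      by (intro tendsto_lowerbound[OF lim]) auto
    have "\<not> 0 < growth U l x"
    proof
      assume "0 < growth U l x"
      then obtain r where "0 < ereal r" "ereal r < growth U l x"
        using ereal_dense2 by blast
      \<comment> \<open>For \<open>c = ln r\<close> the bound says
        \<open>growth U l x \<le> ereal r\<close>.\<close>
      then show False using le[of "ln r"] by auto
    qed
    then show "x \<in> negligible U l" using ge by (simp add: negligible_def)
  qed
qed

section \<open>Arithmetic of moderate and negligible sequences\<close>

lemma moderateI: "eventually (\<lambda>n. \<bar>x n\<bar> \<le> exp (c * l n)) U \<Longrightarrow> x \<in> moderate U l"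
  by (auto simp: moderate_iff)

lemma negligible_moderate: "x \<in> negligible U l \<Longrightarrow> x \<in> moderate U l"
  by (auto simp: moderate_iff negligible_iff)

lemma moderate_log_growth: "x \<in> moderate U l \<longleftrightarrow> log_growth x < \<infinity>"
proof
  assume "x \<in> moderate U l"
  then show "log_growth x < \<infinity>" using log_growth_leI by (fastforce simp: moderate_iff)
next
  assume "log_growth x < \<infinity>"
  then obtain c where "log_growth x < ereal c" using ereal_dense2 by blast
  then show "x \<in> moderate U l" using log_growth_lessD moderateI by blast
qed

lemma negligible_log_growth: "x \<in> negligible U l \<longleftrightarrow> log_growth x = -\<infinity>"
proof
  assume "x \<in> negligible U l"
  then have "log_growth x \<le> ereal c" for c using log_growth_leI by (auto simp: negligible_iff)
  then show "log_growth x = -\<infinity>" by (rule ereal_bot)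
next
  assume "log_growth x = -\<infinity>"
  then show "x \<in> negligible U l" using log_growth_lessD by (simp add: negligible_iff)
qed

text \<open>Since \<open>l n \<ge> 1\<close>, one more unit in the exponent absorbs the factor 2 of
  a sum of two terms. This crude bound suffices for closure under addition; the ultrametric
  inequality uses that \<open>l\<close> tends to infinity.\<close>

lemma two_exp_le: "2 * exp (c * l n) \<le> exp ((c + 1) * l n)"
proof -
  have "2 \<le> exp (l n)" using exp_ge_add_one_self[of "l n"] l_ge_1[of n] by linarith
  then show ?thesis by (simp add: distrib_right exp_add)
qed

lemma eventually_add_le:
  assumes "eventually (\<lambda>n. \<bar>x n\<bar> \<le> exp (c * l n)) U" "eventually (\<lambda>n. \<bar>y n\<bar> \<le> exp (c * l n)) U"
  shows "eventually (\<lambda>n. \<bar>x n + y n\<bar> \<le> exp ((c + 1) * l n)) U"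
  using assms
proof eventually_elim
  case (elim n)
  then show ?case using two_exp_le[of c n] by linarith
qed

lemma eventually_mult_le:
  assumes "eventually (\<lambda>n. \<bar>x n\<bar> \<le> exp (c * l n)) U" "eventually (\<lambda>n. \<bar>y n\<bar> \<le> exp (c' * l n)) U"
  shows "eventually (\<lambda>n. \<bar>x n * y n\<bar> \<le> exp ((c + c') * l n)) U"
  using assms
  by eventually_elim (auto simp: abs_mult distrib_right exp_add intro!: mult_mono)

lemma eventually_le_weaken:
  assumes "eventually (\<lambda>n. \<bar>x n\<bar> \<le> exp (c * l n)) U" "c \<le> c'"
  shows "eventually (\<lambda>n. \<bar>x n\<bar> \<le> exp (c' * l n)) U"
  using assms(1)
proof eventually_elim
  case (elim n)
  have "c * l n \<le> c' * l n" using assms(2) by (intro mult_right_mono) (auto intro: less_imp_le)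
  then show ?case using elim by (meson exp_le_cancel_iff order_trans)
qed

lemma moderate_add: 
  assumes "x \<in> moderate U l" "y \<in> moderate U l"
  shows "(\<lambda>n. x n + y n) \<in> moderate U l"
proof -
  obtain c c' where "eventually (\<lambda>n. \<bar>x n\<bar> \<le> exp (c * l n)) U" "eventually (\<lambda>n. \<bar>y n\<bar> \<le> exp (c' * l n)) U"
    using assms by (auto simp: moderate_iff)
  then show ?thesis
    using eventually_add_le[of x "max c c'" y] eventually_le_weaken by (blast intro: moderateI max.cobounded1 max.cobounded2)
qed

lemma moderate_mult: "x \<in> moderate U l \<Longrightarrow> y \<in> moderate U l \<Longrightarrow> (\<lambda>n. x n * y n) \<in> moderate U l"
  unfolding moderate_iff using eventually_mult_le by blast

lemma moderate_uminus: "x \<in> moderate U l \<Longrightarrow> (\<lambda>n. - x n) \<in> moderate U l"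
  by (simp add: moderate_iff)

lemma moderate_const [simp]: "(\<lambda>n. k) \<in> moderate U l"
proof (rule moderateI[of _ "\<bar>k\<bar>"], rule always_eventually, rule allI)
  fix n
  have "\<bar>k\<bar> \<le> \<bar>k\<bar> * l n" using l_ge_1[of n] by (simp add: mult_le_cancel_left1)
  then show "\<bar>k\<bar> \<le> exp (\<bar>k\<bar> * l n)" using exp_ge_add_one_self[of "\<bar>k\<bar> * l n"] by linarith
qed

lemma moderate_sum:
  "(\<And>i. i \<in> A \<Longrightarrow> x i \<in> moderate U l) \<Longrightarrow> (\<lambda>n. \<Sum>i\<in>A. x i n) \<in> moderate U l"
  by (induction A rule: infinite_finite_induct) (auto intro: moderate_add)

lemma moderate_mono:
  assumes "y \<in> moderate U l" "eventually (\<lambda>n. \<bar>x n\<bar> \<le> \<bar>y n\<bar>) U"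
  shows "x \<in> moderate U l"
proof -
  obtain c where "eventually (\<lambda>n. \<bar>y n\<bar> \<le> exp (c * l n)) U" using assms by (auto simp: moderate_iff)
  with assms(2) have "eventually (\<lambda>n. \<bar>x n\<bar> \<le> exp (c * l n)) U" by eventually_elim auto
  then show ?thesis by (rule moderateI)
qed

lemma negligible_mono:
  assumes "y \<in> negligible U l" "eventually (\<lambda>n. \<bar>x n\<bar> \<le> \<bar>y n\<bar>) U"
  shows "x \<in> negligible U l"
  unfolding negligible_iff
proof
  fix c
  have "eventually (\<lambda>n. \<bar>y n\<bar> \<le> exp (c * l n)) U" using assms by (auto simp: negligible_iff)
  with assms(2) show "eventually (\<lambda>n. \<bar>x n\<bar> \<le> exp (c * l n)) U" by eventually_elim auto
qed

lemma negligible_zero [simp]: "(\<lambda>n. 0) \<in> negligible U l"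
  by (simp add: negligible_iff)

lemma negligible_add:
  assumes "x \<in> negligible U l" "y \<in> negligible U l"
  shows "(\<lambda>n. x n + y n) \<in> negligible U l"
  unfolding negligible_iff
proof
  fix c
  show "eventually (\<lambda>n. \<bar>x n + y n\<bar> \<le> exp (c * l n)) U"
    using eventually_add_le[of x "c - 1" y] assms by (simp add: negligible_iff)
qed

lemma negligible_uminus: "x \<in> negligible U l \<Longrightarrow> (\<lambda>n. - x n) \<in> negligible U l"
  by (simp add: negligible_iff)

lemma negligible_mult:
  assumes "x \<in> negligible U l" "y \<in> moderate U l"
  shows "(\<lambda>n. x n * y n) \<in> negligible U l"
  unfolding negligible_iff
proof
  fix c
  obtain c' where "eventually (\<lambda>n. \<bar>y n\<bar> \<le> exp (c' * l n)) U" using assms by (auto simp: moderate_iff)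
  then show "eventually (\<lambda>n. \<bar>x n * y n\<bar> \<le> exp (c * l n)) U"
    using eventually_mult_le[of x "c - c'" y c'] assms by (simp add: negligible_iff)
qed

lemma one_not_negligible: "(\<lambda>n. 1) \<notin> negligible U l"
proof
  assume "(\<lambda>n. 1) \<in> negligible U l"
  then have "eventually (\<lambda>n. (1::real) \<le> exp ((-1) * l n)) U"
    unfolding negligible_iff by (drule_tac x = "-1" in spec) simp
  then have "eventually (\<lambda>n. False) U"
  proof eventually_elim
    case (elim n)
    have "exp ((-1) * l n) < 1" using l_pos[of n] by simp
    then show False using elim by linarith
  qed
  then show False by (simp add: eventually_False)
qed

text \<open>The ultrafilter turns failure of one bound \<open>exp (c * l n)\<close> into a lower
  bound at almost every index. This is what makes the quotient a field.\<close>

lemma not_negligible_inverse: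
  assumes "x \<in> moderate U l" "x \<notin> negligible U l"
  shows "(\<lambda>n. inverse (x n)) \<in> moderate U l" "eventually (\<lambda>n. x n \<noteq> 0) U"
proof -
  obtain c where "\<not> eventually (\<lambda>n. \<bar>x n\<bar> \<le> exp (c * l n)) U"
    using assms(2) by (auto simp: negligible_iff)
  then have ev: "eventually (\<lambda>n. \<not> \<bar>x n\<bar> \<le> exp (c * l n)) U"
    using eventually_ultra by blast
  then show "eventually (\<lambda>n. x n \<noteq> 0) U" by eventually_elim auto
  have "eventually (\<lambda>n. \<bar>inverse (x n)\<bar> \<le> exp ((- c) * l n)) U"
    using ev
  proof eventually_elim
    case (elim n)
    then have "inverse \<bar>x n\<bar> \<le> inverse (exp (c * l n))" by (intro le_imp_inverse_le) auto
    then show ?case by (simp add: exp_minus)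
  qed
  then show "(\<lambda>n. inverse (x n)) \<in> moderate U l" by (rule moderateI)
qed

section \<open>The quotient field\<close>

abbreviation R where "R \<equiv> moderate_ring U l"
abbreviation K where "K \<equiv> asym_field U l"

lemma R_simps [simp]:
  "carrier R = moderate U l" "x \<otimes>\<^bsub>R\<^esub> y = (\<lambda>n. x n * y n)" "\<one>\<^bsub>R\<^esub> = (\<lambda>n. 1)"
  "\<zero>\<^bsub>R\<^esub> = (\<lambda>n. 0)" "x \<oplus>\<^bsub>R\<^esub> y = (\<lambda>n. x n + y n)"
  by (simp_all add: moderate_ring_def)

lemma R_cring: "cring R"
proof (rule cringI)
  show "abelian_group R"
  proof (rule abelian_groupI)
    fix x assume "x \<in> carrier R"
    then show "\<exists>y\<in>carrier R. y \<oplus>\<^bsub>R\<^esub> x = \<zero>\<^bsub>R\<^esub>"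
      by (intro bexI[of _ "\<lambda>n. - x n"]) (auto simp: moderate_uminus)
  qed (auto simp: moderate_add algebra_simps)
  show "comm_monoid R"
    by (rule comm_monoidI) (auto simp: moderate_mult algebra_simps)
qed (auto simp: algebra_simps)

sublocale R: cring R
  by (rule R_cring)

lemma R_uminus: "x \<in> moderate U l \<Longrightarrow> \<ominus>\<^bsub>R\<^esub> x = (\<lambda>n. - x n)"
  by (rule R.minus_equality) (auto simp: moderate_uminus)

lemma negligible_ideal: "ideal (negligible U l) R"
proof (rule idealI)
  show "subgroup (negligible U l) (add_monoid R)"
  proof (rule R.add.subgroupI)
    show "negligible U l \<noteq> {}" using negligible_zero by blast
    fix x assume x: "x \<in> negligible U l"
    then show "\<ominus>\<^bsub>R\<^esub> x \<in> negligible U l"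
      using R_uminus[OF negligible_moderate[OF x]] negligible_uminus by simp
  qed (auto simp: negligible_moderate negligible_add)
next
  fix a x assume "a \<in> negligible U l" "x \<in> carrier R"
  then show "a \<otimes>\<^bsub>R\<^esub> x \<in> negligible U l" "x \<otimes>\<^bsub>R\<^esub> a \<in> negligible U l"
    using negligible_mult[of a x] by (auto simp: mult.commute)
qed (rule R.ring_axioms)

sublocale negl: ideal "negligible U l" R
  by (rule negligible_ideal)

abbreviation ul where "ul \<equiv> ulim U l"

lemma ulim_hom: "ring_hom_ring R K ul"
  using negl.rcos_ring_hom_ring unfolding asym_field_def ulim_def[abs_def] .

lemma ulim_closed [simp]: "x \<in> moderate U l \<Longrightarrow> ul x \<in> carrier K"
  using ring_hom_closed[OF ring_hom_ring.homh[OF ulim_hom]] by simp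

lemma ulim_add: "x \<in> moderate U l \<Longrightarrow> y \<in> moderate U l \<Longrightarrow> ul (\<lambda>n. x n + y n) = ul x \<oplus>\<^bsub>K\<^esub> ul y"
  using ring_hom_add[OF ring_hom_ring.homh[OF ulim_hom]] by simp

lemma ulim_mult: "x \<in> moderate U l \<Longrightarrow> y \<in> moderate U l \<Longrightarrow> ul (\<lambda>n. x n * y n) = ul x \<otimes>\<^bsub>K\<^esub> ul y"
  using ring_hom_mult[OF ring_hom_ring.homh[OF ulim_hom]] by simp

lemma ulim_one: "ul (\<lambda>n. 1) = \<one>\<^bsub>K\<^esub>"
  using ring_hom_one[OF ring_hom_ring.homh[OF ulim_hom]] by simp

lemma ulim_surj: "X \<in> carrier K \<Longrightarrow> \<exists>x\<in>moderate U l. X = ul x"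
  by (auto simp: asym_field_def FactRing_def A_RCOSETS_def' ulim_def)

lemma zero_K: "\<zero>\<^bsub>K\<^esub> = negligible U l"
  by (simp add: asym_field_def FactRing_def)

lemma ulim_zero_iff: "x \<in> moderate U l \<Longrightarrow> ul x = \<zero>\<^bsub>K\<^esub> \<longleftrightarrow> x \<in> negligible U l"
  unfolding zero_K ulim_def using negl.a_rcos_const[of x] negl.a_rcos_self[of x] by auto

lemma K_field: "field K"
proof -
  have "cring K" unfolding asym_field_def by (rule negl.quotient_is_cring[OF R_cring])
  then interpret K: cring K .
  show ?thesis
  proof (rule K.cring_fieldI2)
    show "\<zero>\<^bsub>K\<^esub> \<noteq> \<one>\<^bsub>K\<^esub>"
      using one_not_negligible ulim_zero_iff[of "\<lambda>n. 1"] by (auto simp: ulim_one)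
    fix X assume X: "X \<in> carrier K" "X \<noteq> \<zero>\<^bsub>K\<^esub>"
    then obtain x where x: "x \<in> moderate U l" "X = ul x" using ulim_surj by blast
    then have nx: "x \<notin> negligible U l" using X ulim_zero_iff by blast
    let ?y = "\<lambda>n. inverse (x n)"
    have y: "?y \<in> moderate U l" and ev: "eventually (\<lambda>n. x n \<noteq> 0) U"
      using not_negligible_inverse[OF x(1) nx] by auto
    \<comment> \<open>Zero at almost every index; where \<open>x n = 0\<close> the value is -1,
      because \<open>inverse 0 = 0\<close>.\<close>
    have 1: "(\<lambda>n. x n * ?y n - 1) \<in> negligible U l"
      by (rule negligible_mono[OF negligible_zero]) (use ev in eventually_elim, auto)
    have "ul (\<lambda>n. x n * ?y n) = ul (\<lambda>n. (x n * ?y n - 1) + 1)" by simp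
    also have "\<dots> = ul (\<lambda>n. x n * ?y n - 1) \<oplus>\<^bsub>K\<^esub> \<one>\<^bsub>K\<^esub>"
      unfolding ulim_one[symmetric] by (rule ulim_add) (auto simp: negligible_moderate[OF 1])
    also have "\<dots> = \<one>\<^bsub>K\<^esub>" using ulim_zero_iff[OF negligible_moderate[OF 1]] 1 by simp
    finally show "\<exists>b\<in>carrier K. X \<otimes>\<^bsub>K\<^esub> b = \<one>\<^bsub>K\<^esub>"
      using x y by (intro bexI[of _ "ul ?y"]) (auto simp: ulim_mult)
  qed
qed

sublocale K: field K
  by (rule K_field)

lemma ulim_zero [simp]: "ul (\<lambda>n. 0) = \<zero>\<^bsub>K\<^esub>"
  by (simp add: ulim_zero_iff)

lemma ulim_uminus: "x \<in> moderate U l \<Longrightarrow> ul (\<lambda>n. - x n) = \<ominus>\<^bsub>K\<^esub> ul x"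
  using ulim_add[of "\<lambda>n. - x n" x] by (intro K.minus_equality[symmetric]) (auto simp: moderate_uminus)

lemma ulim_diff: "x \<in> moderate U l \<Longrightarrow> y \<in> moderate U l \<Longrightarrow> ul (\<lambda>n. x n - y n) = ul x \<ominus>\<^bsub>K\<^esub> ul y"
  using ulim_add[of x "\<lambda>n. - y n"] by (simp add: ulim_uminus moderate_uminus K.minus_eq)

lemma ulim_eq_iff:
  assumes "x \<in> moderate U l" "y \<in> moderate U l"
  shows "ul x = ul y \<longleftrightarrow> (\<lambda>n. x n - y n) \<in> negligible U l"
proof -
  have m: "(\<lambda>n. x n - y n) \<in> moderate U l"
    using moderate_add[of x "\<lambda>n. - y n"] assms by (simp add: moderate_uminus)
  show ?thesis
    using assms by (simp add: ulim_zero_iff[OF m, symmetric] ulim_diff K.r_right_minus_eq)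
qed

lemma ulim_sum:
  assumes "finite A" "\<And>i. i \<in> A \<Longrightarrow> x i \<in> moderate U l"
  shows "ul (\<lambda>n. \<Sum>i\<in>A. x i n) = (\<Oplus>\<^bsub>K\<^esub>i\<in>A. ul (x i))"
  using assms
proof (induction A rule: finite_induct)
  case (insert a A)
  then show ?case
    by (simp add: ulim_add moderate_sum K.finsum_insert Pi_iff)
qed simp

section \<open>The absolute value\<close>

text \<open>The factor 2 costs \<open>ln 2 / l n\<close> in the logarithm, which tends to 0 along
  \<open>U\<close>. Concretely, \<open>2 * exp (a * l n) \<le> exp (b * l n)\<close> as soon as
  \<open>l n \<ge> 1 / (b - a)\<close>.\<close>

lemma log_growth_add_le: "log_growth (\<lambda>n. x n + y n) \<le> max (log_growth x) (log_growth y)"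
proof (rule ccontr)
  assume "\<not> ?thesis"
  then have "max (log_growth x) (log_growth y) < log_growth (\<lambda>n. x n + y n)" by (simp only: not_le)
  then obtain a b where ab: "max (log_growth x) (log_growth y) < ereal a" "a < b"
      "ereal b < log_growth (\<lambda>n. x n + y n)"
    by (metis ereal_dense2 less_ereal.simps(1))
  \<comment> \<open>A non-principal ultrafilter contains every cofinite set, so limits along
    \<open>sequentially\<close> are limits along \<open>U\<close>.\<close>
  have "filterlim l at_top U"
  proof (rule filterlim_mono[OF l_at_top order_refl])
    show "U \<le> sequentially"
    proof (rule filter_leI)
      fix P assume "eventually P sequentially"
      then obtain N where N: "\<And>n. n \<ge> N \<Longrightarrow> P n" by (auto simp: eventually_sequentially)
      have "eventually (\<lambda>n. n \<noteq> m) U" for m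
        using ultra by (auto simp: nonprincipal_ultrafilter_def)
      then have "eventually (\<lambda>n. \<forall>m\<in>{..<N}. n \<noteq> m) U" by (intro eventually_ball_finite) auto
      then show "eventually P U" by eventually_elim (metis N lessThan_iff not_less)
    qed
  qed
  then have "eventually (\<lambda>n. l n \<ge> 1 / (b - a)) U" by (simp add: filterlim_at_top)
  moreover have "eventually (\<lambda>n. \<bar>x n\<bar> \<le> exp (a * l n)) U" "eventually (\<lambda>n. \<bar>y n\<bar> \<le> exp (a * l n)) U"
    using ab by (auto intro!: log_growth_lessD)
  ultimately have "eventually (\<lambda>n. \<bar>x n + y n\<bar> \<le> exp (b * l n)) U"
  proof eventually_elim
    case (elim n)
    have "1 \<le> (b - a) * l n" using elim(1) ab(2) by (simp add: pos_divide_le_eq mult.commute)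
    then have "2 \<le> exp ((b - a) * l n)" using exp_ge_add_one_self[of "(b - a) * l n"] by linarith
    then have "2 * exp (a * l n) \<le> exp ((b - a) * l n) * exp (a * l n)" by simp
    also have "\<dots> = exp (b * l n)" by (simp add: exp_add[symmetric] algebra_simps)
    finally show ?case using elim by linarith
  qed
  from log_growth_leI[OF this] ab(3) show False by simp
qed

text \<open>Moderate and not negligible means finite logarithmic growth, so no sum of opposite
  infinities arises.\<close>

lemma log_growth_mult:
  assumes "x \<in> moderate U l" "y \<in> moderate U l" "x \<notin> negligible U l" "y \<notin> negligible U l"
  shows "log_growth (\<lambda>n. x n * y n) = log_growth x + log_growth y"
proof -
  have "((\<lambda>n. log_term x n + log_term y n) \<longlongrightarrow> log_growth x + log_growth y) U"
    using assms by (intro tendsto_add_ereal log_term_tendsto)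
      (auto simp: moderate_log_growth negligible_log_growth)
  moreover have "log_term (\<lambda>n. x n * y n) = (\<lambda>n. log_term x n + log_term y n)"
    by (auto simp: log_term_def fun_eq_iff abs_mult ln_mult add_divide_distrib)
  ultimately show ?thesis
    using tendsto_unique[OF U_nontrivial log_term_tendsto[of "\<lambda>n. x n * y n"]] by simp
qed

lemma log_growth_uminus: "log_growth (\<lambda>n. - x n) = log_growth x"
proof -
  have "log_term (\<lambda>n. - x n) = log_term x" by (simp add: log_term_def fun_eq_iff)
  then show ?thesis by (simp add: log_growth_def)
qed

text \<open>Makes \<open>val\<close> well defined on classes: a negligible difference has growth
  \<open>-\<infinity>\<close> and drops out of the ultrametric inequality.\<close>

lemma log_growth_cong:
  assumes "(\<lambda>n. x n - y n) \<in> negligible U l"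
  shows "log_growth x = log_growth y"
proof (rule antisym)
  have n: "log_growth (\<lambda>n. x n - y n) = -\<infinity>" "log_growth (\<lambda>n. y n - x n) = -\<infinity>"
    using assms negligible_uminus[OF assms] by (auto simp: negligible_log_growth)
  show "log_growth x \<le> log_growth y" using log_growth_add_le[of "\<lambda>n. x n - y n" y] n by simp
  show "log_growth y \<le> log_growth x" using log_growth_add_le[of "\<lambda>n. y n - x n" x] n by simp
qed

lemma val_seq_eq: "val_seq U l x = - log_growth x"
proof -
  have "(\<lambda>n. if x n = 0 then -\<infinity> else ereal (ln (\<bar>x n\<bar> powr (1 / l n)))) = log_term x"
    by (auto simp: log_term_def fun_eq_iff ln_powr)
  then show ?thesis by (simp add: val_seq_def log_growth_def)
qed

lemma val_ulim:
  assumes x: "x \<in> moderate U l"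
  shows "val U l (ul x) = - log_growth x"
proof -
  have eq: "val_seq U l y = - log_growth x" if "y \<in> ul x" for y
  proof -
    obtain z where "z \<in> negligible U l" "y = (\<lambda>n. z n + x n)"
      using \<open>y \<in> ul x\<close> by (auto simp: ulim_def a_r_coset_def')
    then have "log_growth y = log_growth x" by (intro log_growth_cong) simp
    then show ?thesis by (simp add: val_seq_eq)
  qed
  have "x \<in> ul x" unfolding ulim_def using negl.a_rcos_self x by simp
  then have "val_seq U l ` ul x = {- log_growth x}"
    using eq by (intro equalityI subsetI) (fastforce, metis imageI singletonD)
  then show ?thesis by (simp add: val_def)
qed

text \<open>Negligible sequences are split off because
  \<open>real_of_ereal (-\<infinity>) = 0\<close> would give them the absolute value 1.\<close>

lemma absv_ulim:
  assumes x: "x \<in> moderate U l"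
  shows "absv U l (ul x) = (if x \<in> negligible U l then 0 else exp (real_of_ereal (log_growth x)))"
  using x by (auto simp: absv_def val_ulim negligible_log_growth ereal_uminus_eq_reorder)

lemma log_growth_real:
  "x \<in> moderate U l \<Longrightarrow> x \<notin> negligible U l \<Longrightarrow> ereal (real_of_ereal (log_growth x)) = log_growth x"
  by (auto simp: moderate_log_growth negligible_log_growth ereal_real)

lemma absv_nonneg [simp]: "absv U l X \<ge> 0"
  by (simp add: absv_def)

lemma absv_eq_0_iff: "X \<in> carrier K \<Longrightarrow> absv U l X = 0 \<longleftrightarrow> X = \<zero>\<^bsub>K\<^esub>"
  by (metis absv_ulim exp_not_eq_zero ulim_surj ulim_zero_iff)

lemma absv_pos: "X \<in> carrier K \<Longrightarrow> X \<noteq> \<zero>\<^bsub>K\<^esub> \<Longrightarrow> absv U l X > 0"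
  using absv_eq_0_iff[of X] absv_nonneg[of X] by linarith

lemma absv_mult:
  assumes "X \<in> carrier K" "Y \<in> carrier K"
  shows "absv U l (X \<otimes>\<^bsub>K\<^esub> Y) = absv U l X * absv U l Y"
proof (cases "X = \<zero>\<^bsub>K\<^esub> \<or> Y = \<zero>\<^bsub>K\<^esub>")
  case True
  then show ?thesis using assms absv_eq_0_iff[of "\<zero>\<^bsub>K\<^esub>"] by auto
next
  case False
  obtain x y where x: "x \<in> moderate U l" "X = ul x" and y: "y \<in> moderate U l" "Y = ul y"
    using assms ulim_surj by metis
  have n: "x \<notin> negligible U l" "y \<notin> negligible U l" using False x y ulim_zero_iff by auto
  have "X \<otimes>\<^bsub>K\<^esub> Y \<noteq> \<zero>\<^bsub>K\<^esub>" using False assms K.integral by blast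
  moreover have XY: "X \<otimes>\<^bsub>K\<^esub> Y = ul (\<lambda>n. x n * y n)" using x y by (simp add: ulim_mult)
  ultimately have nn: "(\<lambda>n. x n * y n) \<notin> negligible U l"
    using x y by (simp add: ulim_zero_iff moderate_mult)
  have "ereal (real_of_ereal (log_growth (\<lambda>n. x n * y n))) = log_growth x + log_growth y"
    using log_growth_real[OF moderate_mult nn] log_growth_mult x(1) y(1) n by simp
  also have "\<dots> = ereal (real_of_ereal (log_growth x)) + ereal (real_of_ereal (log_growth y))"
    using log_growth_real x(1) y(1) n by simp
  finally
  have "real_of_ereal (log_growth (\<lambda>n. x n * y n)) =
      real_of_ereal (log_growth x) + real_of_ereal (log_growth y)" by simp
  then show ?thesis
    unfolding XY unfolding x(2) y(2) using x(1) y(1) n nn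
    by (simp add: absv_ulim moderate_mult exp_add)
qed

lemma absv_add_le:
  assumes "X \<in> carrier K" "Y \<in> carrier K"
  shows "absv U l (X \<oplus>\<^bsub>K\<^esub> Y) \<le> max (absv U l X) (absv U l Y)"
proof -
  obtain x y where x: "x \<in> moderate U l" "X = ul x" and y: "y \<in> moderate U l" "Y = ul y"
    using assms ulim_surj by metis
  have m: "(\<lambda>n. x n + y n) \<in> moderate U l" using x y by (simp add: moderate_add)
  show ?thesis
  proof (cases "(\<lambda>n. x n + y n) \<in> negligible U l")
    case True
    then show ?thesis using x y m by (simp add: ulim_add[symmetric] absv_ulim le_max_iff_disj)
  next
    case False
    note r = log_growth_real[OF m False]
    have "log_growth (\<lambda>n. x n + y n) \<le> log_growth x \<or> log_growth (\<lambda>n. x n + y n) \<le> log_growth y"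
      using log_growth_add_le[of x y] by (simp add: le_max_iff_disj)
    moreover have "absv U l (ul (\<lambda>n. x n + y n)) \<le> absv U l (ul z)"
      if z: "z \<in> moderate U l" "log_growth (\<lambda>n. x n + y n) \<le> log_growth z" for z
    proof -
      have "z \<notin> negligible U l" using z False by (auto simp: negligible_log_growth)
      then have "real_of_ereal (log_growth (\<lambda>n. x n + y n)) \<le> real_of_ereal (log_growth z)"
        using z r log_growth_real[of z] by (metis ereal_less_eq(3))
      then show ?thesis
        using m False z \<open>z \<notin> negligible U l\<close> by (simp add: absv_ulim)
    qed
    ultimately show ?thesis using x y by (auto simp: ulim_add[symmetric] le_max_iff_disj)
  qed
qed

text \<open>The value group is all of the reals, realised by \<open>exp (s * l n)\<close>; hence
  every common shift of the exponents of an adapted norm is a homothety.\<close>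

lemma absv_surj: "\<exists>X\<in>carrier K - {\<zero>\<^bsub>K\<^esub>}. absv U l X = exp s"
proof -
  let ?x = "\<lambda>n. exp (s * l n)"
  have "log_growth ?x = ereal s"
    by (intro antisym log_growth_leI log_growth_geI) auto
  then have "?x \<in> moderate U l" "?x \<notin> negligible U l"
    by (auto simp: moderate_log_growth negligible_log_growth)
  then show ?thesis
    using \<open>log_growth ?x = ereal s\<close> by (intro bexI[of _ "ul ?x"]) (auto simp: absv_ulim ulim_zero_iff)
qed

lemma absv_one: "absv U l \<one>\<^bsub>K\<^esub> = 1"
proof -
  have "absv U l \<one>\<^bsub>K\<^esub> * absv U l \<one>\<^bsub>K\<^esub> = absv U l \<one>\<^bsub>K\<^esub>"
    using absv_mult[of "\<one>\<^bsub>K\<^esub>" "\<one>\<^bsub>K\<^esub>"] by simp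
  moreover have "absv U l \<one>\<^bsub>K\<^esub> \<noteq> 0" using absv_eq_0_iff[of "\<one>\<^bsub>K\<^esub>"] by simp
  ultimately show ?thesis by simp
qed

lemma val_eq_ln_absv:
  assumes "X \<in> carrier K" "X \<noteq> \<zero>\<^bsub>K\<^esub>"
  shows "val U l X = ereal (- ln (absv U l X))"
proof -
  obtain x where x: "x \<in> moderate U l" "X = ul x" using assms ulim_surj by blast
  then have n: "x \<notin> negligible U l" using assms ulim_zero_iff by blast
  show ?thesis
    using x n log_growth_real[OF x(1) n] by (simp add: val_ulim absv_ulim flip: uminus_ereal.simps(1))
qed

lemma absv_uminus: 
  assumes "X \<in> carrier K"
  shows "absv U l (\<ominus>\<^bsub>K\<^esub> X) = absv U l X"
proof -
  obtain x where x: "x \<in> moderate U l" "X = ul x" using assms ulim_surj by blast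
  then show ?thesis 
    using moderate_uminus[OF x(1)] negligible_uminus[of x] negligible_uminus[of "\<lambda>n. - x n"]
    by (auto simp: ulim_uminus[symmetric] absv_ulim log_growth_uminus)
qed

end

section \<open>The model apartment\<close>

lemma translation_bij:
  assumes t: "t \<in> model_vectors d"
  shows "bij_betw (translation d t) (model_apartment d) (model_apartment d)"
proof (rule bij_betw_byWitness[where f' = "\<lambda>p. \<lambda>i\<in>{1..d}. p i - t i"])
  have t0: "(\<Sum>i=1..d. t i) = 0" using t by (simp add: model_vectors_def)
  show "translation d t ` model_apartment d \<subseteq> model_apartment d"
    using t0 by (auto simp: translation_def model_apartment_def sum.distrib)
  show "(\<lambda>p. \<lambda>i\<in>{1..d}. p i - t i) ` model_apartment d \<subseteq> model_apartment d"
    using t0 by (auto simp: model_apartment_def sum_subtractf)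
  then show "\<forall>p\<in>model_apartment d. translation d t (\<lambda>i\<in>{1..d}. p i - t i) = p"
    by (auto simp: translation_def model_apartment_def extensional_def fun_eq_iff image_subset_iff)
  show "\<forall>p\<in>model_apartment d. (\<lambda>i\<in>{1..d}. translation d t p i - t i) = p"
    by (auto simp: translation_def model_apartment_def extensional_def fun_eq_iff)
qed

lemma translation_affine_weyl: "t \<in> model_vectors d \<Longrightarrow> translation d t \<in> affine_weyl d"
  unfolding affine_weyl_def translation_def
  by (intro CollectI exI[of _ id] exI[of _ t]) (auto simp: permutes_id)

text \<open>Equal consecutive differences leave one common constant \<open>x 1 - y 1\<close>, and
  the vanishing coordinate sums make it zero.\<close>

lemma model_vectors_eqI:
  assumes "x \<in> model_vectors d" "y \<in> model_vectors d"
    and step: "\<And>i. i \<in> {1..d - 1} \<Longrightarrow> x (i + 1) - x i = y (i + 1) - y i"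
  shows "x = y"
proof (rule extensionalityI[of _ "{1..d}"])
  have const: "x i - y i = x 1 - y 1" if "1 \<le> i" "i \<le> d" for i
    using that
  proof (induction i rule: dec_induct)
    case (step n)
    then have "n \<in> {1..d - 1}" by auto
    then show ?case using step assms(3)[of n] unfolding Suc_eq_plus1 by simp
  qed simp
  fix i assume i: "i \<in> {1..d}"
  have "(\<Sum>j=1..d. x j - y j) = (\<Sum>j=1..d. x 1 - y 1)"
    by (intro sum.cong refl const) auto
  moreover have "(\<Sum>j=1..d. x j - y j) = 0"
    using assms by (simp add: model_vectors_def sum_subtractf)
  ultimately have "x 1 - y 1 = 0" using i by auto
  then show "x i = y i" using const[of i] i by auto
qed (use assms in \<open>auto simp: model_vectors_def\<close>)

section \<open>Norms adapted to a frame\<close>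

locale asymptotic_building = asymptotic U l for U l +
  fixes d :: nat
  assumes d_pos: "d \<ge> 1"
begin

sublocale cs: coordinate_space "asym_field U l" d
  by unfold_locales

abbreviation V where "V \<equiv> coord_space K d"
abbreviation av where "av \<equiv> absv U l"

definition coords where
  "coords b w = (THE x. x \<in> {1..d} \<rightarrow>\<^sub>E carrier K \<and> cs.combine b x = w)"

lemma frame_Pi: "frame K d b \<Longrightarrow> b \<in> {1..d} \<rightarrow> carrier V"
  using cs.frame_V by auto

lemma coords:
  assumes "frame K d b" "w \<in> carrier V"
  shows "coords b w \<in> {1..d} \<rightarrow>\<^sub>E carrier K" "cs.combine b (coords b w) = w"
  using theI'[OF cs.frame_coordinates[OF assms]] by (simp_all add: coords_def)

lemma coords_combine:
  assumes b: "frame K d b" and x: "x \<in> {1..d} \<rightarrow> carrier K" and j: "j \<in> {1..d}"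
  shows "coords b (cs.combine b x) j = x j"
proof -
  have c: "cs.combine b x \<in> carrier V" using cs.combine_closed[OF frame_Pi[OF b] x] .
  have "cs.combine b (restrict x {1..d}) = cs.combine b x"
    using frame_Pi[OF b] x by (intro cs.vs.finsum_cong') (auto simp: Pi_iff)
  moreover have "restrict x {1..d} \<in> {1..d} \<rightarrow>\<^sub>E carrier K" using x by auto
  ultimately have "coords b (cs.combine b x) = restrict x {1..d}"
    using cs.frame_coordinates[OF b c] coords[OF b c] by blast
  then show ?thesis using j by simp
qed

text \<open>The explicit norm behind the definite description in \<open>standard_marking\<close>.
  The exponents \<open>t\<close> are arbitrary, so rescaled ones can be used before the sum is
  normalised to 1.\<close>

definition adapted_norm where
  "adapted_norm b t = (\<lambda>w\<in>carrier V. Max ((\<lambda>j. av (coords b w j) * exp (- t j)) ` {1..d}))"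

lemma adapted_norm_combine:
  assumes b: "frame K d b" and x: "x \<in> {1..d} \<rightarrow> carrier K"
  shows "adapted_norm b t (cs.combine b x) = Max ((\<lambda>j. av (x j) * exp (- t j)) ` {1..d})"
proof -
  have "(\<lambda>j. av (coords b (cs.combine b x) j) * exp (- t j)) ` {1..d} =
      (\<lambda>j. av (x j) * exp (- t j)) ` {1..d}"
    using coords_combine[OF b x] by (intro image_cong) auto
  then show ?thesis using cs.combine_closed[OF frame_Pi[OF b] x] by (simp add: adapted_norm_def)
qed

lemma I_nonempty: "{1..d} \<noteq> {}"
  using d_pos by auto

lemma Max_mult_left:
  assumes "c \<ge> (0::real)"
  shows "Max ((\<lambda>j. c * f j) ` {1..d}) = c * Max (f ` {1..d})"
proof -
  have "mono (\<lambda>x. c * x)" using assms by (intro monoI mult_left_mono)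
  then have "c * Max (f ` {1..d}) = Max ((\<lambda>x. c * x) ` f ` {1..d})"
    using I_nonempty by (intro mono_Max_commute) auto
  then show ?thesis by (simp add: image_image)
qed

lemma adapted_norm_smult:
  assumes b: "frame K d b" and c: "c \<in> carrier K" and w: "w \<in> carrier V"
  shows "adapted_norm b t (c \<odot>\<^bsub>V\<^esub> w) = av c * adapted_norm b t w"
proof -
  let ?x = "coords b w"
  have x: "?x \<in> {1..d} \<rightarrow> carrier K" "cs.combine b ?x = w" using coords[OF b w] by auto
  have "adapted_norm b t (c \<odot>\<^bsub>V\<^esub> w) =
      adapted_norm b t (cs.combine b (\<lambda>j\<in>{1..d}. c \<otimes>\<^bsub>K\<^esub> ?x j))"
    using cs.combine_smult[OF frame_Pi[OF b] x(1) c] x(2) by simp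
  also have "\<dots> = Max ((\<lambda>j. av ((\<lambda>j\<in>{1..d}. c \<otimes>\<^bsub>K\<^esub> ?x j) j) * exp (- t j)) ` {1..d})"
    using x c by (intro adapted_norm_combine[OF b]) (auto simp: Pi_iff)
  also have "\<dots> = Max ((\<lambda>j. av c * (av (?x j) * exp (- t j))) ` {1..d})"
    using x c by (intro arg_cong[of _ _ Max] image_cong) (auto simp: absv_mult Pi_iff)
  also have "\<dots> = av c * Max ((\<lambda>j. av (?x j) * exp (- t j)) ` {1..d})"
    by (rule Max_mult_left) simp
  finally show ?thesis using w by (simp add: adapted_norm_def)
qed

lemma adapted_norm_basis:
  assumes b: "frame K d b" and i: "i \<in> {1..d}"
  shows "adapted_norm b t (b i) = exp (- t i)"
proof -
  let ?x = "\<lambda>j\<in>{1..d}. if j = i then \<one>\<^bsub>K\<^esub> else \<zero>\<^bsub>K\<^esub>"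
  have "b i = cs.combine b ?x"
    using cs.combine_single[OF frame_Pi[OF b] K.one_closed i] cs.frame_V[OF b i] by simp
  then have "adapted_norm b t (b i) = Max ((\<lambda>j. av (?x j) * exp (- t j)) ` {1..d})"
    by (simp only:) (rule adapted_norm_combine[OF b], auto)
  also have "\<dots> = exp (- t i)"
  proof (rule Max_eqI)
    show "exp (- t i) \<in> (\<lambda>j. av (?x j) * exp (- t j)) ` {1..d}"
      using i by (intro image_eqI[of _ _ i]) (auto simp: absv_one)
    fix y assume "y \<in> (\<lambda>j. av (?x j) * exp (- t j)) ` {1..d}"
    then show "y \<le> exp (- t i)" using absv_eq_0_iff[of "\<zero>\<^bsub>K\<^esub>"] by (auto simp: absv_one)
  qed simp
  finally show ?thesis .
qed

lemma adapted_norm_ultrametric: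
  assumes b: "frame K d b"
  shows "ultrametric_norm U l d (adapted_norm b t)"
  unfolding ultrametric_norm_def
proof (intro conjI ballI)
  show "adapted_norm b t \<in> extensional (carrier V)" by (simp add: adapted_norm_def)
  fix w assume w: "w \<in> carrier V"
  let ?x = "coords b w" and ?f = "\<lambda>w j. av (coords b w j) * exp (- t j)"
  have x: "?x \<in> {1..d} \<rightarrow>\<^sub>E carrier K" "cs.combine b ?x = w" using coords[OF b w] by auto
  have nw: "adapted_norm b t w = Max (?f w ` {1..d})" using w by (simp add: adapted_norm_def)
  show "(adapted_norm b t w = 0) = (w = \<zero>\<^bsub>V\<^esub>)"
  proof
    assume "adapted_norm b t w = 0"
    then have "?f w j \<le> 0" if "j \<in> {1..d}" for j
      using that Max_ge[of "?f w ` {1..d}" "?f w j"] nw by auto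
    then have "av (?x j) = 0" if "j \<in> {1..d}" for j
      using that absv_nonneg[of "?x j"] by (metis antisym exp_gt_zero mult_le_0_iff not_le)
    then have "?x j = \<zero>\<^bsub>K\<^esub>" if "j \<in> {1..d}" for j
      using that PiE_mem[OF x(1) that] absv_eq_0_iff by blast
    then have "?x = (\<lambda>j\<in>{1..d}. \<zero>\<^bsub>K\<^esub>)" using x by (intro PiE_ext[OF x(1)]) auto
    then show "w = \<zero>\<^bsub>V\<^esub>" using x(2) cs.combine_zero[OF frame_Pi[OF b]] by simp
  next
    assume "w = \<zero>\<^bsub>V\<^esub>"
    then have "adapted_norm b t w = adapted_norm b t (cs.combine b (\<lambda>j\<in>{1..d}. \<zero>\<^bsub>K\<^esub>))"
      using cs.combine_zero[OF frame_Pi[OF b]] by simp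
    also have "\<dots> = Max ((\<lambda>j. av ((\<lambda>j\<in>{1..d}. \<zero>\<^bsub>K\<^esub>) j) * exp (- t j)) ` {1..d})"
      by (rule adapted_norm_combine[OF b]) auto
    also have "(\<lambda>j. av ((\<lambda>j\<in>{1..d}. \<zero>\<^bsub>K\<^esub>) j) * exp (- t j)) ` {1..d} = {0}"
      using I_nonempty absv_eq_0_iff[of "\<zero>\<^bsub>K\<^esub>"] by auto
    finally show "adapted_norm b t w = 0" by simp
  qed
  fix z assume z: "z \<in> carrier V"
  let ?y = "coords b z"
  have y: "?y \<in> {1..d} \<rightarrow>\<^sub>E carrier K" "cs.combine b ?y = z" using coords[OF b z] by auto
  have xy: "?x \<in> {1..d} \<rightarrow> carrier K" "?y \<in> {1..d} \<rightarrow> carrier K" using x y by auto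
  have "adapted_norm b t (w \<oplus>\<^bsub>V\<^esub> z) =
      adapted_norm b t (cs.combine b (\<lambda>j\<in>{1..d}. ?x j \<oplus>\<^bsub>K\<^esub> ?y j))"
    using cs.combine_add[OF frame_Pi[OF b] xy] x(2) y(2) by (simp only:)
  also have "\<dots> = Max ((\<lambda>j. av ((\<lambda>j\<in>{1..d}. ?x j \<oplus>\<^bsub>K\<^esub> ?y j) j) * exp (- t j)) ` {1..d})"
    using PiE_mem[OF x(1)] PiE_mem[OF y(1)] by (intro adapted_norm_combine[OF b]) auto
  also have "\<dots> \<le> max (adapted_norm b t w) (adapted_norm b t z)"
  proof (rule Max.boundedI)
    fix a assume "a \<in> (\<lambda>j. av ((\<lambda>j\<in>{1..d}. ?x j \<oplus>\<^bsub>K\<^esub> ?y j) j) * exp (- t j)) ` {1..d}"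
    then obtain j where j: "j \<in> {1..d}" "a = av (?x j \<oplus>\<^bsub>K\<^esub> ?y j) * exp (- t j)" by auto
    have "av (?x j \<oplus>\<^bsub>K\<^esub> ?y j) \<le> max (av (?x j)) (av (?y j))"
      using x y j by (intro absv_add_le) auto
    then have "a \<le> max (av (?x j)) (av (?y j)) * exp (- t j)" using j by simp
    also have "\<dots> = max (?f w j) (?f z j)" by (simp add: max_mult_distrib_right)
    also have "\<dots> \<le> max (Max (?f w ` {1..d})) (Max (?f z ` {1..d}))"
      using j by (intro max.mono Max_ge) auto
    finally show "a \<le> max (adapted_norm b t w) (adapted_norm b t z)"
      using w z by (simp add: adapted_norm_def)
  qed (use I_nonempty in auto)
  finally show "adapted_norm b t (w \<oplus>\<^bsub>V\<^esub> z) \<le> max (adapted_norm b t w) (adapted_norm b t z)" .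
qed (use adapted_norm_smult[OF b] in auto)

lemma adapted_norm_adapted:
  assumes b: "frame K d b"
  shows "adapted U l d (adapted_norm b t) b"
  unfolding adapted_def
proof
  fix x assume x: "x \<in> {1..d} \<rightarrow> carrier K"
  have "(\<lambda>j. av (x j) * adapted_norm b t (b j)) ` {1..d} = (\<lambda>j. av (x j) * exp (- t j)) ` {1..d}"
    using adapted_norm_basis[OF b] by (intro image_cong) auto
  then show "adapted_norm b t (cs.combine b x) =
      Max ((\<lambda>j. av (x j) * adapted_norm b t (b j)) ` {1..d})"
    using adapted_norm_combine[OF b x] by simp
qed

lemma adapted_norm_adaptable: "frame K d b \<Longrightarrow> adapted_norm b t \<in> adaptable_norms U l d"
  unfolding adaptable_norms_def using adapted_norm_ultrametric adapted_norm_adapted by blast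

text \<open>Being adapted fixes a norm on the carrier by its values on the frame, and extensionality
  fixes it outside, so the description is proper.\<close>

lemma the_adapted_norm:
  assumes b: "frame K d b"
  shows "(THE \<eta>. ultrametric_norm U l d \<eta> \<and> adapted U l d \<eta> b \<and>
      (\<forall>j\<in>{1..d}. \<eta> (b j) = exp (- t j))) = adapted_norm b t"
proof (rule the_equality)
  show "ultrametric_norm U l d (adapted_norm b t) \<and> adapted U l d (adapted_norm b t) b \<and>
      (\<forall>j\<in>{1..d}. adapted_norm b t (b j) = exp (- t j))"
    using adapted_norm_ultrametric adapted_norm_adapted adapted_norm_basis b by blast
  fix \<eta> assume \<eta>: "ultrametric_norm U l d \<eta> \<and> adapted U l d \<eta> b \<and>
      (\<forall>j\<in>{1..d}. \<eta> (b j) = exp (- t j))"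
  show "\<eta> = adapted_norm b t"
  proof (rule extensionalityI[of _ "carrier V"])
    fix w assume w: "w \<in> carrier V"
    have x: "coords b w \<in> {1..d} \<rightarrow> carrier K" "cs.combine b (coords b w) = w"
      using coords[OF b w] by auto
    have "\<eta> (cs.combine b (coords b w)) = Max ((\<lambda>j. av (coords b w j) * \<eta> (b j)) ` {1..d})"
      using \<eta> x(1) unfolding adapted_def by blast
    also have "\<dots> = adapted_norm b t w"
      using \<eta> w by (simp add: adapted_norm_def)
    finally show "\<eta> w = adapted_norm b t w" using x(2) by simp
  qed (use \<eta> in \<open>auto simp: ultrametric_norm_def adapted_norm_def\<close>)
qed

lemma standard_marking_eq:
  "frame K d b \<Longrightarrow> p \<in> model_apartment d \<Longrightarrow>
    standard_marking U l d b p = homothety U l d `` {adapted_norm b p}"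
  by (simp add: standard_marking_def the_adapted_norm)

section \<open>Homothety classes\<close>

lemma equiv_homothety: "equiv (adaptable_norms U l d) (homothety U l d)"
proof (rule equivI)
  show "refl_on (adaptable_norms U l d) (homothety U l d)"
  proof (rule refl_onI)
    fix \<eta> assume "\<eta> \<in> adaptable_norms U l d"
    then show "(\<eta>, \<eta>) \<in> homothety U l d"
      by (auto simp: homothety_def intro!: bexI[of _ "\<one>\<^bsub>K\<^esub>"])
  qed
  show "homothety U l d \<subseteq> adaptable_norms U l d \<times> adaptable_norms U l d"
    by (auto simp: homothety_def)
  show "sym (homothety U l d)"
  proof (rule symI)
    fix \<eta> \<eta>' assume "(\<eta>, \<eta>') \<in> homothety U l d"
    then obtain x where ad: "\<eta> \<in> adaptable_norms U l d" "\<eta>' \<in> adaptable_norms U l d"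
      and x: "x \<in> carrier K" "x \<noteq> \<zero>\<^bsub>K\<^esub>"
      and eq: "\<And>w. w \<in> carrier V \<Longrightarrow> \<eta> w = \<eta>' (x \<odot>\<^bsub>V\<^esub> w)"
      by (auto simp: homothety_def)
    have ix: "inv\<^bsub>K\<^esub> x \<in> carrier K - {\<zero>\<^bsub>K\<^esub>}" "x \<otimes>\<^bsub>K\<^esub> inv\<^bsub>K\<^esub> x = \<one>\<^bsub>K\<^esub>"
      using x K.field_Units K.Units_inv_Units K.Units_r_inv by auto
    have "\<eta>' w = \<eta> (inv\<^bsub>K\<^esub> x \<odot>\<^bsub>V\<^esub> w)" if w: "w \<in> carrier V" for w
    proof -
      have "x \<odot>\<^bsub>V\<^esub> (inv\<^bsub>K\<^esub> x \<odot>\<^bsub>V\<^esub> w) = w"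
        using cs.vs.smult_assoc1[of x "inv\<^bsub>K\<^esub> x" w] x ix w by simp
      then show ?thesis using eq[of "inv\<^bsub>K\<^esub> x \<odot>\<^bsub>V\<^esub> w"] ix w by simp
    qed
    then show "(\<eta>', \<eta>) \<in> homothety U l d" using ad ix unfolding homothety_def by blast
  qed
  show "trans (homothety U l d)"
  proof (rule transI)
    fix \<eta> \<eta>' \<eta>'' assume "(\<eta>, \<eta>') \<in> homothety U l d" "(\<eta>', \<eta>'') \<in> homothety U l d"
    then obtain x y where ad: "\<eta> \<in> adaptable_norms U l d" "\<eta>'' \<in> adaptable_norms U l d"
      and xy: "x \<in> carrier K - {\<zero>\<^bsub>K\<^esub>}" "y \<in> carrier K - {\<zero>\<^bsub>K\<^esub>}"
      and eq: "\<forall>w\<in>carrier V. \<eta> w = \<eta>' (x \<odot>\<^bsub>V\<^esub> w)"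
        "\<forall>w\<in>carrier V. \<eta>' w = \<eta>'' (y \<odot>\<^bsub>V\<^esub> w)"
      unfolding homothety_def by blast
    have x: "x \<in> carrier K" "x \<noteq> \<zero>\<^bsub>K\<^esub>" and y: "y \<in> carrier K" "y \<noteq> \<zero>\<^bsub>K\<^esub>"
      using xy by simp_all
    have "y \<otimes>\<^bsub>K\<^esub> x \<in> carrier K - {\<zero>\<^bsub>K\<^esub>}" using x y K.integral[of y x] by blast
    moreover have "\<eta> w = \<eta>'' ((y \<otimes>\<^bsub>K\<^esub> x) \<odot>\<^bsub>V\<^esub> w)" if "w \<in> carrier V" for w
      using that x y eq by (simp add: cs.vs.smult_assoc1)
    ultimately show "(\<eta>, \<eta>'') \<in> homothety U l d" using ad unfolding homothety_def by blast
  qed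
qed

text \<open>Multiplying by \<open>x\<close> multiplies the norm by \<open>absv U l x\<close>, which
  shifts all exponents by the same real; conversely each shift comes from some \<open>x\<close> by
  \<open>absv_surj\<close>.\<close>

lemma homothety_adapted_norm_iff:
  assumes b: "frame K d b"
  shows "(adapted_norm b t, adapted_norm b t') \<in> homothety U l d \<longleftrightarrow>
    (\<exists>s. \<forall>j\<in>{1..d}. t j = t' j + s)"
proof
  assume "(adapted_norm b t, adapted_norm b t') \<in> homothety U l d"
  then obtain x where x: "x \<in> carrier K" "x \<noteq> \<zero>\<^bsub>K\<^esub>"
    and eq: "\<And>w. w \<in> carrier V \<Longrightarrow> adapted_norm b t w = adapted_norm b t' (x \<odot>\<^bsub>V\<^esub> w)"
    by (auto simp: homothety_def)
  have pos: "av x > 0" using x absv_pos by simp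
  have "t j = t' j + (- ln (av x))" if j: "j \<in> {1..d}" for j
  proof -
    have "exp (- t j) = av x * exp (- t' j)"
      using eq[OF cs.frame_V[OF b j]] adapted_norm_smult[OF b x(1) cs.frame_V[OF b j]]
      by (simp add: adapted_norm_basis[OF b j])
    also have "\<dots> = exp (ln (av x) - t' j)" using pos by (simp add: exp_diff exp_minus field_simps)
    finally show ?thesis by simp
  qed
  then show "\<exists>s. \<forall>j\<in>{1..d}. t j = t' j + s" by blast
next
  assume "\<exists>s. \<forall>j\<in>{1..d}. t j = t' j + s"
  then obtain s where s: "\<And>j. j \<in> {1..d} \<Longrightarrow> t j = t' j + s" by blast
  obtain x where x: "x \<in> carrier K - {\<zero>\<^bsub>K\<^esub>}" "av x = exp (- s)" using absv_surj by blast
  have "adapted_norm b t w = adapted_norm b t' (x \<odot>\<^bsub>V\<^esub> w)" if w: "w \<in> carrier V" for w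
  proof -
    have "adapted_norm b t' (x \<odot>\<^bsub>V\<^esub> w) = exp (- s) * adapted_norm b t' w"
      using adapted_norm_smult[OF b _ w] x by simp
    also have "\<dots> = Max ((\<lambda>j. exp (- s) * (av (coords b w j) * exp (- t' j))) ` {1..d})"
      using w by (simp add: adapted_norm_def Max_mult_left)
    also have "\<dots> = Max ((\<lambda>j. av (coords b w j) * exp (- t j)) ` {1..d})"
      using s by (intro arg_cong[of _ _ Max] image_cong) (auto simp: exp_diff exp_minus exp_add field_simps)
    finally show ?thesis using w by (simp add: adapted_norm_def)
  qed
  then show "(adapted_norm b t, adapted_norm b t') \<in> homothety U l d"
    using adapted_norm_adaptable[OF b] x(1) unfolding homothety_def by blast
qed

lemma standard_marking_eq_iff:
  assumes b: "frame K d b" and p: "p \<in> model_apartment d"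
  shows "standard_marking U l d b p = homothety U l d `` {adapted_norm b t} \<longleftrightarrow>
    (\<exists>s. \<forall>j\<in>{1..d}. p j = t j + s)"
  unfolding standard_marking_eq[OF assms] homothety_adapted_norm_iff[OF b, symmetric]
  by (rule eq_equiv_class_iff[OF equiv_homothety adapted_norm_adaptable[OF b] adapted_norm_adaptable[OF b]])

text \<open>A common shift \<open>s\<close> changes the coordinate sum by \<open>d * s\<close>, so
  the normalisation to sum 1 forces \<open>s = 0\<close>.\<close>

lemma standard_marking_inj:
  assumes b: "frame K d b"
  shows "inj_on (standard_marking U l d b) (model_apartment d)"
proof (rule inj_onI)
  fix p q assume p: "p \<in> model_apartment d" and q: "q \<in> model_apartment d"
    and "standard_marking U l d b p = standard_marking U l d b q"
  then obtain s where s: "\<And>j. j \<in> {1..d} \<Longrightarrow> p j = q j + s"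
    using standard_marking_eq_iff[OF b p, of q] standard_marking_eq[OF b q] by metis
  have "(\<Sum>j=1..d. p j) = (\<Sum>j=1..d. q j + s)" using s by (intro sum.cong) auto
  then have "s = 0" using p q d_pos by (simp add: model_apartment_def sum.distrib)
  then show "p = q"
    using p q s by (intro extensionalityI[of p "{1..d}"]) (auto simp: model_apartment_def)
qed

lemma standard_marking_building:
  "frame K d b \<Longrightarrow> standard_marking U l d b ` model_apartment d \<subseteq> building U l d"
  unfolding building_def
  by (auto simp: standard_marking_eq intro!: quotientI adapted_norm_adaptable)

section \<open>Rescaling a frame\<close>

text \<open>The mean is subtracted to reach the sum-zero vectors; a constant shift leaves the
  homothety class of the norm unchanged.\<close>

definition rescaling_vector where
  "rescaling_vector r = (\<lambda>j\<in>{1..d}. ln (av (r j)) - (\<Sum>i=1..d. ln (av (r i))) / d)"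

lemma rescaling_vector_model: "rescaling_vector r \<in> model_vectors d"
  using d_pos by (simp add: model_vectors_def rescaling_vector_def sum_subtractf)

text \<open>Coordinates \<open>x j\<close> in \<open>b'\<close> become
  \<open>x j \<otimes> r j\<close> in \<open>b\<close>, and the shift of the exponent by
  \<open>ln (av (r j))\<close> cancels the extra factor.\<close>

lemma adapted_norm_rescale:
  assumes b: "frame K d b" and b': "frame K d b'"
    and r: "\<And>j. j \<in> {1..d} \<Longrightarrow> r j \<in> carrier K - {\<zero>\<^bsub>K\<^esub>}"
    and eq: "\<And>j. j \<in> {1..d} \<Longrightarrow> b' j = r j \<odot>\<^bsub>V\<^esub> b j"
  shows "adapted_norm b' t = adapted_norm b (\<lambda>j. t j + ln (av (r j)))"
proof (rule extensionalityI[of _ "carrier V"])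
  fix w assume w: "w \<in> carrier V"
  let ?x = "coords b' w"
  have x: "?x \<in> {1..d} \<rightarrow> carrier K" "cs.combine b' ?x = w" using coords[OF b' w] by auto
  have "cs.combine b (\<lambda>j. ?x j \<otimes>\<^bsub>K\<^esub> r j) = cs.combine b' ?x"
    using x r frame_Pi[OF b] frame_Pi[OF b'] eq
    by (intro cs.vs.finsum_cong') (auto simp: Pi_iff cs.vs.smult_assoc1)
  then have "adapted_norm b (\<lambda>j. t j + ln (av (r j))) w =
      Max ((\<lambda>j. av (?x j \<otimes>\<^bsub>K\<^esub> r j) * exp (- (t j + ln (av (r j))))) ` {1..d})"
    using adapted_norm_combine[OF b, of "\<lambda>j. ?x j \<otimes>\<^bsub>K\<^esub> r j"] x r by (auto simp: Pi_iff)
  also have "\<dots> = Max ((\<lambda>j. av (?x j) * exp (- t j)) ` {1..d})"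
  proof (intro arg_cong[of _ _ Max] image_cong refl)
    fix j assume j: "j \<in> {1..d}"
    have "av (r j) > 0" using r[OF j] absv_pos by simp
    then have "exp (- (t j + ln (av (r j)))) = exp (- t j) / av (r j)"
      by (simp add: exp_diff exp_minus exp_add field_simps)
    then show "av (?x j \<otimes>\<^bsub>K\<^esub> r j) * exp (- (t j + ln (av (r j)))) = av (?x j) * exp (- t j)"
      using \<open>av (r j) > 0\<close> x r j by (auto simp: absv_mult Pi_iff)
  qed
  finally show "adapted_norm b' t w = adapted_norm b (\<lambda>j. t j + ln (av (r j))) w"
    using w by (simp add: adapted_norm_def)
qed (auto simp: adapted_norm_def)

lemma standard_marking_rescale:
  assumes b: "frame K d b" and b': "frame K d b'"
    and r: "\<And>j. j \<in> {1..d} \<Longrightarrow> r j \<in> carrier K - {\<zero>\<^bsub>K\<^esub>}"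
    and eq: "\<And>j. j \<in> {1..d} \<Longrightarrow> b' j = r j \<odot>\<^bsub>V\<^esub> b j"
    and p: "p \<in> model_apartment d"
  shows "standard_marking U l d b' p =
    standard_marking U l d b (translation d (rescaling_vector r) p)"
proof -
  have q: "translation d (rescaling_vector r) p \<in> model_apartment d"
    using translation_bij[OF rescaling_vector_model] p by (auto simp: bij_betw_def)
  have "\<forall>j\<in>{1..d}. translation d (rescaling_vector r) p j =
      (p j + ln (av (r j))) + (- ((\<Sum>i=1..d. ln (av (r i))) / d))"
    using p by (auto simp: translation_def rescaling_vector_def)
  then have "standard_marking U l d b (translation d (rescaling_vector r) p) =
      homothety U l d `` {adapted_norm b (\<lambda>j. p j + ln (av (r j)))}"
    unfolding standard_marking_eq_iff[OF b q] by blast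
  then show ?thesis
    using standard_marking_eq[OF b' p] adapted_norm_rescale[OF b b' r eq, of p] by simp
qed

lemma standard_marking_rescale_image:
  assumes "frame K d b" "frame K d b'"
    and "\<And>j. j \<in> {1..d} \<Longrightarrow> r j \<in> carrier K - {\<zero>\<^bsub>K\<^esub>}"
    and "\<And>j. j \<in> {1..d} \<Longrightarrow> b' j = r j \<odot>\<^bsub>V\<^esub> b j"
  shows "standard_marking U l d b' ` model_apartment d = standard_marking U l d b ` model_apartment d"
proof -
  have "standard_marking U l d b' ` model_apartment d =
      standard_marking U l d b ` translation d (rescaling_vector r) ` model_apartment d"
    unfolding image_image by (rule image_cong[OF refl standard_marking_rescale[OF assms]])
  then show ?thesis
    using translation_bij[OF rescaling_vector_model] by (simp add: bij_betw_def)
qed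

text \<open>\<open>standard_marking_rescale\<close> factors the second marking through the first;
  injectivity then cancels the first.\<close>

lemma marking_change_rescale:
  assumes "frame K d b" "frame K d b'"
    and "\<And>j. j \<in> {1..d} \<Longrightarrow> r j \<in> carrier K - {\<zero>\<^bsub>K\<^esub>}"
    and "\<And>j. j \<in> {1..d} \<Longrightarrow> b' j = r j \<odot>\<^bsub>V\<^esub> b j"
  shows "marking_change d (standard_marking U l d b) (standard_marking U l d b') =
    translation d (rescaling_vector r)"
proof (rule extensionalityI[of _ "model_apartment d"])
  fix p assume p: "p \<in> model_apartment d"
  have "translation d (rescaling_vector r) p \<in> model_apartment d"
    using translation_bij[OF rescaling_vector_model] p by (auto simp: bij_betw_def)
  then show "marking_change d (standard_marking U l d b) (standard_marking U l d b') p =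
      translation d (rescaling_vector r) p"
    using p standard_marking_rescale[OF assms p] inv_into_f_f[OF standard_marking_inj[OF assms(1)]]
    by (simp add: marking_change_def)
qed (auto simp: marking_change_def translation_def)

lemma same_line_rescale:
  assumes v: "v \<in> carrier V" and w: "w \<in> carrier V" "w \<noteq> \<zero>\<^bsub>V\<^esub>"
    and "vspan K d {v} = vspan K d {w}"
  obtains c where "c \<in> carrier K - {\<zero>\<^bsub>K\<^esub>}" "w = c \<odot>\<^bsub>V\<^esub> v"
proof -
  have "w \<in> vspan K d {v}" using cs.vspan_superset[of "{w}"] w assms(4) by auto
  then obtain c where "c \<in> carrier K" "w = c \<odot>\<^bsub>V\<^esub> v"
    using cs.vspan_singleton[OF v] by auto
  moreover have "c \<noteq> \<zero>\<^bsub>K\<^esub>" using w v calculation by auto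
  ultimately show thesis using that by blast
qed

text \<open>The norm adapted to \<open>b\<close> with all exponents zero takes the value 1 at
  \<open>b i\<close>.\<close>

lemma frame_nonzero:
  assumes b: "frame K d b" and i: "i \<in> {1..d}"
  shows "b i \<noteq> \<zero>\<^bsub>V\<^esub>"
proof -
  have "adapted_norm b (\<lambda>_. 0) (b i) \<noteq> 0" using adapted_norm_basis[OF b i] by simp
  then show ?thesis
    using adapted_norm_ultrametric[OF b] cs.frame_V[OF b i] unfolding ultrametric_norm_def by blast
qed

text \<open>Two frames on the same lines differ by nonzero scalars, so their markings differ by a
  translation of the model and have one image; the description in \<open>apartment\<close> is
  therefore proper.\<close>

lemma apartment_eq:
  assumes b: "frame K d b" and L: "\<And>i. i \<in> {1..d} \<Longrightarrow> vspan K d {b i} = L i"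
  shows "apartment U l d L = standard_marking U l d b ` model_apartment d"
  unfolding apartment_def
proof (rule the_equality)
  fix A assume "\<exists>b. frame K d b \<and> (\<forall>i\<in>{1..d}. vspan K d {b i} = L i) \<and>
      A = standard_marking U l d b ` model_apartment d"
  then obtain b' where b': "frame K d b'" "\<And>i. i \<in> {1..d} \<Longrightarrow> vspan K d {b' i} = L i"
    and A: "A = standard_marking U l d b' ` model_apartment d" by blast
  have "\<forall>i\<in>{1..d}. \<exists>c\<in>carrier K - {\<zero>\<^bsub>K\<^esub>}. b' i = c \<odot>\<^bsub>V\<^esub> b i"
  proof
    fix i assume i: "i \<in> {1..d}"
    then obtain c where "c \<in> carrier K - {\<zero>\<^bsub>K\<^esub>}" "b' i = c \<odot>\<^bsub>V\<^esub> b i"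
      using same_line_rescale[OF cs.frame_V[OF b i] cs.frame_V[OF b'(1) i] frame_nonzero[OF b'(1) i]]
        L[OF i] b'(2)[OF i] by metis
    then show "\<exists>c\<in>carrier K - {\<zero>\<^bsub>K\<^esub>}. b' i = c \<odot>\<^bsub>V\<^esub> b i" by blast
  qed
  then obtain r where "\<And>i. i \<in> {1..d} \<Longrightarrow> r i \<in> carrier K - {\<zero>\<^bsub>K\<^esub>}"
    "\<And>i. i \<in> {1..d} \<Longrightarrow> b' i = r i \<odot>\<^bsub>V\<^esub> b i" by metis
  then show "A = standard_marking U l d b ` model_apartment d"
    using A standard_marking_rescale_image[OF b b'(1)] by blast
qed (use assms in blast)

end

section \<open>Double ratios of real flags\<close>

interpretation rs: coordinate_space real_field d for d
  by (intro coordinate_space.intro class_field)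

lemma pairing_real: "pairing real_field d u w = (\<Sum>i=1..d. u i * w i)"
  by (simp add: pairing_def class_ring_simps)

text \<open>Justifies the choice in \<open>some_basis\<close>: a finite basis exists and can be
  listed without repetition. Its length and span follow.\<close>

lemma some_basis_flag:
  assumes F: "is_flag real_field d F" and i: "i \<le> d" and fd: "rs.vs.fin_dim d"
  shows "length (some_basis d (F i)) = i" "set (some_basis d (F i)) \<subseteq> F i"
    "vspan real_field d (set (some_basis d (F i))) = F i"
proof -
  let ?V = "coord_space real_field d"
  let ?W = "?V\<lparr>carrier := F i\<rparr>"
  have sm: "submodule real_field (F i) ?V" and sub: "subspace real_field (F i) ?V"
    using F i rs.flag_submodule by (auto simp: is_flag_def)
  interpret W: vectorspace real_field ?W by (rule rs.vs.subspace_is_vs[OF sub])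
  obtain A where A: "finite A" "W.basis A"
    using rs.vs.subspace_finite_basis[OF fd sub] by metis
  then obtain bs where "distinct bs \<and> W.basis (set bs)"
    using finite_distinct_list by metis
  then have bs: "distinct (some_basis d (F i))" "W.basis (set (some_basis d (F i)))"
    unfolding some_basis_def by (metis (mono_tags, lifting) someI_ex)+
  have "W.dim = i" using F i by (simp add: is_flag_def vdim_def)
  then show "length (some_basis d (F i)) = i"
    using W.dim_basis[OF _ bs(2)] bs(1) by (simp add: distinct_card)
  show sub: "set (some_basis d (F i)) \<subseteq> F i"
    using bs(2) by (simp add: W.basis_def)
  show "vspan real_field d (set (some_basis d (F i))) = F i"
    using bs(2) rs.vs.span_li_not_depend(1)[OF sub sm] by (simp add: vspan_def W.basis_def)
qed

text \<open>Laplace expansion along the last column: the functional consists of the cofactors, which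
  do not involve that column.\<close>

lemma det_last_column_linear:
  assumes len: "length bs + 1 = d"
  obtains c where "c \<in> carrier (coord_space real_field d)"
    "\<And>x. det (mat d d (\<lambda>(i, j). ((bs @ [x]) ! j) (Suc i))) = pairing real_field d c x"
proof -
  define A where "A x = mat d d (\<lambda>(i, j). ((bs @ [x]) ! j) (Suc i))" for x :: "nat \<Rightarrow> real"
  have A: "A x \<in> carrier_mat d d" for x by (simp add: A_def)
  have del: "mat_delete (A x) i (d - 1) = mat_delete (A y) i (d - 1)" for x y i
    using len by (intro eq_matI) (auto simp: mat_delete_def A_def nth_append)
  \<comment> \<open>The last column is filled with zeros, since its content does not affect the
    cofactors; \<open>k - 1\<close> converts coordinates counted from 1 to matrix rows counted from
    0.\<close>
  define c where "c = (\<lambda>k\<in>{1..d}. cofactor (A (\<lambda>_. 0)) (k - 1) (d - 1))"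
  have "det (A x) = pairing real_field d c x" for x
  proof -
    have "det (A x) = (\<Sum>i<d. A x $$ (i, d - 1) * cofactor (A x) i (d - 1))"
      using len by (intro laplace_expansion_column[OF A]) auto
    also have "\<dots> = (\<Sum>i<d. c (Suc i) * x (Suc i))"
    proof (rule sum.cong[OF refl])
      fix i assume "i \<in> {..<d}"
      moreover from this have "A x $$ (i, d - 1) = x (Suc i)"
        using len by (auto simp: A_def nth_append)
      ultimately show "A x $$ (i, d - 1) * cofactor (A x) i (d - 1) = c (Suc i) * x (Suc i)"
        using del[of x i "\<lambda>_. 0"] by (simp add: c_def cofactor_def)
    qed
    also have "\<dots> = (\<Sum>k=1..d. c k * x k)"
      by (rule sum.reindex_bij_witness[of _ "\<lambda>k. k - 1" Suc]) auto
    finally show ?thesis by (simp add: pairing_real)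
  qed
  moreover have "c \<in> carrier (coord_space real_field d)" by (auto simp: c_def rs.carrier_V)
  ultimately show thesis using that by (auto simp: A_def)
qed

text \<open>A triple wedge whose last factor is a line is a covector evaluated on the chosen
  generator. It kills the first two factors because of repeated columns. The same \<open>c\<close>
  serves every line, so the two wedges in one quotient of the double ratio share it.\<close>

lemma wedge3_functional:
  assumes E: "is_flag real_field d E" and G: "is_flag real_field d G" and fd: "rs.vs.fin_dim d"
    and ab: "a + b + 1 = d"
  obtains c where "c \<in> carrier (coord_space real_field d)"
    "\<And>x. x \<in> E a \<Longrightarrow> pairing real_field d c x = 0"
    "\<And>x. x \<in> G b \<Longrightarrow> pairing real_field d c x = 0"
    "\<And>F x. some_basis d F = [x] \<Longrightarrow> wedge3 d (E a) (G b) F = pairing real_field d c x"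
proof -
  let ?V = "coord_space real_field d"
  define bs where "bs = some_basis d (E a) @ some_basis d (G b)"
  note bE = some_basis_flag[OF E _ fd, of a] and bG = some_basis_flag[OF G _ fd, of b]
  have len: "length bs + 1 = d" using ab bE bG by (simp add: bs_def)
  obtain c where c: "c \<in> carrier ?V"
    "\<And>x. det (mat d d (\<lambda>(i, j). ((bs @ [x]) ! j) (Suc i))) = pairing real_field d c x"
    using det_last_column_linear[OF len] by blast
  have ker: "submodule real_field {w \<in> carrier ?V. pairing real_field d c w = 0} ?V"
    using rs.submodule_pairing_zero[OF c(1)] by simp
  have "pairing real_field d c x = 0" if x: "x \<in> set bs" for x
  proof -
    obtain j where j: "j < length bs" "bs ! j = x" using x by (auto simp: in_set_conv_nth)
    have "det (mat d d (\<lambda>(i, j). ((bs @ [x]) ! j) (Suc i))) = 0"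
    proof (rule det_identical_columns[of _ d j "d - 1"])
      show "col (mat d d (\<lambda>(i, j). ((bs @ [x]) ! j) (Suc i))) j =
          col (mat d d (\<lambda>(i, j). ((bs @ [x]) ! j) (Suc i))) (d - 1)"
        using j len by (intro eq_vecI) (auto simp: nth_append)
    qed (use j len in auto)
    then show ?thesis using c(2) by simp
  qed
  moreover have "set bs \<subseteq> carrier ?V"
    using bE bG ab rs.flag_submodule[OF E, of a] rs.flag_submodule[OF G, of b]
    by (auto simp: bs_def submodule_def)
  ultimately have bs: "set bs \<subseteq> {w \<in> carrier ?V. pairing real_field d c w = 0}" by auto
  have "E a \<subseteq> {w \<in> carrier ?V. pairing real_field d c w = 0}"
    using rs.vspan_subset[OF _ ker, of "set (some_basis d (E a))"] bs bE ab by (auto simp: bs_def)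
  moreover have "G b \<subseteq> {w \<in> carrier ?V. pairing real_field d c w = 0}"
    using rs.vspan_subset[OF _ ker, of "set (some_basis d (G b))"] bs bG ab by (auto simp: bs_def)
  moreover have "wedge3 d (E a) (G b) F = pairing real_field d c x" if "some_basis d F = [x]" for F x
    using that c(2)[of x] by (simp add: wedge3_def bs_def)
  ultimately show thesis using that c(1) by blast
qed

text \<open>The combination c(f) u - u(f) c vanishes on \<open>A\<close>, on \<open>B\<close> and at
  \<open>f\<close>, hence at \<open>h\<close>. The product form avoids dividing by values that may
  be zero.\<close>

lemma covectors_proportional:
  assumes c: "c \<in> carrier (coord_space real_field d)" and u: "u \<in> carrier (coord_space real_field d)"
    and f: "f \<in> carrier (coord_space real_field d)" and h: "h \<in> carrier (coord_space real_field d)"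
    and span: "\<And>P. submodule real_field P (coord_space real_field d) \<Longrightarrow> A \<subseteq> P \<Longrightarrow> B \<subseteq> P \<Longrightarrow>
      vspan real_field d {f} \<subseteq> P \<Longrightarrow> P = carrier (coord_space real_field d)"
    and A: "A \<subseteq> carrier (coord_space real_field d)" and B: "B \<subseteq> carrier (coord_space real_field d)"
    and kill: "\<And>x. x \<in> A \<union> B \<Longrightarrow> pairing real_field d c x = 0 \<and> pairing real_field d u x = 0"
  shows "pairing real_field d c f * pairing real_field d u h =
    pairing real_field d c h * pairing real_field d u f"
proof -
  let ?V = "coord_space real_field d" and ?p = "pairing real_field d"
  define q where "q = (\<lambda>k\<in>{1..d}. ?p c f * u k - ?p u f * c k)"
  have q: "q \<in> carrier ?V" by (auto simp: q_def rs.carrier_V)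
  have pq: "?p q x = ?p c f * ?p u x - ?p u f * ?p c x" for x
    by (simp add: pairing_real q_def sum_subtractf sum_distrib_left left_diff_distrib mult.assoc)
  have ker: "submodule real_field {w \<in> carrier ?V. ?p q w = 0} ?V"
    using rs.submodule_pairing_zero[OF q] by simp
  have "{w \<in> carrier ?V. ?p q w = 0} = carrier ?V"
  proof (rule span[OF ker])
    show "A \<subseteq> {w \<in> carrier ?V. ?p q w = 0}" "B \<subseteq> {w \<in> carrier ?V. ?p q w = 0}"
      using A B kill by (auto simp: pq)
    show "vspan real_field d {f} \<subseteq> {w \<in> carrier ?V. ?p q w = 0}"
      using f by (intro rs.vspan_subset[OF _ ker]) (auto simp: pq)
  qed
  then have "?p q h = 0" using h by blast
  then show ?thesis by (simp add: pq)
qed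

text \<open>\<open>u\<close> and \<open>u'\<close> are multiples of the covectors \<open>c\<close>
  and \<open>c'\<close> of the two wedge quotients, with factors u(f)/c(f) and u'(f)/c'(f). Since
  u'(f) = -u(f), comparing both at the generator \<open>g\<close> of \<open>H 1\<close> yields
  exactly the double ratio, sign included.\<close>

lemma double_ratio_covector:
  assumes pos: "positive_quadruple d E F G H" and fd: "rs.vs.fin_dim d"
    and i: "0 < i" "i < d"
    and u: "u \<in> carrier (coord_space real_field d)" and u': "u' \<in> carrier (coord_space real_field d)"
    and ku: "\<And>x. x \<in> E i \<union> G (d - i - 1) \<Longrightarrow> pairing real_field d u x = 0"
    and ku': "\<And>x. x \<in> E (i - 1) \<union> G (d - i) \<Longrightarrow> pairing real_field d u' x = 0"
    and uF: "\<And>x. x \<in> F 1 \<Longrightarrow> pairing real_field d u x + pairing real_field d u' x = 0"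
    and h: "h \<in> H 1"
  shows "double_ratio d i E F G H * pairing real_field d u h = pairing real_field d u' h"
proof -
  let ?V = "coord_space real_field d" and ?p = "pairing real_field d"
  have flags: "is_flag real_field d E" "is_flag real_field d F" "is_flag real_field d G"
    "is_flag real_field d H" and ms: "max_span real_field d [E, F, G, H]"
    and Z: "double_ratio d i E F G H > 0"
    using pos i by (auto simp: positive_quadruple_def)
  have d1: "1 \<le> d" using i by simp
  obtain f where f: "some_basis d (F 1) = [f]"
    using some_basis_flag(1)[OF flags(2) d1 fd] by (metis One_nat_def length_0_conv length_Suc_conv)
  obtain g where g: "some_basis d (H 1) = [g]"
    using some_basis_flag(1)[OF flags(4) d1 fd] by (metis One_nat_def length_0_conv length_Suc_conv)
  have F1: "f \<in> F 1" "vspan real_field d {f} = F 1"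
    using some_basis_flag[OF flags(2) d1 fd] f by auto
  have H1: "g \<in> H 1" "vspan real_field d {g} = H 1"
    using some_basis_flag[OF flags(4) d1 fd] g by auto
  have fV: "f \<in> carrier ?V" and gV: "g \<in> carrier ?V" and hV: "h \<in> carrier ?V"
    using F1 H1 h rs.flag_submodule[OF flags(2) d1] rs.flag_submodule[OF flags(4) d1]
    by (auto simp: submodule_def)
  have proportional: "?p c f * ?p w g = ?p c g * ?p w f"
    if "a + b + 1 = d" "c \<in> carrier ?V" "w \<in> carrier ?V"
      "\<And>x. x \<in> E a \<union> G b \<Longrightarrow> ?p c x = 0 \<and> ?p w x = 0" for a b c w
  proof (rule covectors_proportional[where A = "E a" and B = "G b"])
    fix P assume P: "submodule real_field P ?V" "E a \<subseteq> P" "G b \<subseteq> P" "vspan real_field d {f} \<subseteq> P"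
    \<comment> \<open>Maximum span is used with indices \<open>a\<close>, 1, \<open>b\<close>, 0, so
      \<open>H\<close> contributes only the zero subspace.\<close>
    have "H 0 \<subseteq> P" using P(1) rs.flag_zero[OF flags(4)] by (auto simp: submodule_def)
    then show "P = carrier ?V"
      using P F1 that(1) by (intro rs.max_span_carrier[OF flags ms fd, of a 1 b 0]) auto
  qed (use that fV gV rs.flag_submodule[OF flags(1), of a] rs.flag_submodule[OF flags(3), of b]
      in \<open>auto simp: submodule_def\<close>)
  obtain c where c: "c \<in> carrier ?V" "\<And>x. x \<in> E i \<Longrightarrow> ?p c x = 0" "\<And>x. x \<in> G (d - i - 1) \<Longrightarrow> ?p c x = 0"
    "\<And>F x. some_basis d F = [x] \<Longrightarrow> wedge3 d (E i) (G (d - i - 1)) F = ?p c x"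
    using wedge3_functional[OF flags(1,3) fd, of i "d - i - 1"] i by auto
  obtain c' where c': "c' \<in> carrier ?V" "\<And>x. x \<in> E (i - 1) \<Longrightarrow> ?p c' x = 0"
    "\<And>x. x \<in> G (d - i) \<Longrightarrow> ?p c' x = 0"
    "\<And>F x. some_basis d F = [x] \<Longrightarrow> wedge3 d (E (i - 1)) (G (d - i)) F = ?p c' x"
    using wedge3_functional[OF flags(1,3) fd, of "i - 1" "d - i"] i by auto
  have ratio: "double_ratio d i E F G H = - (?p c f / ?p c g) * (?p c' g / ?p c' f)"
    using c(4)[OF f] c(4)[OF g] c'(4)[OF f] c'(4)[OF g] by (simp add: double_ratio_def)
  \<comment> \<open>Division by zero yields 0, so a positive double ratio forces all four values to
    be nonzero.\<close>
  then have nz: "?p c f \<noteq> 0" "?p c g \<noteq> 0" "?p c' g \<noteq> 0" "?p c' f \<noteq> 0" using Z by auto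
  have p1: "?p c f * ?p u g = ?p c g * ?p u f"
    using i c u ku by (intro proportional[of i "d - i - 1"]) auto
  have p2: "?p c' f * ?p u' g = ?p c' g * ?p u' f"
    using i c' u' ku' by (intro proportional[of "i - 1" "d - i"]) auto
  \<comment> \<open>Solved for the values at \<open>g\<close>, with u(f) left in the numerator
    because it may be zero.\<close>
  have ug: "?p u g = ?p c g * ?p u f / ?p c f" using p1 nz by (simp add: field_simps)
  have u'g: "?p u' g = - (?p c' g * ?p u f / ?p c' f)"
    using p2 nz uF[OF F1(1)] by (simp add: field_simps eq_neg_iff_add_eq_0 distrib_left[symmetric])
  have base: "double_ratio d i E F G H * ?p u g = ?p u' g"
    unfolding ratio ug u'g using nz by simp
  obtain t where "h = t \<odot>\<^bsub>?V\<^esub> g"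
    using h H1(2) rs.vspan_singleton[OF gV] by auto
  then have "?p u h = t * ?p u g" "?p u' h = t * ?p u' g"
    using rs.pairing_smult[OF u gV, of t] rs.pairing_smult[OF u' gV, of t] by auto
  then show ?thesis using base by (simp add: mult.left_commute)
qed

section \<open>Ultralimits of vectors and covectors\<close>

context asymptotic_building
begin

abbreviation W where "W \<equiv> coord_space real_field d"
abbreviation vl where "vl \<equiv> vec_ulim U l d"

definition moderate_vec where
  "moderate_vec w \<longleftrightarrow> (\<forall>k\<in>{1..d}. (\<lambda>n. w n k) \<in> moderate U l)"

lemma vl_coord: "k \<in> {1..d} \<Longrightarrow> vl w k = ul (\<lambda>n. w n k)"
  by (simp add: vec_ulim_def)

lemma vl_V [simp]: "moderate_vec w \<Longrightarrow> vl w \<in> carrier V"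
  by (auto simp: cs.carrier_V vec_ulim_def moderate_vec_def)

lemma pairing_moderate:
  assumes "moderate_vec u" "moderate_vec w"
  shows "(\<lambda>n. pairing real_field d (u n) (w n)) \<in> moderate U l"
  unfolding pairing_real using assms
  by (intro moderate_sum moderate_mult) (auto simp: moderate_vec_def)

lemma ulim_pairing:
  assumes "moderate_vec u" "moderate_vec w"
  shows "ul (\<lambda>n. pairing real_field d (u n) (w n)) = pairing K d (vl u) (vl w)"
proof -
  have m: "(\<lambda>n. u n k) \<in> moderate U l" "(\<lambda>n. w n k) \<in> moderate U l" if "k \<in> {1..d}" for k
    using assms that by (auto simp: moderate_vec_def)
  have "ul (\<lambda>n. pairing real_field d (u n) (w n)) = (\<Oplus>\<^bsub>K\<^esub>k\<in>{1..d}. ul (\<lambda>n. u n k * w n k))"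
    unfolding pairing_real by (rule ulim_sum) (use m moderate_mult in auto)
  also have "\<dots> = pairing K d (vl u) (vl w)"
    unfolding pairing_def using m by (intro K.finsum_cong') (auto simp: ulim_mult vl_coord)
  finally show ?thesis .
qed

lemma moderate_vec_add:
  assumes "moderate_vec u" "moderate_vec w"
  shows "moderate_vec (\<lambda>n. u n \<oplus>\<^bsub>W\<^esub> w n)" "vl (\<lambda>n. u n \<oplus>\<^bsub>W\<^esub> w n) = vl u \<oplus>\<^bsub>V\<^esub> vl w"
proof -
  show "moderate_vec (\<lambda>n. u n \<oplus>\<^bsub>W\<^esub> w n)"
    using assms by (auto simp: moderate_vec_def rs.add_V moderate_add)
  show "vl (\<lambda>n. u n \<oplus>\<^bsub>W\<^esub> w n) = vl u \<oplus>\<^bsub>V\<^esub> vl w"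
    unfolding cs.add_V vec_ulim_def using assms
    by (intro restrict_ext) (simp add: rs.add_V ulim_add moderate_vec_def)
qed

lemma moderate_vec_smult:
  assumes "c \<in> moderate U l" "moderate_vec w"
  shows "moderate_vec (\<lambda>n. c n \<odot>\<^bsub>W\<^esub> w n)" "vl (\<lambda>n. c n \<odot>\<^bsub>W\<^esub> w n) = ul c \<odot>\<^bsub>V\<^esub> vl w"
proof -
  show "moderate_vec (\<lambda>n. c n \<odot>\<^bsub>W\<^esub> w n)"
    using assms by (auto simp: moderate_vec_def rs.smult_V moderate_mult)
  show "vl (\<lambda>n. c n \<odot>\<^bsub>W\<^esub> w n) = ul c \<odot>\<^bsub>V\<^esub> vl w"
    unfolding cs.smult_V vec_ulim_def using assms
    by (intro restrict_ext) (simp add: rs.smult_V ulim_mult moderate_vec_def)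
qed

lemma moderate_vec_zero:
  "moderate_vec (\<lambda>n. \<zero>\<^bsub>W\<^esub>)" "vl (\<lambda>n. \<zero>\<^bsub>W\<^esub>) = \<zero>\<^bsub>V\<^esub>"
proof -
  show "moderate_vec (\<lambda>n. \<zero>\<^bsub>W\<^esub>)" by (simp add: moderate_vec_def rs.zero_V)
  show "vl (\<lambda>n. \<zero>\<^bsub>W\<^esub>) = \<zero>\<^bsub>V\<^esub>"
    unfolding cs.zero_V vec_ulim_def by (intro restrict_ext) (simp add: rs.zero_V)
qed

lemma has_vec_ulim_iff: "has_vec_ulim U l d w v \<longleftrightarrow> moderate_vec w \<and> v = vl w"
  by (simp add: has_vec_ulim_def moderate_vec_def)

text \<open>The transfer principle from sequences to the limit: \<open>F i\<close> is spanned by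
  ultralimits of vectors from \<open>Fn n i\<close>, so a submodule only has to contain the limits
  of moderate sequences in these subspaces.\<close>

lemma flag_ulim_subset:
  assumes F: "flag_ulim U l d Fn F" and i: "i \<le> d" and P: "submodule K P V"
    and lift: "\<And>w. moderate_vec w \<Longrightarrow> (\<And>n. w n \<in> Fn n i) \<Longrightarrow> (\<And>n. w n \<in> carrier W) \<Longrightarrow> vl w \<in> P"
  shows "F i \<subseteq> P"
proof -
  obtain w v where w: "\<And>n. frame real_field d (\<lambda>i. w i n)"
    and v: "\<And>i. i \<in> {1..d} \<Longrightarrow> moderate_vec (w i) \<and> v i = vl (w i)"
    and Fn: "\<And>n i. i \<le> d \<Longrightarrow> Fn n i = vspan real_field d ((\<lambda>j. w j n) ` {1..i})"
    and F: "\<And>i. i \<le> d \<Longrightarrow> F i = vspan K d (v ` {1..i})"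
    using F unfolding flag_ulim_def has_vec_ulim_iff by blast
  have "v j \<in> P" if j: "j \<in> {1..i}" for j
  proof -
    have jd: "j \<in> {1..d}" using i j by auto
    have car: "w k n \<in> carrier W" if "k \<in> {1..d}" for k n
      using rs.frame_V[OF w that] .
    have "(\<lambda>j. w j n) ` {1..i} \<subseteq> Fn n i" for n
      unfolding Fn[OF i] using car i by (intro rs.vspan_superset) auto
    then have "w j n \<in> Fn n i" for n using j by blast
    then show ?thesis using lift[of "w j"] v[OF jd] car[OF jd] by auto
  qed
  then show ?thesis unfolding F[OF i] by (intro cs.vspan_subset[OF _ P]) auto
qed

text \<open>The \<open>j\<close>-th coordinate of \<open>u n\<close> is its value on a lift of the \<open>j\<close>-th unit vector, up to an error
  that is at most half the size of \<open>u n\<close> for almost all \<open>n\<close>. Nothing is assumed about the growth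
  of \<open>u\<close> itself, so the error has to be absorbed into the left-hand side.\<close>

lemma moderate_covector:
  assumes u: "\<And>n. u n \<in> carrier W"
    and lift: "\<And>y. y \<in> carrier V \<Longrightarrow>
      \<exists>w. moderate_vec w \<and> vl w = y \<and> (\<lambda>n. pairing real_field d (u n) (w n)) \<in> moderate U l"
  shows "moderate_vec u"
proof -
  let ?p = "pairing real_field d" and ?\<delta> = "\<lambda>k j. if k = j then 1 else (0::real)"
  have "\<forall>j. \<exists>w. moderate_vec w \<and> vl w = cs.unit_vec j \<and> (\<lambda>n. ?p (u n) (w n)) \<in> moderate U l"
    using lift by simp
  then obtain y where y: "\<And>j. moderate_vec (y j)" "\<And>j. vl (y j) = cs.unit_vec j"
    "\<And>j. (\<lambda>n. ?p (u n) (y j n)) \<in> moderate U l" by metis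
  define N where "N n = (\<Sum>j=1..d. \<Sum>k=1..d. \<bar>y j n k - ?\<delta> k j\<bar>)" for n
  define S where "S n = (\<Sum>k=1..d. \<bar>u n k\<bar>)" for n
  have "(\<lambda>n. y j n k - ?\<delta> k j) \<in> negligible U l" if k: "k \<in> {1..d}" for j k
  proof -
    have m: "(\<lambda>n. y j n k) \<in> moderate U l" using y(1) k by (simp add: moderate_vec_def)
    have "ul (\<lambda>n. y j n k) = (if k = j then \<one>\<^bsub>K\<^esub> else \<zero>\<^bsub>K\<^esub>)"
      using vl_coord[OF k, of "y j"] k by (simp add: y(2) cs.unit_vec_def)
    also have "\<dots> = ul (\<lambda>n. ?\<delta> k j)" by (simp add: ulim_one)
    finally show ?thesis using ulim_eq_iff[OF m, of "\<lambda>n. ?\<delta> k j"] by simp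
  qed
  \<comment> \<open>Since \<open>l n \<ge> 1\<close>, this makes each of the \<open>d * d\<close>
    deviations at most \<open>exp (-1)\<close> divided by \<open>d * d\<close>; their sum
    \<open>N n\<close> is then at most \<open>exp (-1) \<le> 1 / 2\<close>.\<close>
  then have "eventually (\<lambda>n. \<bar>y j n k - ?\<delta> k j\<bar> \<le> exp (- (2 * ln d + 1) * l n)) U"
    if "k \<in> {1..d}" for j k
    using that unfolding negligible_iff by blast
  then have "eventually (\<lambda>n. \<forall>j\<in>{1..d}. \<forall>k\<in>{1..d}. \<bar>y j n k - ?\<delta> k j\<bar> \<le> exp (- (2 * ln d + 1) * l n)) U"
    by (intro eventually_ball_finite ballI) auto
  then have small: "eventually (\<lambda>n. \<bar>N n\<bar> \<le> 1 / 2) U"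
  proof eventually_elim
    case (elim n)
    have "\<bar>N n\<bar> = N n" unfolding N_def by (intro abs_of_nonneg sum_nonneg) auto
    also have "N n \<le> (\<Sum>j=1..d. \<Sum>k=1..d. exp (- (2 * ln d + 1) * l n))"
      unfolding N_def using elim by (intro sum_mono) auto
    also have "\<dots> = real d * real d * exp (- (2 * ln d + 1) * l n)" by simp
    also have "\<dots> \<le> real d * real d * exp (- (2 * ln d + 1))"
    proof (intro mult_left_mono iffD2[OF exp_le_cancel_iff])
      have "0 \<le> ln (real d)" using d_pos by simp
      then have "(2 * ln d + 1) * 1 \<le> (2 * ln d + 1) * l n"
        using l_ge_1[of n] by (intro mult_left_mono) auto
      then show "- (2 * ln d + 1) * l n \<le> - (2 * ln d + 1)"
        by (simp only: mult_minus_left mult_1_right neg_le_iff_le)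
    qed auto
    also have "\<dots> = exp (-1)"
      using d_pos by (simp add: exp_diff exp_minus exp_add exp_double power2_eq_square field_simps)
    also have "\<dots> \<le> 1 / 2"
      using exp_ge_add_one_self[of 1] by (simp add: exp_minus field_simps)
    finally show ?case .
  qed
  have "(\<lambda>n. 2 * (\<Sum>j=1..d. \<bar>?p (u n) (y j n)\<bar>)) \<in> moderate U l"
    using y(3) by (intro moderate_mult moderate_const moderate_sum) (simp add: moderate_iff)
  moreover have "eventually (\<lambda>n. \<bar>S n\<bar> \<le> \<bar>2 * (\<Sum>j=1..d. \<bar>?p (u n) (y j n)\<bar>)\<bar>) U"
    using small
  proof eventually_elim
    case (elim n)
    have S0: "S n \<ge> 0" unfolding S_def by (intro sum_nonneg) auto
    have uj: "\<bar>u n j\<bar> \<le> \<bar>?p (u n) (y j n)\<bar> + S n * (\<Sum>k=1..d. \<bar>y j n k - ?\<delta> k j\<bar>)"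
      if j: "j \<in> {1..d}" for j
    proof -
      have "(\<Sum>k=1..d. u n k * (y j n k - ?\<delta> k j)) = ?p (u n) (y j n) - (\<Sum>k=1..d. u n k * ?\<delta> k j)"
        by (simp add: pairing_real right_diff_distrib sum_subtractf)
      also have "(\<Sum>k=1..d. u n k * ?\<delta> k j) = u n j"
        using j by (simp add: if_distrib[of "\<lambda>x. _ * x"] sum.delta cong: if_cong)
      finally have "u n j = ?p (u n) (y j n) - (\<Sum>k=1..d. u n k * (y j n k - ?\<delta> k j))" by simp
      moreover have "\<bar>\<Sum>k=1..d. u n k * (y j n k - ?\<delta> k j)\<bar> \<le> (\<Sum>k=1..d. S n * \<bar>y j n k - ?\<delta> k j\<bar>)"
      proof (rule order_trans[OF sum_abs sum_mono])
        fix k assume k: "k \<in> {1..d}"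
        have "\<bar>u n k\<bar> \<le> S n" unfolding S_def using k by (intro member_le_sum) auto
        then show "\<bar>u n k * (y j n k - ?\<delta> k j)\<bar> \<le> S n * \<bar>y j n k - ?\<delta> k j\<bar>"
          unfolding abs_mult by (rule mult_right_mono) simp
      qed
      ultimately show ?thesis unfolding sum_distrib_left by linarith
    qed
    have "(\<Sum>j=1..d. \<bar>u n j\<bar>) \<le>
        (\<Sum>j=1..d. \<bar>?p (u n) (y j n)\<bar> + S n * (\<Sum>k=1..d. \<bar>y j n k - ?\<delta> k j\<bar>))"
      by (intro sum_mono uj)
    also have "\<dots> = (\<Sum>j=1..d. \<bar>?p (u n) (y j n)\<bar>) + S n * N n"
      by (simp add: sum.distrib N_def sum_distrib_left)
    also have "S n * N n \<le> S n * (1 / 2)" using elim S0 by (intro mult_left_mono) auto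
    finally have "S n \<le> 2 * (\<Sum>j=1..d. \<bar>?p (u n) (y j n)\<bar>)" by (simp add: S_def)
    then show ?case using S0 by linarith
  qed
  ultimately have "S \<in> moderate U l" by (rule moderate_mono)
  then have "(\<lambda>n. u n k) \<in> moderate U l" if "k \<in> {1..d}" for k
  proof (rule moderate_mono)
    have "\<bar>u n k\<bar> \<le> S n" for n unfolding S_def using that by (intro member_le_sum) auto
    then show "eventually (\<lambda>n. \<bar>u n k\<bar> \<le> \<bar>S n\<bar>) U"
      by (intro always_eventually allI) (rule order_trans[OF _ abs_ge_self])
  qed
  then show ?thesis by (simp add: moderate_vec_def)
qed

lemma ulim_annihilates:
  assumes u: "moderate_vec u" and F: "flag_ulim U l d Fn F" and i: "i \<le> d"
    and zero: "\<And>n x. x \<in> Fn n i \<Longrightarrow> pairing real_field d (u n) x = 0" and y: "y \<in> F i"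
  shows "pairing K d (vl u) y = \<zero>\<^bsub>K\<^esub>"
proof -
  have "F i \<subseteq> {w \<in> carrier V. pairing K d (vl u) w = \<zero>\<^bsub>K\<^esub>}"
  proof (rule flag_ulim_subset[OF F i cs.submodule_pairing_zero])
    fix w assume w: "moderate_vec w" "\<And>n. w n \<in> Fn n i"
    have "pairing K d (vl u) (vl w) = ul (\<lambda>n. 0)"
      using ulim_pairing[OF u w(1)] zero[OF w(2)] by simp
    then show "vl w \<in> {w \<in> carrier V. pairing K d (vl u) w = \<zero>\<^bsub>K\<^esub>}" using w by simp
  qed (use u in simp)
  then show ?thesis using y by auto
qed

text \<open>Transfers the identity supplied by the double ratio from the real flags to the limit
  line. The vectors where it holds form a submodule, so it suffices to check lifts.\<close>

lemma ulim_pairing_scale: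
  assumes u: "moderate_vec u" "moderate_vec u'" and c: "c \<in> moderate U l"
    and F: "flag_ulim U l d Fn F" and i: "i \<le> d"
    and eq: "\<And>n x. x \<in> Fn n i \<Longrightarrow> c n * pairing real_field d (u n) x = pairing real_field d (u' n) x"
    and y: "y \<in> F i"
  shows "ul c \<otimes>\<^bsub>K\<^esub> pairing K d (vl u) y = pairing K d (vl u') y"
proof -
  let ?P = "{y \<in> carrier V. ul c \<otimes>\<^bsub>K\<^esub> pairing K d (vl u) y = pairing K d (vl u') y}"
  have V: "vl u \<in> carrier V" "vl u' \<in> carrier V" using u by simp_all
  have P: "submodule K ?P V"
    using V c by (intro cs.submoduleI) (auto simp: cs.pairing_add cs.pairing_smult K.r_distr K.m_lcomm)
  have "F i \<subseteq> ?P"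
  proof (rule flag_ulim_subset[OF F i P])
    fix w assume w: "moderate_vec w" "\<And>n. w n \<in> Fn n i"
    have "ul c \<otimes>\<^bsub>K\<^esub> pairing K d (vl u) (vl w) = ul (\<lambda>n. c n * pairing real_field d (u n) (w n))"
      using ulim_mult[OF c pairing_moderate[OF u(1) w(1)]] ulim_pairing[OF u(1) w(1)] by simp
    also have "\<dots> = pairing K d (vl u') (vl w)"
      using ulim_pairing[OF u(2) w(1)] eq[OF w(2)] by simp
    finally show "vl w \<in> ?P" using w by simp
  qed
  then show ?thesis using y by auto
qed

end

section \<open>Preferred frames\<close>

text \<open>One setting for both preferred frames: \<open>T\<close> is \<open>F\<close> or
  \<open>H\<close>. The maximum span of the quadruple is reduced to two spanning properties that
  mention only \<open>E\<close>, \<open>T\<close> and \<open>G\<close>.\<close>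

locale limit_triple = asymptotic_building U l d for U l d +
  fixes En Tn Gn :: "nat \<Rightarrow> real flag" and E T G :: "(nat \<Rightarrow> real) set flag"
    and u :: "nat \<Rightarrow> nat \<Rightarrow> nat \<Rightarrow> real"
  assumes real_flags: "\<And>n. is_flag real_field d (En n)" "\<And>n. is_flag real_field d (Tn n)"
      "\<And>n. is_flag real_field d (Gn n)"
    and limits: "flag_ulim U l d En E" "flag_ulim U l d Tn T" "flag_ulim U l d Gn G"
    and span3: "\<And>a b P. a + b + 1 = d \<Longrightarrow> submodule K P V \<Longrightarrow> E a \<subseteq> P \<Longrightarrow> T 1 \<subseteq> P \<Longrightarrow> G b \<subseteq> P \<Longrightarrow>
      P = carrier V"
    and span2: "\<And>a b P. a + b = d \<Longrightarrow> submodule K P V \<Longrightarrow> E a \<subseteq> P \<Longrightarrow> G b \<subseteq> P \<Longrightarrow> P = carrier V"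
    and preferred: "preferred_sequence U l d En Tn Gn u"
begin

lemma flags: "is_flag K d E" "is_flag K d T" "is_flag K d G"
  using limits by (simp_all add: flag_ulim_def)

lemma u_W: "i \<in> {1..d} \<Longrightarrow> u i n \<in> carrier W"
  and u_zero: "i \<in> {1..d} \<Longrightarrow> x \<in> En n (d - i) \<union> Gn n (i - 1) \<Longrightarrow> pairing real_field d (u i n) x = 0"
proof -
  have "u i n \<in> carrier W \<and> (\<forall>x\<in>En n (d - i) \<union> Gn n (i - 1). pairing real_field d (u i n) x = 0)"
    if i: "i \<in> {1..d}" for i
  proof (cases "i = 1")
    case True
    \<comment> \<open>\<open>u 1\<close> is only required to annihilate \<open>En n (d - 1)\<close>;
      the subspace \<open>Gn n 0\<close> is zero, so the general pattern holds.\<close>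
    have "u 1 n \<in> annihilator real_field d (En n (d - 1))"
      using preferred by (simp add: preferred_sequence_def Let_def)
    then show ?thesis
      using True rs.flag_zero[OF real_flags(3)[of n]] by (auto simp: rs.annihilator_iff)
  next
    case False
    define j where "j = i - 1"
    have j: "i = j + 1" "1 \<le> j" "j < d" using False i by (auto simp: j_def)
    have "u (j + 1) n \<in> annihilator real_field d (En n (d - j - 1) <+>\<^bsub>W\<^esub> Gn n j)"
      using preferred j by (simp add: preferred_sequence_def Let_def)
    then show ?thesis
      using rs.vs.subset_set_add[OF rs.flag_submodule[OF real_flags(1)] rs.flag_submodule[OF real_flags(3)],
          of "d - j - 1" j n n] j
      by (auto simp: rs.annihilator_iff)
  qed
  then show "i \<in> {1..d} \<Longrightarrow> u i n \<in> carrier W"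
    "i \<in> {1..d} \<Longrightarrow> x \<in> En n (d - i) \<union> Gn n (i - 1) \<Longrightarrow> pairing real_field d (u i n) x = 0"
    by auto
qed

lemma u_alternating:
  assumes i: "1 \<le> i" "i < d" and x: "x \<in> Tn n 1"
  shows "pairing real_field d (u i n) x + pairing real_field d (u (i + 1) n) x = 0"
proof -
  have "u i n \<oplus>\<^bsub>W\<^esub> u (i + 1) n \<in>
      annihilator real_field d (En n (d - i - 1) <+>\<^bsub>W\<^esub> Tn n 1 <+>\<^bsub>W\<^esub> Gn n (i - 1))"
    using preferred i by (simp add: preferred_sequence_def Let_def)
  moreover have "x \<in> En n (d - i - 1) <+>\<^bsub>W\<^esub> Tn n 1 <+>\<^bsub>W\<^esub> Gn n (i - 1)"
    using x i rs.vs.subset_set_add rs.vs.set_add_submodule rs.flag_submodule[OF real_flags(1)]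
      rs.flag_submodule[OF real_flags(2)] rs.flag_submodule[OF real_flags(3)]
    by (meson diff_le_self dual_order.trans less_imp_le subsetD)
  ultimately have "pairing real_field d (u i n \<oplus>\<^bsub>W\<^esub> u (i + 1) n) x = 0"
    by (simp add: rs.annihilator_iff)
  moreover have "x \<in> carrier W"
    using x i rs.flag_submodule[OF real_flags(2), of 1 n] by (auto simp: submodule_def)
  ultimately show ?thesis
    using rs.pairing_add_left[OF u_W u_W, of i "i + 1" x n n] i by simp
qed

text \<open>Each step passes a bound on \<open>u i\<close> to \<open>u (i + 1)\<close> through their
  values on the line of \<open>T\<close>. The set \<open>P\<close> below asks only for some lift
  with moderate pairing, because the pairing may depend on the lift as long as
  \<open>u (i + 1)\<close> is not known to be moderate.\<close>

lemma u_moderate: "1 \<le> i \<Longrightarrow> i \<le> d \<Longrightarrow> moderate_vec (u i)"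
proof (induction i rule: dec_induct)
  case base
  then show ?case
    using preferred by (auto simp: preferred_sequence_def Let_def has_vec_ulim_iff)
next
  case (step i)
  then have m: "moderate_vec (u i)" and i: "1 \<le> i" "i < d" by auto
  let ?p = "pairing real_field d"
  define P where "P = {y \<in> carrier V. \<exists>w. moderate_vec w \<and> vl w = y \<and> (\<forall>n. w n \<in> carrier W) \<and>
      (\<lambda>n. ?p (u (i + 1) n) (w n)) \<in> moderate U l}"
  have u: "u (i + 1) n \<in> carrier W" for n using u_W i by simp
  \<comment> \<open>\<open>P\<close> contains the limits of all three flags: on the first and last the covector vanishes,
    and on the line \<open>Tn n 1\<close> it agrees with \<open>u i\<close> up to sign.\<close>
  have P: "submodule K P V"
  proof (rule cs.submoduleI)
    show "\<zero>\<^bsub>V\<^esub> \<in> P"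
      using moderate_vec_zero rs.pairing_zero[OF u] by (auto simp: P_def intro!: exI[of _ "\<lambda>n. \<zero>\<^bsub>W\<^esub>"])
    fix v w assume "v \<in> P" "w \<in> P"
    then obtain v' w' where v: "moderate_vec v'" "vl v' = v" "\<And>n. v' n \<in> carrier W"
      "(\<lambda>n. ?p (u (i + 1) n) (v' n)) \<in> moderate U l"
      and w: "moderate_vec w'" "vl w' = w" "\<And>n. w' n \<in> carrier W"
      "(\<lambda>n. ?p (u (i + 1) n) (w' n)) \<in> moderate U l"
      unfolding P_def by blast
    have "(\<lambda>n. ?p (u (i + 1) n) (v' n \<oplus>\<^bsub>W\<^esub> w' n)) \<in> moderate U l"
      using moderate_add[OF v(4) w(4)] rs.pairing_add[OF u v(3) w(3)] by simp
    then show "v \<oplus>\<^bsub>V\<^esub> w \<in> P"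
      using moderate_vec_add[OF v(1) w(1)] v w unfolding P_def
      by (auto intro!: exI[of _ "\<lambda>n. v' n \<oplus>\<^bsub>W\<^esub> w' n"])
  next
    fix c v assume "c \<in> carrier K" "v \<in> P"
    then obtain c' v' where c: "c' \<in> moderate U l" "c = ul c'"
      and v: "moderate_vec v'" "vl v' = v" "\<And>n. v' n \<in> carrier W"
      "(\<lambda>n. ?p (u (i + 1) n) (v' n)) \<in> moderate U l"
      unfolding P_def using ulim_surj by blast
    have "(\<lambda>n. ?p (u (i + 1) n) (c' n \<odot>\<^bsub>W\<^esub> v' n)) \<in> moderate U l"
      using moderate_mult[OF c(1) v(4)] rs.pairing_smult[OF u v(3)] by simp
    moreover have "c' n \<odot>\<^bsub>W\<^esub> v' n \<in> carrier W" for n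
      using v(3) by (intro rs.vs.smult_closed) auto
    ultimately show "c \<odot>\<^bsub>V\<^esub> v \<in> P"
      using moderate_vec_smult[OF c(1) v(1)] vl_V[OF v(1)] v(2) c(2) \<open>c \<in> carrier K\<close> unfolding P_def
      by (intro CollectI conjI exI[of _ "\<lambda>n. c' n \<odot>\<^bsub>W\<^esub> v' n"]) auto
  qed (auto simp: P_def)
  have "P = carrier V"
  proof (rule span3[of "d - (i + 1)" i])
    show "E (d - (i + 1)) \<subseteq> P"
    proof (rule flag_ulim_subset[OF limits(1) _ P])
      fix w assume w: "moderate_vec w" "\<And>n. w n \<in> En n (d - (i + 1))" "\<And>n. w n \<in> carrier W"
      then have "?p (u (i + 1) n) (w n) = 0" for n using u_zero[of "i + 1" "w n" n] i by auto
      then show "vl w \<in> P" using w by (auto simp: P_def intro!: exI[of _ w])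
    qed simp
    show "G i \<subseteq> P"
    proof (rule flag_ulim_subset[OF limits(3) _ P])
      fix w assume w: "moderate_vec w" "\<And>n. w n \<in> Gn n i" "\<And>n. w n \<in> carrier W"
      then have "?p (u (i + 1) n) (w n) = 0" for n using u_zero[of "i + 1" "w n" n] i by auto
      then show "vl w \<in> P" using w by (auto simp: P_def intro!: exI[of _ w])
    qed (use i in simp)
    show "T 1 \<subseteq> P"
    proof (rule flag_ulim_subset[OF limits(2) _ P])
      fix w assume w: "moderate_vec w" "\<And>n. w n \<in> Tn n 1" "\<And>n. w n \<in> carrier W"
      then have "?p (u (i + 1) n) (w n) = - ?p (u i n) (w n)" for n
        using u_alternating[OF i, of "w n" n] by simp
      then have "(\<lambda>n. ?p (u (i + 1) n) (w n)) \<in> moderate U l"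
        using moderate_uminus[OF pairing_moderate[OF m w(1)]] by simp
      then show "vl w \<in> P" using w by (auto simp: P_def intro!: exI[of _ w])
    qed (use i in simp)
  qed (use i P in auto)
  then have "moderate_vec (u (i + 1))"
    unfolding P_def by (intro moderate_covector u) blast
  then show ?case unfolding Suc_eq_plus1 .
qed

section \<open>The limit covectors and their lines\<close>

abbreviation b where "b i \<equiv> vl (u i)"

lemma b_V: "i \<in> {1..d} \<Longrightarrow> b i \<in> carrier V"
  using u_moderate by auto

lemma b_zero:
  assumes i: "i \<in> {1..d}" and y: "y \<in> E (d - i) \<union> G (i - 1)"
  shows "pairing K d (b i) y = \<zero>\<^bsub>K\<^esub>"
  using y
proof
  assume "y \<in> E (d - i)"
  then show ?thesis
    using i u_zero[OF i] by (intro ulim_annihilates[OF u_moderate limits(1), of i "d - i"]) auto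
next
  assume "y \<in> G (i - 1)"
  then show ?thesis
    using i u_zero[OF i] by (intro ulim_annihilates[OF u_moderate limits(3), of i "i - 1"]) auto
qed

lemma T_V: "y \<in> T 1 \<Longrightarrow> y \<in> carrier V"
  using cs.flag_submodule[OF flags(2), of 1] d_pos by (auto simp: submodule_def)

lemma b_alternating:
  assumes i: "1 \<le> i" "i < d" and y: "y \<in> T 1"
  shows "pairing K d (b i) y = \<ominus>\<^bsub>K\<^esub> pairing K d (b (i + 1)) y"
proof -
  have m: "moderate_vec (u i)" "moderate_vec (u (i + 1))" using u_moderate i by auto
  have "pairing K d (vl (\<lambda>n. u i n \<oplus>\<^bsub>W\<^esub> u (i + 1) n)) y = \<zero>\<^bsub>K\<^esub>"
  proof (rule ulim_annihilates[OF moderate_vec_add(1)[OF m] limits(2) d_pos _ y])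
    fix n x assume x: "x \<in> Tn n 1"
    then have "x \<in> carrier W"
      using rs.flag_submodule[OF real_flags(2) d_pos, of n] by (auto simp: submodule_def)
    then show "pairing real_field d (u i n \<oplus>\<^bsub>W\<^esub> u (i + 1) n) x = 0"
      using u_alternating[OF i x] rs.pairing_add_left[OF u_W u_W, of i "i + 1" x n n] i by simp
  qed
  then have "pairing K d (b i) y \<oplus>\<^bsub>K\<^esub> pairing K d (b (i + 1)) y = \<zero>\<^bsub>K\<^esub>"
    using moderate_vec_add(2)[OF m] cs.pairing_add_left[OF b_V b_V T_V[OF y], of i "i + 1"] i by simp
  then show ?thesis
    using K.minus_equality b_V T_V[OF y] i by (simp add: K.minus_equality)
qed

text \<open>If \<open>b 1\<close> vanished on \<open>T 1\<close> as it does on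
  \<open>E (d - 1)\<close>, it would vanish everywhere, whereas \<open>b 1\<close> is nonzero.
  Alternation carries the value at one \<open>y\<close>, up to sign, to all indices.\<close>

lemma T_nonzero:
  obtains y where "y \<in> T 1" "\<And>i. i \<in> {1..d} \<Longrightarrow> pairing K d (b i) y \<noteq> \<zero>\<^bsub>K\<^esub>"
proof -
  have b1: "b 1 \<noteq> \<zero>\<^bsub>V\<^esub>" "b 1 \<in> carrier V"
    using preferred d_pos b_V[of 1] by (auto simp: preferred_sequence_def Let_def has_vec_ulim_iff)
  let ?P = "{w \<in> carrier V. pairing K d (b 1) w = \<zero>\<^bsub>K\<^esub>}"
  have P: "submodule K ?P V" by (rule cs.submodule_pairing_zero[OF b1(2)])
  have EV: "E (d - 1) \<subseteq> carrier V" "G 0 \<subseteq> carrier V"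
    using cs.flag_submodule[OF flags(1), of "d - 1"] cs.flag_submodule[OF flags(3), of 0]
    by (auto simp: submodule_def)
  have "\<not> T 1 \<subseteq> ?P"
  proof
    assume "T 1 \<subseteq> ?P"
    then have "?P = carrier V"
      using b_zero[of 1] EV d_pos by (intro span3[of "d - 1" 0, OF _ P]) auto
    then have "b 1 = \<zero>\<^bsub>V\<^esub>" by (intro cs.pairing_nondegenerate[OF b1(2)]) blast
    then show False using b1 by blast
  qed
  then obtain y where y: "y \<in> T 1" "pairing K d (b 1) y \<noteq> \<zero>\<^bsub>K\<^esub>" using T_V by blast
  have "pairing K d (b i) y \<noteq> \<zero>\<^bsub>K\<^esub>" if "1 \<le> i" "i \<le> d" for i
    using that
  proof (induction i rule: dec_induct)
    case (step i)
    then have "pairing K d (b (i + 1)) y \<in> carrier K" using b_V T_V[OF y(1)] by simp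
    then have "\<ominus>\<^bsub>K\<^esub> pairing K d (b (i + 1)) y = \<zero>\<^bsub>K\<^esub>" if "pairing K d (b (i + 1)) y = \<zero>\<^bsub>K\<^esub>"
      unfolding that by simp
    then show ?case using b_alternating[OF _ _ y(1), of i] step by (metis Suc_eq_plus1 Suc_le_eq less_imp_le)
  qed (use y in simp)
  then show thesis using that y(1) by auto
qed

text \<open>Diagonal entries: \<open>b i\<close> kills \<open>E (d - i)\<close>, so if it also
  killed \<open>G i\<close> it would be zero by \<open>span2\<close>, against
  \<open>T_nonzero\<close>. Off the diagonal, for \<open>j < i\<close>, the vector
  \<open>g j\<close> lies in \<open>G (i - 1)\<close>.\<close>

lemma b_frame: "frame K d b"
proof -
  have "\<exists>g\<in>G i. pairing K d (b i) g \<noteq> \<zero>\<^bsub>K\<^esub>" if i: "i \<in> {1..d}" for i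
  proof (rule ccontr)
    assume *: "\<not> ?thesis"
    let ?P = "{w \<in> carrier V. pairing K d (b i) w = \<zero>\<^bsub>K\<^esub>}"
    have "E (d - i) \<subseteq> carrier V" "G i \<subseteq> carrier V"
      using cs.flag_submodule[OF flags(1), of "d - i"] cs.flag_submodule[OF flags(3), of i] i
      by (auto simp: submodule_def)
    then have "?P = carrier V"
      using i b_zero[OF i] * by (intro span2[of "d - i" i, OF _ cs.submodule_pairing_zero[OF b_V[OF i]]]) auto
    then show False using T_nonzero T_V i by (metis (mono_tags, lifting) mem_Collect_eq)
  qed
  then obtain g where g: "\<And>i. i \<in> {1..d} \<Longrightarrow> g i \<in> G i"
    "\<And>i. i \<in> {1..d} \<Longrightarrow> pairing K d (b i) (g i) \<noteq> \<zero>\<^bsub>K\<^esub>" by metis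
  obtain v where v: "frame K d v" using limits(1) unfolding flag_ulim_def by blast
  show ?thesis
  proof (rule cs.frame_triangular[OF cs.frame_fin_dim[OF v] cs.flag_dim[OF flags(1)]])
    show "b \<in> {1..d} \<rightarrow> carrier V" using b_V by blast
    show "g \<in> {1..d} \<rightarrow> carrier V"
      using g(1) cs.flag_submodule[OF flags(3)] by (auto simp: submodule_def subset_iff)
    fix i j assume ij: "i \<in> {1..d}" "j \<in> {1..d}" "j < i"
    then have "G j \<subseteq> G (i - 1)" by (intro cs.flag_mono[OF flags(3)]) auto
    then have "g j \<in> G (i - 1)" using g(1)[OF ij(2)] by blast
    then show "pairing K d (b i) (g j) = \<zero>\<^bsub>K\<^esub>" using b_zero[OF ij(1)] by blast
  qed (use g in blast)
qed

text \<open>For \<open>x\<close> in the annihilator, subtracting the multiple of \<open>b i\<close>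
  that agrees with it on the line \<open>T 1\<close> leaves a covector killing
  \<open>E (d - i)\<close>, \<open>T 1\<close> and \<open>G (i - 1)\<close>, hence zero. So the
  lines depend on \<open>E\<close> and \<open>G\<close> alone.\<close>

lemma b_line:
  assumes i: "i \<in> {1..d}"
  shows "vspan K d {b i} = annihilator K d (E (d - i) <+>\<^bsub>V\<^esub> G (i - 1))"
proof (intro equalityI subsetI)
  have sm: "submodule K (E (d - i)) V" "submodule K (G (i - 1)) V"
    using i by (auto intro!: cs.flag_submodule[OF flags(1)] cs.flag_submodule[OF flags(3)])
  have EGV: "E (d - i) \<subseteq> carrier V" "G (i - 1) \<subseteq> carrier V"
    using sm by (auto simp: submodule_def)
  fix x
  {
    assume "x \<in> vspan K d {b i}"
    then obtain c where c: "c \<in> carrier K" "x = c \<odot>\<^bsub>V\<^esub> b i" using cs.vspan_singleton[OF b_V[OF i]] by auto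
    let ?P = "{w \<in> carrier V. pairing K d (b i) w = \<zero>\<^bsub>K\<^esub>}"
    have "E (d - i) <+>\<^bsub>V\<^esub> G (i - 1) \<subseteq> ?P"
      using b_zero[OF i] EGV
      by (intro cs.vs.set_add_subset_submodule cs.submodule_pairing_zero b_V i) auto
    then show "x \<in> annihilator K d (E (d - i) <+>\<^bsub>V\<^esub> G (i - 1))"
      using c b_V[OF i] by (auto simp: cs.annihilator_iff cs.pairing_smult_left)
  next
    assume "x \<in> annihilator K d (E (d - i) <+>\<^bsub>V\<^esub> G (i - 1))"
    then have x: "x \<in> carrier V" "\<And>w. w \<in> E (d - i) \<union> G (i - 1) \<Longrightarrow> pairing K d x w = \<zero>\<^bsub>K\<^esub>"
      using cs.vs.subset_set_add[OF sm] by (auto simp: cs.annihilator_iff)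
    obtain y where y: "y \<in> T 1" "pairing K d (b i) y \<noteq> \<zero>\<^bsub>K\<^esub>" using T_nonzero i by metis
    let ?s = "pairing K d (b i) y" and ?t = "pairing K d x y"
    have st: "?s \<in> carrier K" "?t \<in> carrier K" "inv\<^bsub>K\<^esub> ?s \<in> carrier K" "inv\<^bsub>K\<^esub> ?s \<otimes>\<^bsub>K\<^esub> ?s = \<one>\<^bsub>K\<^esub>"
      using b_V[OF i] x(1) T_V[OF y(1)] y(2) K.field_Units by auto
    define c where "c = ?t \<otimes>\<^bsub>K\<^esub> inv\<^bsub>K\<^esub> ?s"
    have c: "c \<in> carrier K" "c \<otimes>\<^bsub>K\<^esub> ?s = ?t" using st by (simp_all add: c_def K.m_assoc)
    define q where "q = x \<oplus>\<^bsub>V\<^esub> (\<ominus>\<^bsub>K\<^esub> c) \<odot>\<^bsub>V\<^esub> b i"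
    have q: "q \<in> carrier V" using x c b_V[OF i] by (simp add: q_def)
    have pq: "pairing K d q w = pairing K d x w \<ominus>\<^bsub>K\<^esub> c \<otimes>\<^bsub>K\<^esub> pairing K d (b i) w"
      if "w \<in> carrier V" for w
      using that x(1) c(1) b_V[OF i]
      by (simp add: q_def cs.pairing_add_left cs.pairing_smult_left K.l_minus K.minus_eq)
    let ?P = "{w \<in> carrier V. pairing K d q w = \<zero>\<^bsub>K\<^esub>}"
    have "pairing K d q y = \<zero>\<^bsub>K\<^esub>" using pq[OF T_V[OF y(1)]] c st by simp
    \<comment> \<open>\<open>T 1\<close> is a line and \<open>y\<close> a nonzero vector on it, so
      vanishing at \<open>y\<close> is passed to the whole line through the generator
      \<open>v 1\<close>.\<close>
    have T1: "pairing K d q w = \<zero>\<^bsub>K\<^esub>" if w: "w \<in> T 1" for w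
    proof -
      obtain v where "frame K d v" "T 1 = vspan K d (v ` {1..1})"
        using limits(2) d_pos unfolding flag_ulim_def by blast
      then have v: "T 1 = vspan K d {v 1}" "v 1 \<in> carrier V" using cs.frame_V d_pos by auto
      obtain a where a: "a \<in> carrier K" "y = a \<odot>\<^bsub>V\<^esub> v 1" using y v cs.vspan_singleton by auto
      have "a \<noteq> \<zero>\<^bsub>K\<^esub>"
        using a y v cs.pairing_zero[OF b_V[OF i]] by auto
      have "a \<otimes>\<^bsub>K\<^esub> pairing K d q (v 1) = \<zero>\<^bsub>K\<^esub>"
        using \<open>pairing K d q y = \<zero>\<^bsub>K\<^esub>\<close> a v q by (simp add: cs.pairing_smult)
      then have "pairing K d q (v 1) = \<zero>\<^bsub>K\<^esub>"
        using K.integral[of a "pairing K d q (v 1)"] a v q \<open>a \<noteq> \<zero>\<^bsub>K\<^esub>\<close> by simp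
      moreover obtain a' where "a' \<in> carrier K" "w = a' \<odot>\<^bsub>V\<^esub> v 1" using w v cs.vspan_singleton by auto
      ultimately show ?thesis using q v by (simp add: cs.pairing_smult)
    qed
    have "?P = carrier V"
    proof (rule span3[of "d - i" "i - 1", OF _ cs.submodule_pairing_zero[OF q]])
      have "pairing K d q w = \<zero>\<^bsub>K\<^esub>" if "w \<in> E (d - i) \<union> G (i - 1)" for w
      proof -
        have "w \<in> carrier V" using that EGV by blast
        then show ?thesis
          using pq[of w] x(2)[OF that] b_zero[OF i that] c(1) by (simp add: K.minus_eq)
      qed
      then show "E (d - i) \<subseteq> ?P" "G (i - 1) \<subseteq> ?P" using EGV by blast+
      show "T 1 \<subseteq> ?P" using T1 T_V by blast
    qed (use i in auto)
    then have "q = \<zero>\<^bsub>V\<^esub>" by (intro cs.pairing_nondegenerate[OF q]) blast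
    then have "x = c \<odot>\<^bsub>V\<^esub> b i"
      using x(1) c(1) b_V[OF i] cs.vs.minus_equality[of x "\<ominus>\<^bsub>V\<^esub> (c \<odot>\<^bsub>V\<^esub> b i)"]
      by (simp add: q_def cs.vs.smult_l_minus)
    then show "x \<in> vspan K d {b i}" using cs.vspan_singleton[OF b_V[OF i]] c(1) by auto
  }
qed

end

section \<open>The change of preferred markings\<close>

theorem theorem1p2:
  fixes U :: "nat filter" and l :: "nat \<Rightarrow> real" and d :: nat
    and En Fn Gn Hn :: "nat \<Rightarrow> real flag"
    and E F G H :: "(nat \<Rightarrow> real) set flag"
    and f f' :: "(nat \<Rightarrow> real) \<Rightarrow> (dual_vec \<Rightarrow> real) set"
  assumes "nonprincipal_ultrafilter U"
    and "\<And>n. l n \<ge> 1"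
    and "filterlim l at_top sequentially"
    and "d \<ge> 2"
    and "\<And>n. positive_quadruple d (En n) (Fn n) (Gn n) (Hn n)"
    and "positive_ultralimit U l d En Fn Gn Hn E F G H"
    and "preferred_marking U l d En Fn Gn f"
    and "preferred_marking U l d En Hn Gn f'"
  shows "flag_apartment U l d E G \<subseteq> building U l d \<and>
    bij_betw f (model_apartment d) (flag_apartment U l d E G) \<and>
    bij_betw f' (model_apartment d) (flag_apartment U l d E G) \<and>
    marking_change d f f' \<in> affine_weyl d \<and>
    (\<exists>!x. x \<in> model_vectors d \<and>
       (\<forall>i\<in>{1..d - 1}. ereal (x (i + 1) - x i) =
          val U l (ulim U l (\<lambda>n. double_ratio d (d - i) (En n) (Fn n) (Gn n) (Hn n))))) \<and>
    (\<forall>x. x \<in> model_vectors d \<and>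
       (\<forall>i\<in>{1..d - 1}. ereal (x (i + 1) - x i) =
          val U l (ulim U l (\<lambda>n. double_ratio d (d - i) (En n) (Fn n) (Gn n) (Hn n)))) \<longrightarrow>
       marking_change d f f' = translation d x)"
proof -
  interpret asymptotic_building U l d
    using assms(1-4) by unfold_locales auto
  note pos = assms(5)
  have lim: "flag_ulim U l d En E" "flag_ulim U l d Fn F" "flag_ulim U l d Gn G" "flag_ulim U l d Hn H"
    and ms: "max_span K d [E, F, G, H]"
    and Z_pos: "\<And>i. 0 < i \<Longrightarrow> i < d \<Longrightarrow>
      defines_pos U l (\<lambda>n. double_ratio d i (En n) (Fn n) (Gn n) (Hn n))"
    using assms(6) by (auto simp: positive_ultralimit_def)
  have flags: "is_flag K d E" "is_flag K d F" "is_flag K d G" "is_flag K d H"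
    using lim by (simp_all add: flag_ulim_def)
  have fd: "cs.vs.fin_dim"
    using lim(1) cs.frame_fin_dim unfolding flag_ulim_def by blast
  have rfd: "rs.vs.fin_dim d"
    using lim(1) rs.frame_fin_dim unfolding flag_ulim_def by blast
  have rflags: "is_flag real_field d (En n)" "is_flag real_field d (Fn n)"
    "is_flag real_field d (Gn n)" "is_flag real_field d (Hn n)" for n
    using pos[of n] by (simp_all add: positive_quadruple_def)
  have zero: "E 0 \<subseteq> P" "F 0 \<subseteq> P" "G 0 \<subseteq> P" "H 0 \<subseteq> P" if "submodule K P V" for P
    using that cs.flag_zero[OF flags(1)] cs.flag_zero[OF flags(2)] cs.flag_zero[OF flags(3)]
      cs.flag_zero[OF flags(4)] by (auto simp: submodule_def)
  note spanning = cs.max_span_carrier[OF flags ms fd]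
  have span2: "P = carrier V" if "a + b = d" "submodule K P V" "E a \<subseteq> P" "G b \<subseteq> P" for a b P
    using that zero by (intro spanning[of a 0 b 0]) auto
  obtain u where u: "preferred_sequence U l d En Fn Gn u"
    and f: "f = standard_marking U l d (\<lambda>i. vl (u i))"
    using assms(7) by (auto simp: preferred_marking_def)
  obtain u' where u': "preferred_sequence U l d En Hn Gn u'"
    and f': "f' = standard_marking U l d (\<lambda>i. vl (u' i))"
    using assms(8) by (auto simp: preferred_marking_def)
  interpret F: limit_triple U l d En Fn Gn E F G u
  proof
    fix a b P
    assume "a + b + 1 = d" "submodule K P V" "E a \<subseteq> P" "F 1 \<subseteq> P" "G b \<subseteq> P"
    then show "P = carrier V" using zero by (intro spanning[of a 1 b 0]) auto
  qed (use rflags lim span2 u in auto)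
  interpret H: limit_triple U l d En Hn Gn E H G u'
  proof
    fix a b P
    assume "a + b + 1 = d" "submodule K P V" "E a \<subseteq> P" "H 1 \<subseteq> P" "G b \<subseteq> P"
    then show "P = carrier V" using zero by (intro spanning[of a 0 b 1]) auto
  qed (use rflags lim span2 u' in auto)
  have "\<forall>j\<in>{1..d}. \<exists>c\<in>carrier K - {\<zero>\<^bsub>K\<^esub>}. H.b j = c \<odot>\<^bsub>V\<^esub> F.b j"
  proof
    fix j assume j: "j \<in> {1..d}"
    obtain c where "c \<in> carrier K - {\<zero>\<^bsub>K\<^esub>}" "H.b j = c \<odot>\<^bsub>V\<^esub> F.b j"
      using same_line_rescale[OF F.b_V[OF j] H.b_V[OF j] frame_nonzero[OF H.b_frame j]]
        F.b_line[OF j] H.b_line[OF j] by metis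
    then show "\<exists>c\<in>carrier K - {\<zero>\<^bsub>K\<^esub>}. H.b j = c \<odot>\<^bsub>V\<^esub> F.b j" by blast
  qed
  then obtain r where r: "\<And>j. j \<in> {1..d} \<Longrightarrow> r j \<in> carrier K - {\<zero>\<^bsub>K\<^esub>}"
    "\<And>j. j \<in> {1..d} \<Longrightarrow> H.b j = r j \<odot>\<^bsub>V\<^esub> F.b j" by metis
  let ?Z = "\<lambda>i n. double_ratio d (d - i) (En n) (Fn n) (Gn n) (Hn n)"
  define x where "x = rescaling_vector r"
  have x: "x \<in> model_vectors d" unfolding x_def by (rule rescaling_vector_model)
  have diff: "ereal (x (j + 1) - x j) = val U l (ul (?Z j))" if "j \<in> {1..d - 1}" for j
  proof -
    have j: "1 \<le> j" "j < d" "j \<in> {1..d}" "j + 1 \<in> {1..d}" using that by auto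
    have Zm: "?Z j \<in> moderate U l" and Z0: "ul (?Z j) \<noteq> \<zero>\<^bsub>K\<^esub>"
      using Z_pos[of "d - j"] j by (auto simp: defines_pos_def asym_pos_def)
    \<comment> \<open>Evaluation takes place on the line of \<open>H\<close>, where both the double
      ratio relation for \<open>F.b\<close> and the alternation of \<open>H.b\<close> hold.\<close>
    obtain y where y: "y \<in> H 1" "pairing K d (H.b j) y \<noteq> \<zero>\<^bsub>K\<^esub>" using H.T_nonzero j by metis
    have yV: "y \<in> carrier V" by (rule H.T_V[OF y(1)])
    let ?A = "pairing K d (F.b j) y"
    have A: "?A \<in> carrier K" using F.b_V j yV by simp
    have rK: "r j \<in> carrier K" "r (j + 1) \<in> carrier K" using r(1) j by auto
    have ratio: "ul (?Z j) \<otimes>\<^bsub>K\<^esub> ?A = pairing K d (F.b (j + 1)) y"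
    proof (rule ulim_pairing_scale[OF F.u_moderate F.u_moderate Zm lim(4) d_pos _ y(1)])
      fix n h assume h: "h \<in> Hn n 1"
      show "?Z j n * pairing real_field d (u j n) h = pairing real_field d (u (j + 1) n) h"
      proof (rule double_ratio_covector[OF pos rfd _ _ F.u_W F.u_W _ _ _ h])
        show "pairing real_field d (u j n) z = 0" if "z \<in> En n (d - j) \<union> Gn n (d - (d - j) - 1)" for z
          using that F.u_zero[OF j(3), of z n] j by auto
        show "pairing real_field d (u (j + 1) n) z = 0"
          if "z \<in> En n (d - j - 1) \<union> Gn n (d - (d - j))" for z
          using that F.u_zero[OF j(4), of z n] j by auto
        show "pairing real_field d (u j n) z + pairing real_field d (u (j + 1) n) z = 0"
          if "z \<in> Fn n 1" for z
          using F.u_alternating[OF j(1,2) that] .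
      qed (use j in auto)
    qed (use j in auto)
    have Hj: "pairing K d (H.b j) y = r j \<otimes>\<^bsub>K\<^esub> ?A"
      using r(2)[OF j(3)] cs.pairing_smult_left[OF F.b_V[OF j(3)] yV rK(1)] by simp
    have "pairing K d (H.b (j + 1)) y = r (j + 1) \<otimes>\<^bsub>K\<^esub> (ul (?Z j) \<otimes>\<^bsub>K\<^esub> ?A)"
      using r(2)[OF j(4)] cs.pairing_smult_left[OF F.b_V[OF j(4)] yV rK(2)] ratio by simp
    then have "r j \<otimes>\<^bsub>K\<^esub> ?A = \<ominus>\<^bsub>K\<^esub> (r (j + 1) \<otimes>\<^bsub>K\<^esub> (ul (?Z j) \<otimes>\<^bsub>K\<^esub> ?A))"
      using H.b_alternating[OF j(1,2) y(1)] Hj by simp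
    \<comment> \<open>The absolute value discards the minus sign from the alternation.\<close>
    from arg_cong[OF this, of av]
    have "av (r j) * av ?A = av (r (j + 1)) * (av (ul (?Z j)) * av ?A)"
      using rK A Zm by (simp add: absv_mult absv_uminus)
    moreover have "av ?A \<noteq> 0"
    proof -
      \<comment> \<open>The product of \<open>r j\<close> and \<open>?A\<close> is the value of
        \<open>H.b j\<close> at \<open>y\<close>, which is nonzero.\<close>
      have "?A \<noteq> \<zero>\<^bsub>K\<^esub>" using y(2) K.r_null[OF rK(1)] unfolding Hj by metis
      then show ?thesis using absv_eq_0_iff[OF A] by blast
    qed
    ultimately have "av (r j) = av (r (j + 1)) * av (ul (?Z j))" by simp
    moreover have "av (r (j + 1)) > 0" "av (ul (?Z j)) > 0"
      using r(1)[OF j(4)] absv_pos[OF ulim_closed[OF Zm] Z0] absv_pos by simp_all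
    ultimately have "ln (av (r j)) = ln (av (r (j + 1))) + ln (av (ul (?Z j)))"
      by (simp add: ln_mult)
    \<comment> \<open>The mean subtracted in \<open>rescaling_vector\<close> cancels in the
      difference, and \<open>val\<close> is \<open>- ln\<close> of the absolute value.\<close>
    then show ?thesis
      using j Z0 Zm by (simp add: val_eq_ln_absv x_def rescaling_vector_def)
  qed
  have unique: "z = x" if z: "z \<in> model_vectors d \<and>
      (\<forall>i\<in>{1..d - 1}. ereal (z (i + 1) - z i) = val U l (ul (?Z i)))" for z
  proof (rule model_vectors_eqI[OF _ x])
    fix i assume "i \<in> {1..d - 1}"
    then have "ereal (z (i + 1) - z i) = ereal (x (i + 1) - x i)" using z diff by simp
    then show "z (i + 1) - z i = x (i + 1) - x i" by simp
  qed (use z in simp)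
  have change: "marking_change d f f' = translation d x"
    unfolding f f' x_def by (rule marking_change_rescale[OF F.b_frame H.b_frame r])
  \<comment> \<open>Both frames lie on the lines that define the apartment, so it is the image of
    either marking.\<close>
  have img: "flag_apartment U l d E G = f ` model_apartment d"
    "flag_apartment U l d E G = f' ` model_apartment d"
    unfolding flag_apartment_def f f'
    by (rule apartment_eq[OF F.b_frame F.b_line] apartment_eq[OF H.b_frame H.b_line]; assumption)+
  have "flag_apartment U l d E G \<subseteq> building U l d"
    unfolding img(1) f by (rule standard_marking_building[OF F.b_frame])
  moreover have "bij_betw f (model_apartment d) (flag_apartment U l d E G)"
    using standard_marking_inj[OF F.b_frame] img(1) by (simp add: bij_betw_def f)
  moreover have "bij_betw f' (model_apartment d) (flag_apartment U l d E G)"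
    using standard_marking_inj[OF H.b_frame] img(2) by (simp add: bij_betw_def f')
  moreover have "marking_change d f f' \<in> affine_weyl d"
    unfolding change by (rule translation_affine_weyl[OF x])
  moreover have "\<exists>!x. x \<in> model_vectors d \<and>
      (\<forall>i\<in>{1..d - 1}. ereal (x (i + 1) - x i) = val U l (ul (?Z i)))"
    using x diff unique by blast
  ultimately show ?thesis using change unique by blast
qed

end
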